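(* Let $\psi\in F$, $\beta\in\mathbb{R}$, $n,p\in\mathbb{N}$, $p\leqslant n$. Then, as $n\to\infty$, $$\mathcal{E}(C^{\psi}_{\beta,\infty};U^{\psi}_{n,p})=\psi(n)\Big(\frac{4}{\pi^2}A^{\psi}_{n,p}+O(1)\Big),$$ where $$A^{\psi}_{n,p}=\begin{cases}\ln p, & \text{if } T(n)\leqslant 1,\\ \ln\frac{p}{T(n)}, & \text{if } 1\leqslant T(n)\leqslant p,\\ \ln\frac{T(n)}{p}, & \text{if } T(n)\geqslant p,\end{cases}$$ $T(t)=\eta(\psi;t)-t$, $\eta(\psi;n)=\psi^{-1}\big(\tfrac12\psi(n)\big)$, and $O(1)$ denotes a quantity bounded in absolute value uniformly with respect to $\beta$, $n$ and $p$.
   Context: $C$ is the space of continuous $2\pi$-periodic functions with $\|f\|_C=\max_x|f(x)|$. For $f\in C$, $a_k(f),b_k(f)$ are its Fourier coefficients, $A_0(f;x)=a_0(f)/2$, $A_k(f;x)=a_k(f)\cos kx+b_k(f)\sin kx$. $\mathfrak{M}$ is the set of all positive functions $\psi(t)$, $t\geqslant1$, that are convex (downward convex) and satisfy $\lim_{t\to\infty}\psi(t)=0$. For $\psi\in\mathfrak{M}$, $\eta(t)=\eta(\psi;t)=\psi^{-1}\big(\tfrac12\psi(t)\big)$, $t\geqslant1$, where $\psi^{-1}$ is the inverse function of $\psi$. $F=\{\psi\in\mathfrak{M}:\ \eta'(\psi;t)\leqslant K\ \ \forall t\geqslant1\}$ for some constant $K$ (depending on $\psi$). For $\psi\in F$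 and $\beta\in\mathbb{R}$, $C^{\psi}_{\beta,\infty}$ is the class of $f\in C$ such that the series $\sum_{k=1}^{\infty}\frac{1}{\psi(k)}\big(a_k(f)\cos(kx+\frac{\beta\pi}{2})+b_k(f)\sin(kx+\frac{\beta\pi}{2})\big)$ is the Fourier series of some function $\varphi$ with $\operatorname{ess\,sup}_t|\varphi(t)|\leqslant1$; this $\varphi$ is denoted $f^{\psi}_{\beta}$ (the $(\psi,\beta)$-derivative of $f$). Here $\psi(k)$ are the values of the function $\psi$ at natural numbers. For $n,p\in\mathbb{N}$, $1\leqslant p\leqslant n$, and $f\in C$, $U^{\psi}_{n,p}(f;x)=\sum_{k=0}^{n-1}\lambda_{n,p}(k)A_k(f;x)$, where $\lambda_{n,p}(k)=1$ for $0\leqslant k\leqslant n-p$ and $\lambda_{n,p}(k)=1-\frac{\varphi(k)}{\varphi(n)}$ for $n-p+1\leqslant k\leqslant n-1$, with $\varphi(k)=\frac{k-n+p}{\psi(k)}$ (so $\varphi(n)=p/\psi(n)$). $\mathcal{E}(C^{\psi}_{\beta,\infty};U^{\psi}_{n,p})=\sup_{f\in C^{\psi}_{\beta,\infty}}\|f(\cdot)-U^{\psi}_{n,p}(f;\cdot)\|_C$. *)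

theory Defs
  imports "HOL-Analysis.Analysis"
begin

definition in_C :: "(real \<Rightarrow> real) \<Rightarrow> bool" where
  "in_C f \<longleftrightarrow> continuous_on UNIV f \<and> (\<forall>x. f (x + 2*pi) = f x)"

definition normC :: "(real \<Rightarrow> real) \<Rightarrow> real" where
  "normC g = Sup (range (\<lambda>x. \<bar>g x\<bar>))"

definition fa :: "nat \<Rightarrow> (real \<Rightarrow> real) \<Rightarrow> real" where
  "fa k f = (LBINT x:{-pi..pi}. f x * cos (real k * x)) / pi"

definition fb :: "nat \<Rightarrow> (real \<Rightarrow> real) \<Rightarrow> real" where
  "fb k f = (LBINT x:{-pi..pi}. f x * sin (real k * x)) / pi"

definition fA :: "nat \<Rightarrow> (real \<Rightarrow> real) \<Rightarrow> real \<Rightarrow> real" where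
  "fA k f x = (if k = 0 then fa 0 f / 2 else fa k f * cos (real k * x) + fb k f * sin (real k * x))"

definition in_M :: "(real \<Rightarrow> real) \<Rightarrow> bool" where
  "in_M \<psi> \<longleftrightarrow> (\<forall>t\<ge>1. \<psi> t > 0) \<and> convex_on {1..} \<psi> \<and> (\<psi> \<longlongrightarrow> 0) at_top"

definition eta :: "(real \<Rightarrow> real) \<Rightarrow> real \<Rightarrow> real" where
  "eta \<psi> t = the_inv_into {1..} \<psi> (\<psi> t / 2)"

text \<open>The class F; eta' is understood as the right derivative eta'(t+0).\<close>
definition in_F :: "(real \<Rightarrow> real) \<Rightarrow> bool" where
  "in_F \<psi> \<longleftrightarrow> in_M \<psi> \<and>
     (\<exists>K. \<forall>t\<ge>1. \<exists>D. (eta \<psi> has_real_derivative D) (at_right t) \<and> D \<le> K)"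

text \<open>The class C^psi_{beta,oo}: the series sum_{k>=1} psi(k)^{-1}(a_k cos(kx+beta pi/2) + b_k sin(kx+beta pi/2))
  is the Fourier series of a measurable phi with ess sup |phi| <= 1; written out coefficientwise
  (constant term 0, cos- and sin-coefficients of the rotated series).\<close>
definition Cpsi :: "(real \<Rightarrow> real) \<Rightarrow> real \<Rightarrow> (real \<Rightarrow> real) set" where
  "Cpsi \<psi> \<beta> = {f. in_C f \<and> (\<exists>\<phi>. \<phi> \<in> borel_measurable lborel \<and> (AE x in lborel. \<bar>\<phi> x\<bar> \<le> 1) \<and>
      fa 0 \<phi> = 0 \<and>
      (\<forall>k\<ge>1. fa k \<phi> = (fa k f * cos (\<beta>*pi/2) + fb k f * sin (\<beta>*pi/2)) / \<psi> (real k) \<and>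
              fb k \<phi> = (fb k f * cos (\<beta>*pi/2) - fa k f * sin (\<beta>*pi/2)) / \<psi> (real k)))}"

definition lam :: "(real \<Rightarrow> real) \<Rightarrow> nat \<Rightarrow> nat \<Rightarrow> nat \<Rightarrow> real" where
  "lam \<psi> n p k = (if k \<le> n - p then 1
     else 1 - ((real k - real n + real p) / \<psi> (real k)) / (real p / \<psi> (real n)))"

definition U :: "(real \<Rightarrow> real) \<Rightarrow> nat \<Rightarrow> nat \<Rightarrow> (real \<Rightarrow> real) \<Rightarrow> real \<Rightarrow> real" where
  "U \<psi> n p f x = (\<Sum>k<n. lam \<psi> n p k * fA k f x)"

definition Err :: "(real \<Rightarrow> real) \<Rightarrow> real \<Rightarrow> nat \<Rightarrow> nat \<Rightarrow> ereal" where
  "Err \<psi> \<beta> n p = (SUP f\<in>Cpsi \<psi> \<beta>. ereal (normC (\<lambda>x. f x - U \<psi> n p f x)))"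

definition Tfun :: "(real \<Rightarrow> real) \<Rightarrow> real \<Rightarrow> real" where
  "Tfun \<psi> t = eta \<psi> t - t"

definition Apsi :: "(real \<Rightarrow> real) \<Rightarrow> nat \<Rightarrow> nat \<Rightarrow> real" where
  "Apsi \<psi> n p = (let T = Tfun \<psi> (real n) in
     if T \<le> 1 then ln (real p)
     else if T \<le> real p then ln (real p / T)
     else ln (T / real p))"

end

theory Submission
  imports Defs
begin

text \<open>
  For \<open>f\<close> in the class with derivative \<open>\<phi>\<close>, the deviation \<open>f - U f\<close> is \<open>\<psi> n / pi\<close> times the convolution
  of \<open>\<phi>\<close> with a cosine kernel whose multipliers rise linearly from \<open>0\<close> to \<open>1\<close> on \<open>[n - p, n]\<close> and then
  decay like \<open>\<psi> k / \<psi> n\<close>. Summation by parts turns the kernel into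
  \<open>(S\<^sub>2 - S\<^sub>1) / (2 sin (t / 2))\<close>, where \<open>S\<^sub>1\<close> and \<open>S\<^sub>2\<close> are weighted means of \<open>sin ((k + 1/2) t - \<theta>)\<close> over
  the \<open>p\<close> frequencies below \<open>n\<close> and over the frequencies above \<open>n\<close>. Such a mean behaves like
  \<open>sin (n t - \<theta>)\<close> for \<open>t\<close> below the reciprocal of its bandwidth and is negligible beyond it; the
  bandwidths are \<open>p\<close> and \<open>T = max 1 (T n)\<close>. Hence, up to \<open>O(1)\<close> in the mean, the kernel is
  \<open>\<plusminus> sin (n t - \<theta>) / t\<close> on the range of \<open>|t|\<close> between \<open>1/p\<close> and \<open>1/T\<close>, and its norm is \<open>4 / pi\<close> times
  \<open>|ln (p / T)|\<close> because \<open>|sin|\<close> has mean \<open>2 / pi\<close>. The class \<open>F\<close> enters through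
  \<open>(\<psi> n - \<psi> (n+1)) T \<le> K \<psi> n\<close>, through \<open>T (\<eta> t) \<le> K T t\<close>, which forces power decay on the scale
  \<open>T\<close>, and through \<open>T n = O(n)\<close>.
\<close>

section \<open>Preliminaries from real analysis\<close>

text \<open>The sum of the values \<open>\<psi> k\<close> may diverge, so the full kernel is not an
  absolutely convergent series. All work is therefore done at a finite cutoff \<open>N\<close>, with
  bounds independent of \<open>N\<close>. The upper bound lets \<open>N\<close> tend to infinity.
  The lower bound takes a single \<open>N\<close> beyond \<open>n + T + n\<^sup>2\<close>:
  normalising the test function then costs a factor \<open>1 - O(1/n)\<close>, which is harmless
  because \<open>A\<close> is at most of order \<open>n\<close>. A family of decreasing weights
  \<open>d\<close> with sum \<open>1\<close> is judged by two numbers only: its logarithmic moment,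
  the sum of \<open>d k * ln (1 + \<bar>k + 1/2 - n\<bar> / R)\<close>, and the product of its
  largest weight with \<open>R\<close>. A correct bandwidth \<open>R\<close> is one for which both
  stay bounded. The parameter \<open>\<beta>\<close> appears only as a phase
  \<open>\<theta>\<close>. The oscillatory integrals are estimated through the oscillation of a
  periodic primitive, which no phase can change; this is the source of uniformity in
  \<open>\<beta>\<close>. Reflecting \<open>t\<close> turns \<open>\<theta>\<close> into
  \<open>- \<theta>\<close>, so it suffices to treat \<open>[0, pi]\<close> with arbitrary
  phase.\<close>

lemma right_derivative_le_imp_increment_le:
  fixes f :: "real \<Rightarrow> real"
  assumes ab: "a \<le> b" and cont: "continuous_on {a..b} f"
    and der: "\<And>x. a \<le> x \<Longrightarrow> x < b \<Longrightarrow> \<exists>D. (f has_real_derivative D) (at_right x) \<and> D \<le> K"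
  shows "f b - f a \<le> K * (b - a)"
proof -
  \<comment> \<open>With only a one-sided derivative the mean value theorem does not apply. For
    \<open>L\<close> strictly above \<open>K\<close>, the last point at which \<open>f\<close> lies
    on or below the line of slope \<open>L\<close> can be pushed to the right unless it is
    \<open>b\<close>; afterwards \<open>L\<close> decreases to \<open>K\<close>.\<close>
  have key: "f b - f a \<le> L * (b - a)" if L: "K < L" for L
  proof -
    define g where "g x = f x - f a - L * (x - a)" for x
    define S where "S = {x \<in> {a..b}. g x \<le> 0}"
    have cg: "continuous_on {a..b} g"
      unfolding g_def by (intro continuous_intros cont)
    have closed: "closed S" 
      unfolding S_def using continuous_closed_preimage[OF cg closed_atLeastAtMost closed_atMost[of 0]]
      by (simp add: vimage_def Int_def)
    have aS: "a \<in> S" using ab by (auto simp: S_def g_def)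
    have bdd: "bdd_above S" by (auto simp: S_def)
    define s where "s = Sup S"
    have sS: "s \<in> S" unfolding s_def using closed_contains_Sup aS bdd closed by blast
    have "s = b"
    proof (rule ccontr)
      assume "s \<noteq> b"
      hence s: "a \<le> s" "s < b" using sS by (auto simp: S_def)
      obtain D where D: "(f has_real_derivative D) (at_right s)" "D \<le> K" using der[OF s] by auto
      have "((\<lambda>y. (f y - f s) / (y - s)) \<longlongrightarrow> D) (at_right s)"
        using D(1) by (simp add: has_field_derivative_iff)
      hence "eventually (\<lambda>y. (f y - f s) / (y - s) < L) (at_right s)"
        using D(2) L by (auto intro: order_tendstoD(2))
      moreover have "eventually (\<lambda>y. y \<in> {s<..<b}) (at_right s)"
        using s(2) by (rule eventually_at_right_real)
      ultimately have "eventually (\<lambda>y. (f y - f s) / (y - s) < L \<and> y \<in> {s<..<b}) (at_right s)"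
        by eventually_elim auto
      then obtain y where y: "(f y - f s) / (y - s) < L" "s < y" "y < b"
        by (auto dest!: eventually_happens)
      have "f y - f s < L * (y - s)" using y by (simp add: field_simps)
      hence "g y \<le> 0" using sS by (auto simp: S_def g_def algebra_simps)
      hence "y \<in> S" using y s by (auto simp: S_def)
      hence "y \<le> s" unfolding s_def using bdd by (rule cSup_upper)
      thus False using y by simp
    qed
    thus ?thesis using sS by (simp add: S_def g_def)
  qed
  show ?thesis
  proof (cases "a = b")
    case False
    hence "a < b" using ab by simp
    show ?thesis
    proof (rule field_le_epsilon)
      fix e :: real assume "e > 0"
      hence "f b - f a \<le> (K + e / (b - a)) * (b - a)" using \<open>a < b\<close> by (intro key) auto
      thus "f b - f a \<le> K * (b - a) + e" using \<open>a < b\<close> by (simp add: distrib_right)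
    qed
  qed simp
qed

lemma set_integral_FTC_Icc:
  fixes F f :: "real \<Rightarrow> real"
  assumes "a \<le> b" "\<And>x. a \<le> x \<Longrightarrow> x \<le> b \<Longrightarrow> (F has_real_derivative f x) (at x)"
    "\<And>x. a \<le> x \<Longrightarrow> x \<le> b \<Longrightarrow> isCont f x"
  shows "(LBINT x:{a..b}. f x) = F b - F a"
proof -
  have "(\<integral>x. f x * indicator {a..b} x \<partial>lborel) = F b - F a"
    using assms by (intro integral_FTC_Icc_real) auto
  thus ?thesis by (simp add: set_lebesgue_integral_def mult.commute)
qed

lemma set_integral_FTC_real:
  fixes F f :: "real \<Rightarrow> real"
  assumes "a \<le> b" "\<And>x. (F has_real_derivative f x) (at x)" "continuous_on UNIV f"
  shows "(LBINT x:{a..b}. f x) = F b - F a"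
  using assms by (intro set_integral_FTC_Icc) (auto simp: continuous_on_eq_continuous_at)

lemma periodic_int:
  fixes G :: "real \<Rightarrow> 'a" and L :: real
  assumes p: "\<And>x. G (x + L) = G x" shows "G (x + L * of_int m) = G x"
proof -
  have nat: "G (x + L * real j) = G x" for x j
  proof (induction j)
    case (Suc j)
    thus ?case using p[of "x + L * real j"] by (simp add: algebra_simps)
  qed simp
  show ?thesis
  proof (cases m)
    case (nonneg j) thus ?thesis using nat by simp
  next
    case (neg j)
    hence "of_int m = - real (Suc j)" by simp
    hence "x + L * of_int m + L * real (Suc j) = x" by (simp only: mult_minus_right)
    thus ?thesis using nat[of "x + L * of_int m" "Suc j"] by (simp only:)
  qed
qed

lemma continuous_antiderivative:
  fixes g :: "real \<Rightarrow> real"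
  assumes "continuous_on UNIV g"
  obtains G where "\<And>y. (G has_real_derivative g y) (at y)"
  using einterval_antiderivative[of "-\<infinity>" "\<infinity>" g] assms
  by (auto simp: continuous_on_eq_continuous_at has_real_derivative_iff_has_vector_derivative)

section \<open>The classes of generating functions\<close>

locale class_M =
  fixes \<psi> :: "real \<Rightarrow> real"
  assumes in_M: "in_M \<psi>"
begin

lemma pos: "t \<ge> 1 \<Longrightarrow> \<psi> t > 0"
  and convex: "convex_on {1..} \<psi>"
  and tendsto_0: "(\<psi> \<longlongrightarrow> 0) at_top"
  using in_M by (auto simp: in_M_def)

lemma three_slopes:
  assumes "1 \<le> x" "x < y" "y < z"
  shows "(\<psi> x - \<psi> y) / (y - x) \<ge> (\<psi> y - \<psi> z) / (z - y)"
proof -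
  have "(\<psi> x - \<psi> y) / (x - y) \<le> (\<psi> y - \<psi> z) / (y - z)"
  proof -
    have "(\<psi> x - \<psi> y) / (x - y) \<le> (\<psi> x - \<psi> z) / (x - z)"
      "(\<psi> x - \<psi> z) / (x - z) \<le> (\<psi> y - \<psi> z) / (y - z)"
      using convex_on_slope_le[OF convex] assms by auto
    thus ?thesis by linarith
  qed
  thus ?thesis using assms by (simp add: field_simps)
qed

text \<open>If \<open>\<psi>\<close> failed to drop between \<open>s\<close> and \<open>t\<close>,
  convexity would keep it at or above \<open>\<psi> t > 0\<close> from \<open>t\<close> on, against
  the limit \<open>0\<close>.\<close>

lemma strict_decreasing:
  assumes "1 \<le> s" "s < t" shows "\<psi> t < \<psi> s"
proof (rule ccontr)
  assume *: "\<not> \<psi> t < \<psi> s"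
  have "\<psi> u \<ge> \<psi> t" if "u > t" for u
  proof -
    have "(\<psi> t - \<psi> u) / (u - t) \<le> (\<psi> s - \<psi> t) / (t - s)" using three_slopes assms that by auto
    also have "\<dots> \<le> 0" using * assms by (auto simp: divide_le_0_iff)
    finally show ?thesis using that by (auto simp: divide_le_0_iff)
  qed
  hence "eventually (\<lambda>u. \<psi> t \<le> \<psi> u) at_top"
    by (rule eventually_mono[OF eventually_gt_at_top[of t]])
  moreover have "\<psi> t > 0" using pos assms by auto
  hence "eventually (\<lambda>u. \<psi> u < \<psi> t) at_top" using tendsto_0 by (rule order_tendstoD(2)[rotated])
  ultimately have "eventually (\<lambda>u. False) (at_top :: real filter)"
    by eventually_elim simp
  thus False by simp
qed

lemma decreasing: "1 \<le> s \<Longrightarrow> s \<le> t \<Longrightarrow> \<psi> t \<le> \<psi> s"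
  using strict_decreasing[of s t] by (cases "s = t") auto

lemma inj: "inj_on \<psi> {1..}"
proof (rule linorder_inj_onI')
  fix i j :: real assume "i \<in> {1..}" "j \<in> {1..}" "i < j"
  thus "\<psi> i \<noteq> \<psi> j" using strict_decreasing[of i j] by auto
qed

text \<open>The half-line is open because a convex function may jump up at its endpoint
  \<open>1\<close>; half of \<open>\<psi> 1\<close> may then be no value of \<open>\<psi>\<close>.
  Hence \<open>1 < t\<close> in the facts on \<open>eta\<close>, and \<open>2 \<le> n\<close>
  later.\<close>

lemma continuous: "continuous_on {1<..} \<psi>"
  by (rule convex_on_continuous) (auto intro: convex_on_subset[OF convex])

lemma eta_props:
  assumes "1 < t" shows "t < eta \<psi> t" "\<psi> (eta \<psi> t) = \<psi> t / 2"
proof -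
  have pt: "\<psi> t > 0" using pos assms by auto
  hence "eventually (\<lambda>u. \<psi> u < \<psi> t / 2) at_top" using tendsto_0 by (intro order_tendstoD(2)) auto
  moreover have "eventually (\<lambda>u. u > t) at_top" by (rule eventually_gt_at_top)
  ultimately have "eventually (\<lambda>u. \<psi> u < \<psi> t / 2 \<and> u > t) at_top" by eventually_elim auto
  then obtain u where u: "\<psi> u < \<psi> t / 2" "u > t" by (auto dest!: eventually_happens)
  have "\<exists>s. t \<le> s \<and> s \<le> u \<and> \<psi> s = \<psi> t / 2"
    using assms u pt by (intro IVT2' continuous_on_subset[OF continuous]) auto
  then obtain s where s: "t \<le> s" "\<psi> s = \<psi> t / 2" by auto
  have "s \<noteq> t" using s pt by auto
  have "eta \<psi> t = s" unfolding eta_def s(2)[symmetric]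
    using assms s by (intro the_inv_into_f_f inj) auto
  thus "t < eta \<psi> t" "\<psi> (eta \<psi> t) = \<psi> t / 2" using s \<open>s \<noteq> t\<close> by auto
qed

lemma eta_mono:
  assumes "1 < s" "s \<le> t" shows "eta \<psi> s \<le> eta \<psi> t"
proof (rule ccontr)
  assume "\<not> ?thesis"
  hence "\<psi> (eta \<psi> s) < \<psi> (eta \<psi> t)"
    using eta_props[of t] assms by (intro strict_decreasing) auto
  thus False using eta_props[of s] eta_props[of t] decreasing[of s t] assms by auto
qed

lemma continuous_eta:
  assumes "1 < a" "a \<le> b" shows "continuous_on {a..b} (eta \<psi>)"
proof -
  have "continuous_on (\<psi> ` {a..eta \<psi> b}) (the_inv_into {1..} \<psi>)"
    using assms by (intro continuous_on_inv continuous_on_subset[OF continuous])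
      (auto intro!: the_inv_into_f_f inj)
  moreover have "continuous_on {a..b} (\<lambda>t. \<psi> t / 2)"
    using assms by (intro continuous_intros continuous_on_subset[OF continuous]) auto
  moreover have "(\<lambda>t. \<psi> t / 2) ` {a..b} \<subseteq> \<psi> ` {a..eta \<psi> b}"
  proof safe
    fix t assume "t \<in> {a..b}"
    hence "\<psi> t / 2 = \<psi> (eta \<psi> t)" "eta \<psi> t \<in> {a..eta \<psi> b}"
      using eta_props[of t] eta_mono[of t b] assms by auto
    thus "\<psi> t / 2 \<in> \<psi> ` {a..eta \<psi> b}" by blast
  qed
  ultimately have "continuous_on {a..b} (\<lambda>t. the_inv_into {1..} \<psi> (\<psi> t / 2))"
    by (rule continuous_on_compose2)
  thus ?thesis unfolding eta_def .
qed

end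

section \<open>Consequences of a bounded derivative of \<open>eta\<close>\<close>

locale class_F = class_M +
  fixes K :: real
  assumes K_ge_1: "K \<ge> 1"
    and eta_deriv: "\<And>t. t \<ge> 1 \<Longrightarrow> \<exists>D. (eta \<psi> has_real_derivative D) (at_right t) \<and> D \<le> K"
begin

lemma eta_lipschitz: "1 < a \<Longrightarrow> a \<le> b \<Longrightarrow> eta \<psi> b - eta \<psi> a \<le> K * (b - a)"
  by (intro right_derivative_le_imp_increment_le continuous_eta eta_deriv) auto

lemma Tfun_pos: "1 < t \<Longrightarrow> Tfun \<psi> t > 0"
  using eta_props[of t] by (simp add: Tfun_def)

lemma Tfun_eta: "1 < t \<Longrightarrow> Tfun \<psi> (eta \<psi> t) \<le> K * Tfun \<psi> t"
  using eta_lipschitz[of t "eta \<psi> t"] eta_props[of t] by (simp add: Tfun_def)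

lemma Tfun_le_linear:
  assumes "2 \<le> t" shows "Tfun \<psi> t \<le> (K + eta \<psi> 2) * t"
proof -
  have "eta \<psi> t \<le> eta \<psi> 2 + K * (t - 2)" using eta_lipschitz[of 2 t] assms by simp
  also have "\<dots> \<le> eta \<psi> 2 * t + K * t"
    using assms K_ge_1 eta_props(1)[of 2] by (intro add_mono mult_left_mono) (auto simp: mult_le_cancel_left1)
  finally show ?thesis using assms by (simp add: Tfun_def algebra_simps)
qed

text \<open>Convexity bounds the slope at \<open>t\<close> from the wrong side. The step from
  \<open>t\<close> to \<open>t + 1\<close> is therefore carried past the halving point: it is at
  most twice the drop of \<open>\<psi>\<close> on \<open>[eta t, eta t + K]\<close>, and there the
  slope is at most the mean slope on \<open>[t, eta t]\<close>, namely
  \<open>\<psi> t / (2 * T)\<close>.\<close>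

lemma first_difference_le:
  assumes "1 < t" shows "(\<psi> t - \<psi> (t + 1)) * Tfun \<psi> t \<le> K * \<psi> t"
proof -
  let ?e = "eta \<psi> t"
  have e: "t < ?e" "\<psi> ?e = \<psi> t / 2" using eta_props assms by auto
  have "eta \<psi> (t + 1) \<le> ?e + K" using eta_lipschitz[of t "t + 1"] assms by simp
  moreover have "1 \<le> eta \<psi> (t + 1)" using eta_props(1)[of "t+1"] assms by simp
  ultimately have "\<psi> (?e + K) \<le> \<psi> (t + 1) / 2"
    using eta_props(2)[of "t+1"] decreasing[of "eta \<psi> (t+1)" "?e + K"] assms by simp
  hence 1: "\<psi> t - \<psi> (t + 1) \<le> 2 * (\<psi> ?e - \<psi> (?e + K))" using e by simp
  have "(\<psi> ?e - \<psi> (?e + K)) / K \<le> (\<psi> t - \<psi> ?e) / Tfun \<psi> t"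
    using three_slopes[of t ?e "?e + K"] e(1) K_ge_1 assms by (simp add: Tfun_def)
  hence "(\<psi> ?e - \<psi> (?e + K)) * Tfun \<psi> t \<le> K * (\<psi> t / 2)"
    using Tfun_pos[OF assms] K_ge_1 e by (simp add: field_simps)
  moreover have "(\<psi> t - \<psi> (t + 1)) * Tfun \<psi> t \<le> 2 * (\<psi> ?e - \<psi> (?e + K)) * Tfun \<psi> t"
    using 1 Tfun_pos[OF assms] by (intro mult_right_mono) auto
  ultimately show ?thesis by (simp add: algebra_simps)
qed

text \<open>Each halving of \<open>\<psi>\<close> takes a step at most \<open>K\<close> times as
  long as the one before, so \<open>j\<close> halvings cover at most a geometric sum;
  \<open>(K + 1) ^ j\<close> is a convenient majorant for the induction.\<close>

lemma distance_le_Tfun_power: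
  assumes "1 < t" "\<psi> t \<le> 2 ^ j * \<psi> x" "t \<le> x"
  shows "x - t \<le> Tfun \<psi> t * (K + 1) ^ j"
  using assms
proof (induction j arbitrary: t)
  case 0
  hence "x = t" using strict_decreasing[of t x] by (cases "t < x") auto
  thus ?case using 0 Tfun_pos[of t] by simp
next
  case (Suc j)
  note T = Tfun_pos[OF Suc.prems(1)]
  have K1: "(K + 1) ^ j \<ge> 1" "K * (K + 1) ^ j \<ge> 0" using K_ge_1 by (auto intro: one_le_power)
  show ?case
  proof (cases "x \<le> eta \<psi> t")
    case True
    hence "x - t \<le> Tfun \<psi> t * 1" by (simp add: Tfun_def)
    also have "\<dots> \<le> Tfun \<psi> t * (K + 1) ^ Suc j"
      using T K_ge_1 by (intro mult_left_mono one_le_power) auto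
    finally show ?thesis .
  next
    case False
    have "x - eta \<psi> t \<le> Tfun \<psi> (eta \<psi> t) * (K + 1) ^ j"
      using False Suc.prems eta_props[of t] by (intro Suc.IH) (auto simp: field_simps)
    also have "\<dots> \<le> K * Tfun \<psi> t * (K + 1) ^ j"
      using Tfun_eta[OF Suc.prems(1)] K1 by (intro mult_right_mono) auto
    finally have "x - t \<le> Tfun \<psi> t * (1 + K * (K + 1) ^ j)" by (simp add: Tfun_def algebra_simps)
    also have "\<dots> \<le> Tfun \<psi> t * (K + 1) ^ Suc j"
      using K1 T by (intro mult_left_mono) (auto simp: algebra_simps)
    finally show ?thesis .
  qed
qed

text \<open>The logarithm of the distance grows only linearly in the number of halvings, which is
  logarithmic in \<open>\<psi> t / \<psi> x\<close>. It is weakened to a square root because that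
  form telescopes when summed against differences.\<close>

lemma ln_distance_le:
  assumes t: "1 < t" "t \<le> x" and R: "R \<ge> 1" "R \<ge> Tfun \<psi> t"
  shows "ln (1 + (x + 1/2 - t) / R) \<le> 4 * ln (K + 3) / sqrt (\<psi> x / \<psi> t)"
proof -
  have px: "\<psi> x > 0" "\<psi> t > 0" using pos t by auto
  define y where "y = \<psi> t / \<psi> x"
  have y1: "y \<ge> 1" using decreasing[of t x] px t by (simp add: y_def)
  \<comment> \<open>Minimality gives \<open>2 ^ (j - 1) \<le> y < 2 ^ j\<close>: the upper half
    feeds the distance estimate, the lower half bounds \<open>j\<close> in terms of
    \<open>y\<close>.\<close>
  define j where "j = (LEAST j. y < 2 ^ j)"
  have "\<exists>j. y < 2 ^ j" using real_arch_pow[of 2 y] by auto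
  hence jy: "y < 2 ^ j" unfolding j_def by (rule LeastI_ex)
  hence "j \<noteq> 0" using y1 by (cases "j = 0") auto
  then obtain i where i: "j = Suc i" by (cases j) auto
  have "\<not> y < 2 ^ i" using not_less_Least[of i "\<lambda>j. y < 2 ^ j"] i unfolding j_def by auto
  hence iy: "2 ^ i \<le> y" by simp
  have "\<psi> t \<le> 2 ^ j * \<psi> x" using jy px by (simp add: y_def field_simps)
  from distance_le_Tfun_power[OF t(1) this t(2)]
  have "x - t \<le> Tfun \<psi> t * (K + 1) ^ j" .
  also have "\<dots> \<le> R * (K + 1) ^ j" using R K_ge_1 by (intro mult_right_mono) auto
  finally have "(x - t) / R \<le> (K + 1) ^ j" using R by (simp add: field_simps)
  moreover have "(1/2) / R \<le> 1" using R by simp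
  ultimately have "1 + (x + 1/2 - t) / R \<le> 2 + (K + 1) ^ j" using R by (simp add: field_simps)
  also have "\<dots> \<le> (K + 3) ^ j"
  proof -
    have "(K + 1) ^ i \<le> (K + 3) ^ i" "1 \<le> (K + 3) ^ i" using K_ge_1 by (auto intro: power_mono one_le_power)
    moreover from this have "(K + 1) * (K + 1) ^ i \<le> (K + 1) * (K + 3) ^ i"
      using K_ge_1 by (intro mult_left_mono) auto
    ultimately show ?thesis unfolding i by (simp add: algebra_simps)
  qed
  finally have "ln (1 + (x + 1/2 - t) / R) \<le> ln ((K + 3) ^ j)"
    using t R by (intro ln_mono) (auto intro: add_pos_nonneg)
  also have "\<dots> = real j * ln (K + 3)" using K_ge_1 by (simp add: ln_realpow)
  also have "\<dots> \<le> 4 * sqrt y * ln (K + 3)"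
  proof (intro mult_right_mono)
    have "(real (Suc i))\<^sup>2 \<le> 16 * 2 ^ i"
    proof (induction i)
      case (Suc i)
      show ?case
      proof (cases "i = 0 \<or> i = 1")
        case False
        hence "(real (Suc (Suc i)))\<^sup>2 \<le> 2 * (real (Suc i))\<^sup>2"
        proof -
          have "2 * 2 \<le> real i * real i" using False by (intro mult_mono) auto
          thus ?thesis by (simp add: power2_eq_square algebra_simps)
        qed
        thus ?thesis using Suc by simp
      qed auto
    qed simp
    also have "\<dots> \<le> 16 * y" using iy by simp
    finally have "real (Suc i) \<le> sqrt (16 * y)" by (rule real_le_rsqrt)
    thus "real j \<le> 4 * sqrt y" by (simp add: i real_sqrt_mult)
  qed (use K_ge_1 in auto)
  also have "\<dots> = 4 * ln (K + 3) / sqrt (\<psi> x / \<psi> t)"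
    by (simp add: y_def real_sqrt_divide)
  finally show ?thesis .
qed

end

section \<open>Fourier coefficients\<close>

lemma set_integrable_continuous_real:
  fixes f :: "real \<Rightarrow> real"
  assumes "continuous_on UNIV f" shows "set_integrable lborel {a..b} f"
  using assms by (intro borel_integrable_atLeastAtMost' continuous_on_subset[OF assms]) auto

lemma LBINT_cos_int: "(LBINT t:{-pi..pi}. cos (real_of_int m * t)) = (if m = 0 then 2 * pi else 0)"
proof (cases "m = 0")
  case True
  have "(LBINT t:{-pi..pi}. (1::real)) = pi - (-pi)"
    by (rule set_integral_FTC_real) (auto intro!: derivative_eq_intros)
  thus ?thesis using True by simp
next
  case False
  have "(LBINT t:{-pi..pi}. cos (real_of_int m * t)) = sin (real_of_int m * pi) / m - sin (real_of_int m * (-pi)) / m"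
    using False by (intro set_integral_FTC_real continuous_intros) (auto intro!: derivative_eq_intros)
  also have "\<dots> = 0" using sin_npi_int[of m] by (simp add: mult.commute)
  finally show ?thesis using False by simp
qed

lemma LBINT_sin_int: "(LBINT t:{-pi..pi}. sin (real_of_int m * t)) = 0"
proof (cases "m = 0")
  case False
  have "(LBINT t:{-pi..pi}. sin (real_of_int m * t)) = - cos (real_of_int m * pi) / m - (- cos (real_of_int m * (-pi)) / m)"
    using False by (intro set_integral_FTC_real continuous_intros) (auto intro!: derivative_eq_intros)
  thus ?thesis by simp
qed (simp add: set_lebesgue_integral_def)

lemma LBINT_cos_cos:
  "(LBINT t:{-pi..pi}. cos (real j * t) * cos (real k * t)) = (if j = k then if j = 0 then 2 * pi else pi else 0)"
proof -
  have "(LBINT t:{-pi..pi}. cos (real j * t) * cos (real k * t)) =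
     (LBINT t:{-pi..pi}. (cos (real_of_int (int j - int k) * t) + cos (real_of_int (int j + int k) * t)) / 2)"
    by (intro set_lebesgue_integral_cong) (auto simp: cos_times_cos algebra_simps)
  also have "\<dots> = ((if int j - int k = 0 then 2 * pi else 0) + (if int j + int k = 0 then 2 * pi else 0)) / 2"
    by (simp only: set_integral_divide_zero LBINT_cos_int[symmetric])
       (subst set_integral_add; (intro set_integrable_continuous_real continuous_intros)?; simp)
  finally show ?thesis by auto
qed

lemma LBINT_sin_sin:
  "(LBINT t:{-pi..pi}. sin (real j * t) * sin (real k * t)) = (if j = k \<and> j \<noteq> 0 then pi else 0)"
proof -
  have "(LBINT t:{-pi..pi}. sin (real j * t) * sin (real k * t)) =
     (LBINT t:{-pi..pi}. (cos (real_of_int (int j - int k) * t) - cos (real_of_int (int j + int k) * t)) / 2)"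
    by (intro set_lebesgue_integral_cong) (auto simp: sin_times_sin algebra_simps)
  also have "\<dots> = ((if int j - int k = 0 then 2 * pi else 0) - (if int j + int k = 0 then 2 * pi else 0)) / 2"
    by (simp only: set_integral_divide_zero LBINT_cos_int[symmetric])
       (subst set_integral_diff; (intro set_integrable_continuous_real continuous_intros)?; simp)
  finally show ?thesis by auto
qed

lemma LBINT_sin_cos:
  "(LBINT t:{-pi..pi}. sin (real j * t) * cos (real k * t)) = 0"
proof -
  have "(LBINT t:{-pi..pi}. sin (real j * t) * cos (real k * t)) =
     (LBINT t:{-pi..pi}. (sin (real_of_int (int j + int k) * t) + sin (real_of_int (int j - int k) * t)) / 2)"
    by (intro set_lebesgue_integral_cong) (auto simp: sin_add sin_diff algebra_simps)
  also have "\<dots> = (0 + 0) / 2"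
    unfolding LBINT_sin_int[of "int j + int k", symmetric]
    by (simp only: set_integral_divide_zero)
       (subst set_integral_add; (intro set_integrable_continuous_real continuous_intros)?; simp only: LBINT_sin_int)
  finally show ?thesis by simp
qed

lemma set_integral_sum_real:
  fixes g :: "'i \<Rightarrow> 'a \<Rightarrow> real"
  assumes "\<And>i. i \<in> A \<Longrightarrow> set_integrable M S (g i)"
  shows "set_lebesgue_integral M S (\<lambda>t. \<Sum>i\<in>A. g i t) = (\<Sum>i\<in>A. set_lebesgue_integral M S (g i))"
  using assms unfolding set_lebesgue_integral_def set_integrable_def
  by (simp add: scaleR_sum_right sum_distrib_left Bochner_Integration.integral_sum)

lemma LBINT_sum_continuous:
  fixes g :: "'i \<Rightarrow> real \<Rightarrow> real"
  assumes "\<And>i. i \<in> A \<Longrightarrow> continuous_on UNIV (g i)"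
  shows "(LBINT t:{a..b}. (\<Sum>i\<in>A. g i t)) = (\<Sum>i\<in>A. LBINT t:{a..b}. g i t)"
  using assms by (intro set_integral_sum_real set_integrable_continuous_real) auto

lemma fa_trig_sum:
  "fa j (\<lambda>t. \<Sum>k=1..M. \<alpha> k * cos (real k * t) + \<beta> k * sin (real k * t)) = (if j \<in> {1..M} then \<alpha> j else 0)"
proof -
  have "(LBINT t:{-pi..pi}. (\<Sum>k=1..M. \<alpha> k * cos (real k * t) + \<beta> k * sin (real k * t)) * cos (real j * t))
      = (LBINT t:{-pi..pi}. \<Sum>k=1..M. (\<alpha> k * (cos (real k * t) * cos (real j * t)) + \<beta> k * (sin (real k * t) * cos (real j * t))))"
    unfolding sum_distrib_right by (intro set_lebesgue_integral_cong allI impI sum.cong refl) (auto simp: algebra_simps)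
  also have "\<dots> = (\<Sum>k=1..M. LBINT t:{-pi..pi}. \<alpha> k * (cos (real k * t) * cos (real j * t)) + \<beta> k * (sin (real k * t) * cos (real j * t)))"
    by (intro LBINT_sum_continuous continuous_intros)
  also have "\<dots> = (\<Sum>k=1..M. \<alpha> k * (LBINT t:{-pi..pi}. cos (real k * t) * cos (real j * t)) +
      \<beta> k * (LBINT t:{-pi..pi}. sin (real k * t) * cos (real j * t)))"
    by (intro sum.cong refl, subst set_integral_add; (intro set_integrable_continuous_real continuous_intros)?; simp)
  also have "\<dots> = (\<Sum>k=1..M. if k = j then pi * \<alpha> j else 0)"
    unfolding LBINT_cos_cos LBINT_sin_cos by (intro sum.cong) auto
  also have "\<dots> = (if j \<in> {1..M} then pi * \<alpha> j else 0)" by (simp add: sum.delta)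
  finally show ?thesis by (auto simp: fa_def)
qed

lemma fb_trig_sum:
  "fb j (\<lambda>t. \<Sum>k=1..M. \<alpha> k * cos (real k * t) + \<beta> k * sin (real k * t)) = (if j \<in> {1..M} then \<beta> j else 0)"
proof -
  have "(LBINT t:{-pi..pi}. (\<Sum>k=1..M. \<alpha> k * cos (real k * t) + \<beta> k * sin (real k * t)) * sin (real j * t))
      = (LBINT t:{-pi..pi}. \<Sum>k=1..M. (\<alpha> k * (sin (real j * t) * cos (real k * t)) + \<beta> k * (sin (real k * t) * sin (real j * t))))"
    unfolding sum_distrib_right by (intro set_lebesgue_integral_cong allI impI sum.cong refl) (auto simp: algebra_simps)
  also have "\<dots> = (\<Sum>k=1..M. LBINT t:{-pi..pi}. \<alpha> k * (sin (real j * t) * cos (real k * t)) + \<beta> k * (sin (real k * t) * sin (real j * t)))"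
    by (intro LBINT_sum_continuous continuous_intros)
  also have "\<dots> = (\<Sum>k=1..M. \<alpha> k * (LBINT t:{-pi..pi}. sin (real j * t) * cos (real k * t)) +
      \<beta> k * (LBINT t:{-pi..pi}. sin (real k * t) * sin (real j * t)))"
    by (intro sum.cong refl, subst set_integral_add; (intro set_integrable_continuous_real continuous_intros)?; simp)
  also have "\<dots> = (\<Sum>k=1..M. if k = j then pi * \<beta> j else 0)"
    unfolding LBINT_sin_sin LBINT_sin_cos by (intro sum.cong) auto
  also have "\<dots> = (if j \<in> {1..M} then pi * \<beta> j else 0)" by (simp add: sum.delta)
  finally show ?thesis by (auto simp: fb_def)
qed

text \<open>The bound is asked on one period only, since Fourier coefficients are integrals over
  that period.\<close>

definition ess_bounded :: "real \<Rightarrow> (real \<Rightarrow> real) \<Rightarrow> bool" where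
  "ess_bounded B \<phi> \<longleftrightarrow> \<phi> \<in> borel_measurable borel \<and> (AE t in lborel. t \<in> {-pi..pi} \<longrightarrow> \<bar>\<phi> t\<bar> \<le> B)"

lemma set_integrable_bounded_real:
  fixes g :: "real \<Rightarrow> real"
  assumes "g \<in> borel_measurable borel" "AE t in lborel. t \<in> {a..b} \<longrightarrow> \<bar>g t\<bar> \<le> B"
  shows "set_integrable lborel {a..b} g"
  unfolding set_integrable_def using assms
  by (intro integrableI_bounded_set_indicator[where B = B]) (auto simp: emeasure_lborel_Icc_eq)

lemma continuous_imp_bounded_Icc:
  fixes g :: "real \<Rightarrow> real"
  assumes "continuous_on UNIV g" shows "\<exists>C\<ge>0. \<forall>t\<in>{a..b}. \<bar>g t\<bar> \<le> C"
proof -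
  have "bounded (g ` {a..b})"
    by (intro compact_imp_bounded compact_continuous_image continuous_on_subset[OF assms]) auto
  then obtain C where "\<forall>t\<in>{a..b}. \<bar>g t\<bar> \<le> C" by (auto simp: bounded_iff)
  thus ?thesis by (intro exI[of _ "max C 0"]) auto
qed

lemma ess_bounded_set_integrable_mult:
  assumes "ess_bounded B \<phi>" "continuous_on UNIV g"
  shows "set_integrable lborel {-pi..pi} (\<lambda>t. \<phi> t * g t)"
proof -
  obtain C where C: "C \<ge> 0" "\<forall>t\<in>{-pi..pi}. \<bar>g t\<bar> \<le> C" using continuous_imp_bounded_Icc[OF assms(2)] by blast
  have "AE t in lborel. t \<in> {-pi..pi} \<longrightarrow> \<bar>\<phi> t\<bar> \<le> B" using assms(1) by (auto simp: ess_bounded_def)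
  hence "AE t in lborel. t \<in> {-pi..pi} \<longrightarrow> \<bar>\<phi> t * g t\<bar> \<le> \<bar>B\<bar> * C"
  proof (rule AE_mp, intro AE_I2 impI)
    fix t assume t: "t \<in> {-pi..pi} \<longrightarrow> \<bar>\<phi> t\<bar> \<le> B" "t \<in> {-pi..pi}"
    show "\<bar>\<phi> t * g t\<bar> \<le> \<bar>B\<bar> * C" unfolding abs_mult using t C by (intro mult_mono) auto
  qed
  moreover have "(\<lambda>t. \<phi> t * g t) \<in> borel_measurable borel"
    using assms borel_measurable_continuous_onI[of g] by (auto simp: ess_bounded_def)
  ultimately show ?thesis by (intro set_integrable_bounded_real)
qed

lemma ess_bounded_set_integral_le:
  assumes "ess_bounded B \<phi>" "continuous_on UNIV g"
  shows "\<bar>LBINT t:{-pi..pi}. \<phi> t * g t\<bar> \<le> B * (LBINT t:{-pi..pi}. \<bar>g t\<bar>)"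
proof -
  note int = ess_bounded_set_integrable_mult[OF assms]
  have "\<bar>LBINT t:{-pi..pi}. \<phi> t * g t\<bar> \<le> (LBINT t:{-pi..pi}. \<bar>\<phi> t * g t\<bar>)"
    using set_integral_norm_bound[OF int] by simp
  also have "\<dots> \<le> (LBINT t:{-pi..pi}. B * \<bar>g t\<bar>)"
  proof (rule set_integral_mono_AE)
    show "set_integrable lborel {-pi..pi} (\<lambda>t. \<bar>\<phi> t * g t\<bar>)" using int by (rule set_integrable_abs)
    show "set_integrable lborel {-pi..pi} (\<lambda>t. B * \<bar>g t\<bar>)"
      using assms by (intro set_integrable_continuous_real continuous_intros)
    have "AE t in lborel. t \<in> {-pi..pi} \<longrightarrow> \<bar>\<phi> t\<bar> \<le> B" using assms(1) by (auto simp: ess_bounded_def)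
    thus "AE t \<in> {-pi..pi} in lborel. \<bar>\<phi> t * g t\<bar> \<le> B * \<bar>g t\<bar>"
      by (rule AE_mp, intro AE_I2 impI) (auto simp: abs_mult intro: mult_right_mono)
  qed
  also have "\<dots> = B * (LBINT t:{-pi..pi}. \<bar>g t\<bar>)" by simp
  finally show ?thesis .
qed

text \<open>The phases \<open>y k\<close> are left free so that one formula serves both the Fejer
  sums, with \<open>y k = k * x\<close>, and the deviation, with the extra shift by
  \<open>\<theta>\<close>.\<close>

lemma fourier_sum_eq_integral:
  assumes "ess_bounded B \<phi>"
  shows "(\<Sum>k\<in>A. c k * (fa k \<phi> * cos (y k) + fb k \<phi> * sin (y k))) =
           (LBINT t:{-pi..pi}. \<phi> t * (\<Sum>k\<in>A. c k * cos (y k - real k * t))) / pi"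
proof -
  note int = ess_bounded_set_integrable_mult[OF assms]
  have "(LBINT t:{-pi..pi}. \<phi> t * (\<Sum>k\<in>A. c k * cos (y k - real k * t))) =
      (LBINT t:{-pi..pi}. (\<Sum>k\<in>A. \<phi> t * (c k * cos (y k - real k * t))))"
    by (simp add: sum_distrib_left)
  also have "\<dots> = (\<Sum>k\<in>A. LBINT t:{-pi..pi}. \<phi> t * (c k * cos (y k - real k * t)))"
    by (intro set_integral_sum_real int continuous_intros)
  also have "\<dots> = (\<Sum>k\<in>A. LBINT t:{-pi..pi}. c k * cos (y k) * (\<phi> t * cos (real k * t)) + c k * sin (y k) * (\<phi> t * sin (real k * t)))"
    by (simp add: cos_diff algebra_simps)
  also have "\<dots> = (\<Sum>k\<in>A. c k * cos (y k) * (LBINT t:{-pi..pi}. \<phi> t * cos (real k * t)) + c k * sin (y k) * (LBINT t:{-pi..pi}. \<phi> t * sin (real k * t)))"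
    by (intro sum.cong refl, subst set_integral_add; (intro set_integrable_mult_right int continuous_intros)?; simp)
  finally have "(LBINT t:{-pi..pi}. \<phi> t * (\<Sum>k\<in>A. c k * cos (y k - real k * t))) = \<dots>" .
  thus ?thesis by (simp add: fa_def fb_def sum_divide_distrib add_divide_distrib algebra_simps)
qed

lemma in_C_ess_bounded: "in_C f \<Longrightarrow> \<exists>B. ess_bounded B f"
  using continuous_imp_bounded_Icc[of f "-pi" pi]
  by (auto simp: in_C_def ess_bounded_def intro!: borel_measurable_continuous_onI exI AE_I2)

section \<open>Fejer means\<close>

text \<open>The Fejer kernel multiplied by \<open>N\<close>; without the normalisation the recursion
  in \<open>N\<close> involves no division.\<close>

definition fejer :: "nat \<Rightarrow> real \<Rightarrow> real" where
  "fejer N t = real N + 2 * (\<Sum>k=1..<N. (real N - real k) * cos (real k * t))"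

lemma fejer_Suc: "fejer (Suc N) t = fejer N t + 1 + 2 * (\<Sum>k=1..N. cos (real k * t))"
proof -
  have "(\<Sum>k=1..<Suc N. (real (Suc N) - real k) * cos (real k * t)) =
     (\<Sum>k=1..<Suc N. (real N - real k) * cos (real k * t)) + (\<Sum>k=1..<Suc N. cos (real k * t))"
    by (subst sum.distrib[symmetric]) (simp add: algebra_simps)
  also have "(\<Sum>k=1..<Suc N. (real N - real k) * cos (real k * t)) = (\<Sum>k=1..<N. (real N - real k) * cos (real k * t))"
    by (cases N) auto
  finally show ?thesis by (simp add: fejer_def atLeastLessThanSuc_atLeastAtMost)
qed

text \<open>The right side is the squared modulus of the sum of \<open>e^{ijt}\<close> over
  \<open>j < N\<close>. Passing to \<open>N + 1\<close> adds \<open>1\<close> and twice the cross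
  term with \<open>e^{iNt}\<close>, which is the cosine sum of \<open>fejer_Suc\<close> after the
  substitution of \<open>N - j\<close> for \<open>j\<close>. Positivity of the kernel is the
  purpose.\<close>

lemma fejer_eq_sum_squares:
  "fejer N t = (\<Sum>j<N. cos (real j * t))\<^sup>2 + (\<Sum>j<N. sin (real j * t))\<^sup>2"
proof (induction N)
  case (Suc N)
  let ?C = "\<Sum>j<N. cos (real j * t)" and ?S = "\<Sum>j<N. sin (real j * t)"
  have "cos (real N * t) * ?C + sin (real N * t) * ?S = (\<Sum>j<N. cos (real (N - j) * t))"
    unfolding sum_distrib_left sum.distrib[symmetric]
    by (intro sum.cong) (auto simp: of_nat_diff left_diff_distrib cos_diff)
  also have "\<dots> = (\<Sum>k=1..N. cos (real k * t))"
    by (rule sum.reindex_bij_witness[of _ "\<lambda>k. N - k" "\<lambda>j. N - j"]) auto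
  finally have eq: "(\<Sum>k=1..N. cos (real k * t)) = cos (real N * t) * ?C + sin (real N * t) * ?S" ..
  have "(cos (real N * t))\<^sup>2 + (sin (real N * t))\<^sup>2 = 1" by (rule sin_cos_squared_add2)
  thus ?case unfolding fejer_Suc eq Suc by (simp add: power2_eq_square algebra_simps)
qed (simp add: fejer_def)

lemma fejer_nonneg: "fejer N t \<ge> 0"
  unfolding fejer_eq_sum_squares by simp

lemma continuous_fejer: "continuous_on UNIV (\<lambda>t. fejer N (x - t))"
  unfolding fejer_def by (intro continuous_intros)

lemma fejer_sum_eq_integral:
  assumes "ess_bounded B \<phi>"
  shows "(\<Sum>k<N. (real N - real k) * fA k \<phi> x) = (LBINT t:{-pi..pi}. \<phi> t * fejer N (x - t)) / (2 * pi)"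
proof -
  \<comment> \<open>The factor \<open>1/2\<close> at \<open>0\<close> matches the halved constant
    term in \<open>fA\<close>.\<close>
  define c where "c k = (real N - real k) * (if k = 0 then 1/2 else 1)" for k
  have "(\<Sum>k<N. (real N - real k) * fA k \<phi> x) = (\<Sum>k<N. c k * (fa k \<phi> * cos (real k * x) + fb k \<phi> * sin (real k * x)))"
    by (intro sum.cong) (auto simp: fA_def c_def)
  also have "\<dots> = (LBINT t:{-pi..pi}. \<phi> t * (\<Sum>k<N. c k * cos (real k * x - real k * t))) / pi"
    using assms by (rule fourier_sum_eq_integral)
  also have "(\<lambda>t. \<Sum>k<N. c k * cos (real k * x - real k * t)) = (\<lambda>t. fejer N (x - t) / 2)"
  proof
    fix t
    show "(\<Sum>k<N. c k * cos (real k * x - real k * t)) = fejer N (x - t) / 2"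
    proof (cases N)
      case (Suc M)
      have "(\<Sum>k<N. c k * cos (real k * x - real k * t)) = c 0 + (\<Sum>k=1..<N. c k * cos (real k * x - real k * t))"
        unfolding Suc lessThan_atLeast0 by (subst sum.atLeast_Suc_lessThan) auto
      also have "(\<Sum>k=1..<N. c k * cos (real k * x - real k * t)) = (\<Sum>k=1..<N. (real N - real k) * cos (real k * (x - t)))"
        by (intro sum.cong) (auto simp: c_def right_diff_distrib)
      finally show ?thesis by (simp add: fejer_def c_def)
    qed (simp add: fejer_def)
  qed
  finally show ?thesis by simp
qed

lemma LBINT_fejer: "(LBINT t:{-pi..pi}. fejer N (x - t)) = 2 * pi * real N"
proof -
  have "ess_bounded 1 (\<lambda>t. 1)" by (auto simp: ess_bounded_def)
  from fejer_sum_eq_integral[OF this, of N x]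
  have "(LBINT t:{-pi..pi}. fejer N (x - t)) = 2 * pi * (\<Sum>k<N. (real N - real k) * fA k (\<lambda>t. 1) x)" by simp
  also have "(\<Sum>k<N. (real N - real k) * fA k (\<lambda>t. 1) x) = (\<Sum>k<N. if k = 0 then real N else 0)"
  proof (intro sum.cong refl)
    fix k
    show "(real N - real k) * fA k (\<lambda>t. 1) x = (if k = 0 then real N else 0)"
      using LBINT_cos_int[of "int k"] LBINT_sin_int[of "int k"] by (auto simp: fA_def fa_def fb_def)
  qed
  also have "\<dots> = real N" by (cases N) (auto simp: sum.delta)
  finally show ?thesis .
qed

lemma fejer_sum_le:
  assumes "ess_bounded B \<phi>"
  shows "\<bar>\<Sum>k<N. (real N - real k) * fA k \<phi> x\<bar> \<le> B * real N"
proof -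
  have "\<bar>LBINT t:{-pi..pi}. \<phi> t * fejer N (x - t)\<bar> \<le> B * (LBINT t:{-pi..pi}. \<bar>fejer N (x - t)\<bar>)"
    using assms continuous_fejer by (rule ess_bounded_set_integral_le)
  also have "\<dots> = B * (2 * pi * real N)" by (simp add: fejer_nonneg LBINT_fejer)
  finally show ?thesis unfolding fejer_sum_eq_integral[OF assms] by (simp add: field_simps)
qed

text \<open>The function \<open>cos (x - t)\<close> has the single frequency \<open>1\<close>, whose
  Fejer multiplier is \<open>N - 1\<close> instead of \<open>N\<close>. The defect thus stays
  bounded while the total mass grows like \<open>N\<close>.\<close>

lemma LBINT_one_minus_cos_fejer_le:
  "(LBINT t:{-pi..pi}. (1 - cos (x - t)) * fejer N (x - t)) \<le> 2 * pi"
proof -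
  define g where "g = (\<lambda>t. cos (x - t))"
  have g: "g = (\<lambda>t. \<Sum>k=1..1. cos x * cos (real k * t) + sin x * sin (real k * t))"
    by (auto simp: g_def cos_diff)
  have coef: "fa k g = (if k = 1 then cos x else 0)" "fb k g = (if k = 1 then sin x else 0)" for k
    unfolding g fa_trig_sum fb_trig_sum by auto
  have eg: "ess_bounded 1 g" unfolding ess_bounded_def g_def by auto
  have "(\<Sum>k<N. (real N - real k) * fA k g x) = (\<Sum>k<N. if k = 1 then real N - 1 else 0)"
    by (intro sum.cong) (auto simp: fA_def coef)
  \<comment> \<open>Only an inequality, because for \<open>N = 0\<close> the sum is empty and equals
    \<open>0\<close>.\<close>
  also have "\<dots> \<ge> real N - 1" by (auto simp: sum.delta)
  finally have "real N - 1 \<le> (LBINT t:{-pi..pi}. g t * fejer N (x - t)) / (2 * pi)"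
    unfolding fejer_sum_eq_integral[OF eg] .
  hence "2 * pi * (real N - 1) \<le> (LBINT t:{-pi..pi}. g t * fejer N (x - t))" by (simp add: field_simps)
  moreover have "(LBINT t:{-pi..pi}. (1 - cos (x - t)) * fejer N (x - t)) =
     (LBINT t:{-pi..pi}. fejer N (x - t)) - (LBINT t:{-pi..pi}. g t * fejer N (x - t))"
    unfolding left_diff_distrib g_def
    by (subst set_integral_diff; (intro set_integrable_continuous_real continuous_intros continuous_fejer)?; simp)
  ultimately show ?thesis by (simp add: LBINT_fejer algebra_simps)
qed

lemma in_C_periodic_int: "in_C f \<Longrightarrow> f (x + 2 * pi * of_int m) = f x"
  by (rule periodic_int) (simp add: in_C_def)

text \<open>Korovkin's argument: with this bound, positivity of the kernel and its integrals against
  \<open>1\<close> and \<open>cos (x - t)\<close> already give Fejer's theorem.\<close>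

lemma in_C_korovkin:
  assumes f: "in_C f" and e: "e > 0"
  shows "\<exists>C. \<forall>t. \<bar>f t - f x\<bar> \<le> e + C * (1 - cos (x - t))"
proof -
  have cont: "continuous_on UNIV f" using f by (simp add: in_C_def)
  hence "isCont f x" by (simp add: continuous_on_eq_continuous_at)
  then obtain d0 where d0: "d0 > 0" "\<And>t. \<bar>t - x\<bar> < d0 \<Longrightarrow> \<bar>f t - f x\<bar> < e"
    using e by (auto simp: continuous_at_eps_delta dist_real_def)
  define d where "d = min d0 pi"
  have d: "d > 0" "d \<le> pi" using d0 pi_gt_zero by (auto simp: d_def)
  obtain B where B: "B \<ge> 0" "\<forall>t\<in>{x-pi..x+pi}. \<bar>f t\<bar> \<le> B"
    using continuous_imp_bounded_Icc[OF cont] by blast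
  have cd: "cos d < 1" using cos_monotone_0_pi[of 0 d] d by auto
  \<comment> \<open>At distance between \<open>d\<close> and \<open>pi\<close> from \<open>x\<close>
    the increment of \<open>f\<close> is at most \<open>2 * B\<close>, while
    \<open>1 - cos (x - t)\<close> is at least \<open>1 - cos d\<close>; this ratio makes the second
    term dominate.\<close>
  define C where "C = 2 * B / (1 - cos d)"
  have C: "C \<ge> 0" using B cd by (auto simp: C_def)
  have main: "\<bar>f t - f x\<bar> \<le> e + C * (1 - cos (x - t))" if t: "\<bar>t - x\<bar> \<le> pi" for t
  proof (cases "\<bar>t - x\<bar> < d")
    case True
    hence "\<bar>f t - f x\<bar> < e" using d0 by (auto simp: d_def)
    thus ?thesis using mult_nonneg_nonneg[OF C, of "1 - cos (x - t)"] by simp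
  next
    case False
    have "cos \<bar>t - x\<bar> \<le> cos d" using False t d by (intro cos_monotone_0_pi_le) auto
    hence "cos (x - t) \<le> cos d" by (metis cos_abs_real abs_minus_commute)
    hence "2 * B \<le> C * (1 - cos (x - t))" using C cd B
      by (auto simp: C_def field_simps intro: mult_left_mono)
    moreover have "\<bar>f t\<bar> \<le> B" "\<bar>f x\<bar> \<le> B" using B t pi_gt_zero by (auto simp: abs_le_iff)
    ultimately show ?thesis using e by linarith
  qed
  have "\<bar>f t - f x\<bar> \<le> e + C * (1 - cos (x - t))" for t
  proof -
    define m where "m = \<lfloor>(t - x + pi) / (2 * pi)\<rfloor>"
    define s where "s = t - 2 * pi * of_int m"
    have "of_int m \<le> (t - x + pi) / (2 * pi)" "(t - x + pi) / (2 * pi) < of_int m + 1" by (auto simp: m_def)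
    hence "\<bar>s - x\<bar> \<le> pi" by (auto simp: s_def field_simps abs_le_iff)
    from main[OF this] have "\<bar>f s - f x\<bar> \<le> e + C * (1 - cos (x - s))" .
    moreover have "f t = f s" using in_C_periodic_int[OF f, of s m] by (simp add: s_def)
    moreover have "cos (x - s) = cos (x - t)"
    proof -
      have "x - s = (x - t) + 2 * pi * of_int m" by (simp add: s_def)
      thus ?thesis using cos_int_2pin[of m] sin_int_2pin[of m] by (simp only: cos_add)
    qed
    ultimately show ?thesis by simp
  qed
  thus ?thesis by blast
qed

lemma fejer_tendsto:
  assumes f: "in_C f"
  shows "(\<lambda>N. (\<Sum>k<N. (real N - real k) * fA k f x) / real N) \<longlonglongrightarrow> f x"
proof (rule LIMSEQ_I)
  fix r :: real assume r: "r > 0"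
  obtain C where C: "\<And>t. \<bar>f t - f x\<bar> \<le> r / 2 + C * (1 - cos (x - t))"
    using in_C_korovkin[OF f, of "r/2"] r by auto
  have contf: "continuous_on UNIV f" using f by (simp add: in_C_def)
  obtain B where B: "ess_bounded B f" using in_C_ess_bounded[OF f] by auto
  have bound: "\<bar>(\<Sum>k<N. (real N - real k) * fA k f x) - real N * f x\<bar> \<le> real N * (r / 2) + \<bar>C\<bar>" for N
  proof -
    have "(\<Sum>k<N. (real N - real k) * fA k f x) - real N * f x =
       (LBINT t:{-pi..pi}. (f t - f x) * fejer N (x - t)) / (2 * pi)"
    proof -
      have "(LBINT t:{-pi..pi}. (f t - f x) * fejer N (x - t)) =
          (LBINT t:{-pi..pi}. f t * fejer N (x - t)) - f x * (2 * pi * real N)"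
        unfolding left_diff_distrib
        by (subst set_integral_diff; (intro set_integrable_continuous_real continuous_intros continuous_fejer contf)?;
            simp add: LBINT_fejer)
      thus ?thesis unfolding fejer_sum_eq_integral[OF B] by (simp add: diff_divide_distrib)
    qed
    also have "\<bar>\<dots>\<bar> = \<bar>LBINT t:{-pi..pi}. (f t - f x) * fejer N (x - t)\<bar> / (2 * pi)" by simp
    also have "\<bar>LBINT t:{-pi..pi}. (f t - f x) * fejer N (x - t)\<bar> \<le> (LBINT t:{-pi..pi}. \<bar>(f t - f x) * fejer N (x - t)\<bar>)"
    proof -
      have "continuous_on UNIV (\<lambda>t. (f t - f x) * fejer N (x - t))"
        by (intro continuous_intros continuous_fejer contf)
      from set_integral_norm_bound[OF set_integrable_continuous_real[OF this]] show ?thesis by simp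
    qed
    also have "\<dots> \<le> (LBINT t:{-pi..pi}. r / 2 * fejer N (x - t) + \<bar>C\<bar> * ((1 - cos (x - t)) * fejer N (x - t)))"
    proof (rule set_integral_mono)
      fix t
      have "C * (1 - cos (x - t)) \<le> \<bar>C\<bar> * (1 - cos (x - t))" by (intro mult_right_mono) auto
      hence "\<bar>f t - f x\<bar> \<le> r / 2 + \<bar>C\<bar> * (1 - cos (x - t))" using C[of t] by linarith
      hence "\<bar>f t - f x\<bar> * fejer N (x - t) \<le> (r / 2 + \<bar>C\<bar> * (1 - cos (x - t))) * fejer N (x - t)"
        by (intro mult_right_mono fejer_nonneg)
      thus "\<bar>(f t - f x) * fejer N (x - t)\<bar> \<le> r / 2 * fejer N (x - t) + \<bar>C\<bar> * ((1 - cos (x - t)) * fejer N (x - t))"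
        unfolding abs_mult abs_of_nonneg[OF fejer_nonneg] by (simp add: algebra_simps)
    qed (intro set_integrable_continuous_real continuous_intros continuous_fejer contf)+
    also have "\<dots> = r / 2 * (2 * pi * real N) + \<bar>C\<bar> * (LBINT t:{-pi..pi}. (1 - cos (x - t)) * fejer N (x - t))"
      by (subst set_integral_add; (intro set_integrable_continuous_real continuous_intros continuous_fejer)?;
          simp add: LBINT_fejer)
    also have "\<dots> \<le> r / 2 * (2 * pi * real N) + \<bar>C\<bar> * (2 * pi)"
      by (intro add_left_mono mult_left_mono LBINT_one_minus_cos_fejer_le) auto
    finally have "\<bar>(\<Sum>k<N. (real N - real k) * fA k f x) - real N * f x\<bar> \<le> (r / 2 * (2 * pi * real N) + \<bar>C\<bar> * (2 * pi)) / (2 * pi)"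
      by (simp add: divide_right_mono)
    also have "\<dots> = real N * (r / 2) + \<bar>C\<bar>" by (simp add: add_divide_distrib)
    finally show ?thesis .
  qed
  \<comment> \<open>After division by \<open>n\<close> the error is
    \<open>r / 2 + \<bar>C\<bar> / n\<close>; beyond \<open>M\<close> the second part is below
    \<open>r / 2\<close>.\<close>
  obtain M :: nat where M: "2 * \<bar>C\<bar> / r < real M" using reals_Archimedean2 by blast
  show "\<exists>no. \<forall>n\<ge>no. norm ((\<Sum>k<n. (real n - real k) * fA k f x) / real n - f x) < r"
  proof (intro exI allI impI)
    fix n assume n: "max M 1 \<le> n"
    have "2 * \<bar>C\<bar> / r < real n" using M n by linarith
    hence "\<bar>C\<bar> < real n * (r / 2)" using r by (simp add: field_simps)
    hence "\<bar>(\<Sum>k<n. (real n - real k) * fA k f x) - real n * f x\<bar> < real n * r" using bound[of n] by argo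
    moreover have "(\<Sum>k<n. (real n - real k) * fA k f x) / real n - f x = ((\<Sum>k<n. (real n - real k) * fA k f x) - real n * f x) / real n"
      using n by (simp add: diff_divide_distrib)
    ultimately show "norm ((\<Sum>k<n. (real n - real k) * fA k f x) / real n - f x) < r"
      using n by (simp add: divide_less_eq mult.commute)
  qed
qed

section \<open>Integral representation of the deviation\<close>

text \<open>De la Vallee Poussin weights. Beyond \<open>n\<close> they are linear and decreasing, so multiplying the
  tail of \<open>\<psi>\<close> by them keeps it convex and decreasing, while all sums become finite.\<close>

definition vp_weight :: "nat \<Rightarrow> nat \<Rightarrow> nat \<Rightarrow> real" where
  "vp_weight n N k = (if k \<le> n then 1 else (real N - real k) / (real N - real n))"

text \<open>The trapezoidal weight is a difference of two triangular ones, so Fejer positivity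
  controls the means. Their norm bound \<open>(N + n) / (N - n)\<close> tends to \<open>1\<close>
  for fixed \<open>n\<close>, which keeps the lower estimate sharp.\<close>

lemma vp_sum_eq:
  assumes "n < N"
  shows "(\<Sum>k\<le>N. vp_weight n N k * A k) =
    ((\<Sum>k<N. (real N - real k) * A k) - (\<Sum>k<n. (real n - real k) * A k)) / (real N - real n)"
proof -
  have w: "(real N - real n) * vp_weight n N k = (real N - real k) - (if k < n then real n - real k else 0)" for k
    using assms by (auto simp: vp_weight_def)
  have "(real N - real n) * (\<Sum>k\<le>N. vp_weight n N k * A k) =
      (\<Sum>k\<le>N. (real N - real k) * A k - (if k < n then (real n - real k) * A k else 0))"
    unfolding sum_distrib_left mult.assoc[symmetric] w by (intro sum.cong refl) (simp add: left_diff_distrib)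
  also have "\<dots> = (\<Sum>k\<le>N. (real N - real k) * A k) - (\<Sum>k\<le>N. if k < n then (real n - real k) * A k else 0)"
    by (rule sum_subtractf)
  also have "(\<Sum>k\<le>N. (real N - real k) * A k) = (\<Sum>k<N. (real N - real k) * A k)"
    by (simp add: lessThan_Suc_atMost[symmetric])
  also have "(\<Sum>k\<le>N. if k < n then (real n - real k) * A k else 0) = (\<Sum>k<n. (real n - real k) * A k)"
    using assms by (subst sum.inter_filter[symmetric]) (auto intro!: sum.cong)
  finally show ?thesis using assms by (simp add: field_simps)
qed

lemma vp_sum_le:
  assumes "ess_bounded B \<phi>" "n < N"
  shows "\<bar>\<Sum>k\<le>N. vp_weight n N k * fA k \<phi> x\<bar> \<le> B * ((real N + real n) / (real N - real n))"
proof -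
  have "\<bar>(\<Sum>k<N. (real N - real k) * fA k \<phi> x) - (\<Sum>k<n. (real n - real k) * fA k \<phi> x)\<bar> \<le> B * real N + B * real n"
    using fejer_sum_le[OF assms(1), of N x] fejer_sum_le[OF assms(1), of n x] by linarith
  thus ?thesis unfolding vp_sum_eq[OF assms(2)] using assms(2) by (simp add: divide_right_mono distrib_left)
qed

lemma vp_sum_tendsto:
  assumes "in_C f"
  shows "(\<lambda>N. \<Sum>k\<le>N. vp_weight n N k * fA k f x) \<longlonglongrightarrow> f x"
proof -
  define S where "S N = (\<Sum>k<N. (real N - real k) * fA k f x)" for N
  have "(\<lambda>N. real N / (real N - real n)) \<longlonglongrightarrow> 1" "(\<lambda>N. S n / (real N - real n)) \<longlonglongrightarrow> 0"
    by real_asymp+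
  moreover have "(\<lambda>N. S N / real N) \<longlonglongrightarrow> f x" unfolding S_def using fejer_tendsto[OF assms] .
  ultimately have "(\<lambda>N. (S N / real N) * (real N / (real N - real n)) - S n / (real N - real n)) \<longlonglongrightarrow> f x * 1 - 0"
    by (intro tendsto_intros)
  moreover have "eventually (\<lambda>N. (S N / real N) * (real N / (real N - real n)) - S n / (real N - real n)
      = (\<Sum>k\<le>N. vp_weight n N k * fA k f x)) sequentially"
    using eventually_gt_at_top[of n]
    by eventually_elim (auto simp: vp_sum_eq S_def diff_divide_distrib)
  ultimately show ?thesis using Lim_transform_eventually by fastforce
qed

text \<open>The multipliers of \<open>f - U f\<close> relative to the \<open>(\<psi>, \<beta>)\<close>-derivative, divided by \<open>\<psi> n\<close>: the
  definition of \<open>lam\<close> is made so that \<open>(1 - lam) * \<psi> k\<close> is linear in \<open>k\<close> below \<open>n\<close>.\<close>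

definition kcoef :: "(real \<Rightarrow> real) \<Rightarrow> nat \<Rightarrow> nat \<Rightarrow> nat \<Rightarrow> nat \<Rightarrow> real" where
  "kcoef \<psi> n p N k = (if k \<le> n - p then 0
     else if k < n then (real k - real n + real p) / real p
     else \<psi> (real k) / \<psi> (real n) * ((real N - real k) / (real N - real n)))"

definition dev_kernel :: "(real \<Rightarrow> real) \<Rightarrow> nat \<Rightarrow> nat \<Rightarrow> nat \<Rightarrow> real \<Rightarrow> real \<Rightarrow> real" where
  "dev_kernel \<psi> n p N \<theta> t = (\<Sum>k=1..N. kcoef \<psi> n p N k * cos (real k * t - \<theta>))"

lemma continuous_dev_kernel: "continuous_on UNIV (dev_kernel \<psi> n p N \<theta>)"
  unfolding dev_kernel_def by (intro continuous_intros)

text \<open>Reduces the left half of the period to the right half with the opposite phase.\<close>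

lemma dev_kernel_minus: "dev_kernel \<psi> n p N \<theta> (- t) = dev_kernel \<psi> n p N (- \<theta>) t"
proof -
  have "cos (real k * (- t) - \<theta>) = cos (real k * t - (- \<theta>))" for k
  proof -
    have "real k * (- t) - \<theta> = - (real k * t - (- \<theta>))" by simp
    thus ?thesis by (simp only: cos_minus)
  qed
  thus ?thesis by (simp add: dev_kernel_def)
qed

lemma dev_kernel_periodic: "dev_kernel \<psi> n p N \<theta> (t + 2 * pi) = dev_kernel \<psi> n p N \<theta> t"
proof -
  have "cos (real k * (t + 2 * pi) - \<theta>) = cos (real k * t - \<theta>)" for k
  proof -
    have "real k * (t + 2 * pi) - \<theta> = (real k * t - \<theta>) + 2 * pi * of_int (int k)" by (simp add: algebra_simps)
    thus ?thesis using cos_int_2pin[of "int k"] sin_int_2pin[of "int k"] by (simp only: cos_add)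
  qed
  thus ?thesis by (simp add: dev_kernel_def)
qed

lemma LBINT_periodic_reflect:
  fixes g :: "real \<Rightarrow> real"
  assumes cont: "continuous_on UNIV g" and per: "\<And>t. g (t + 2 * pi) = g t"
  shows "(LBINT t:{-pi..pi}. g (x - t)) = (LBINT t:{-pi..pi}. g t)"
proof -
  obtain G where G: "\<And>y. (G has_real_derivative g y) (at y)"
    using continuous_antiderivative[OF cont] by blast
  have "(LBINT t:{-pi..pi}. g (x - t)) = - G (x - pi) - (- G (x - (- pi)))" for x
    using pi_gt_zero
    by (intro set_integral_FTC_real)
       (auto intro!: derivative_eq_intros DERIV_chain'[OF _ G] continuous_on_compose2[OF cont] continuous_intros)
  hence 1: "(LBINT t:{-pi..pi}. g (x - t)) = G (x + pi) - G (x - pi)" for x by simp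
  have "((\<lambda>x. G (x + pi) - G (x - pi)) has_real_derivative 0) (at x)" for x
    using per[of "x - pi"]
    by (auto simp: add.commute intro!: derivative_eq_intros DERIV_chain'[OF _ G])
  hence "G (x + pi) - G (x - pi) = G (0 + pi) - G (0 - pi)"
    using DERIV_isconst_all[of "\<lambda>x. G (x + pi) - G (x - pi)" x 0] by blast
  moreover have "(LBINT t:{-pi..pi}. g t) = G pi - G (- pi)"
    using pi_gt_zero by (intro set_integral_FTC_real G cont) auto
  ultimately show ?thesis using 1[of x] by simp
qed

text \<open>The coefficients of \<open>\<phi>\<close> are those of \<open>f\<close>, divided by
  \<open>\<psi> k\<close> and rotated by \<open>\<beta> * pi / 2\<close>. Undoing the rotation moves
  the angle into the phase of the harmonics.\<close>

lemma Cpsi_derivative: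
  assumes M: "in_M \<psi>" and f: "f \<in> Cpsi \<psi> \<beta>"
  obtains \<phi> where "ess_bounded 1 \<phi>"
    "\<And>k x. k \<ge> 1 \<Longrightarrow> fA k f x = \<psi> (real k) *
        (fa k \<phi> * cos (real k * x - \<beta> * pi / 2) + fb k \<phi> * sin (real k * x - \<beta> * pi / 2))"
proof -
  let ?t = "\<beta> * pi / 2"
  obtain \<phi> where \<phi>: "\<phi> \<in> borel_measurable lborel" "AE x in lborel. \<bar>\<phi> x\<bar> \<le> 1"
    "\<And>k. k \<ge> 1 \<Longrightarrow> fa k \<phi> = (fa k f * cos ?t + fb k f * sin ?t) / \<psi> (real k)"
    "\<And>k. k \<ge> 1 \<Longrightarrow> fb k \<phi> = (fb k f * cos ?t - fa k f * sin ?t) / \<psi> (real k)"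
    using f unfolding Cpsi_def by blast
  have "fA k f x = \<psi> (real k) * (fa k \<phi> * cos (real k * x - ?t) + fb k \<phi> * sin (real k * x - ?t))"
    if k: "k \<ge> 1" for k x
  proof -
    have "\<psi> (real k) > 0" using M k by (auto simp: in_M_def)
    hence "\<psi> (real k) * (fa k \<phi> * cos (real k * x - ?t) + fb k \<phi> * sin (real k * x - ?t)) =
      (fa k f * cos ?t + fb k f * sin ?t) * (cos (real k * x) * cos ?t + sin (real k * x) * sin ?t) +
      (fb k f * cos ?t - fa k f * sin ?t) * (sin (real k * x) * cos ?t - cos (real k * x) * sin ?t)"
      unfolding \<phi>(3)[OF k] \<phi>(4)[OF k] cos_diff sin_diff by (simp add: field_simps)
    also have "\<dots> = (fa k f * cos (real k * x) + fb k f * sin (real k * x)) * ((sin ?t)\<^sup>2 + (cos ?t)\<^sup>2)"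
      unfolding power2_eq_square by algebra
    finally show ?thesis using k by (simp add: fA_def)
  qed
  moreover have "ess_bounded 1 \<phi>" using \<phi> by (auto simp: ess_bounded_def)
  ultimately show ?thesis using that by blast
qed

lemma weight_minus_lam:
  assumes "in_M \<psi>" "1 \<le> p" "p \<le> n" "n < N" "1 \<le> k"
  shows "(vp_weight n N k - (if k < n then lam \<psi> n p k else 0)) * \<psi> (real k) = \<psi> (real n) * kcoef \<psi> n p N k"
proof -
  have "\<psi> (real k) > 0" "\<psi> (real n) > 0" using assms by (auto simp: in_M_def)
  thus ?thesis using assms by (auto simp: vp_weight_def lam_def kcoef_def)
qed

lemma deviation_sum_eq:
  assumes p: "1 \<le> p" "p \<le> n" "n < N"
  shows "(\<Sum>k\<le>N. vp_weight n N k * fA k f x) - U \<psi> n p f x =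
    (\<Sum>k=1..N. (vp_weight n N k - (if k < n then lam \<psi> n p k else 0)) * fA k f x)"
proof -
  have "U \<psi> n p f x = (\<Sum>k\<le>N. (if k < n then lam \<psi> n p k else 0) * fA k f x)"
    unfolding U_def using p by (intro sum.mono_neutral_cong_left) auto
  hence "(\<Sum>k\<le>N. vp_weight n N k * fA k f x) - U \<psi> n p f x =
     (\<Sum>k\<le>N. (vp_weight n N k - (if k < n then lam \<psi> n p k else 0)) * fA k f x)"
    by (simp add: sum_subtractf left_diff_distrib)
  \<comment> \<open>The frequency \<open>0\<close> drops out because both multipliers are
    \<open>1\<close> there.\<close>
  also have "\<dots> = (\<Sum>k=1..N. (vp_weight n N k - (if k < n then lam \<psi> n p k else 0)) * fA k f x)"
    using p by (intro sum.mono_neutral_right) (auto simp: vp_weight_def lam_def not_le)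
  finally show ?thesis .
qed

lemma dev_kernel_sum_eq_integral:
  assumes "ess_bounded B \<phi>"
  shows "(\<Sum>k=1..N. kcoef \<psi> n p N k * (fa k \<phi> * cos (real k * x - \<theta>) + fb k \<phi> * sin (real k * x - \<theta>))) =
    (LBINT t:{-pi..pi}. \<phi> t * dev_kernel \<psi> n p N \<theta> (x - t)) / pi"
  unfolding fourier_sum_eq_integral[OF assms] dev_kernel_def
  by (simp add: algebra_simps)

text \<open>The value \<open>f x\<close> is reached as the limit of de la Vallee Poussin means, for
  which the kernel is a finite sum. Since \<open>L\<close> does not depend on \<open>N\<close>, the
  bound survives the limit.\<close>

lemma deviation_le:
  assumes M: "in_M \<psi>" and p: "1 \<le> p" "p \<le> n" and f: "f \<in> Cpsi \<psi> \<beta>"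
    and L: "\<And>N. N \<ge> N1 \<Longrightarrow> (LBINT t:{-pi..pi}. \<bar>dev_kernel \<psi> n p N (\<beta> * pi / 2) t\<bar>) \<le> L"
  shows "\<bar>f x - U \<psi> n p f x\<bar> \<le> \<psi> (real n) * L / pi"
proof -
  obtain \<phi> where \<phi>: "ess_bounded 1 \<phi>"
    "\<And>k x. k \<ge> 1 \<Longrightarrow> fA k f x = \<psi> (real k) *
        (fa k \<phi> * cos (real k * x - \<beta> * pi / 2) + fb k \<phi> * sin (real k * x - \<beta> * pi / 2))"
    using Cpsi_derivative[OF M f] by blast
  have \<psi>n: "\<psi> (real n) > 0" using M p by (auto simp: in_M_def)
  have bound: "\<bar>(\<Sum>k\<le>N. vp_weight n N k * fA k f x) - U \<psi> n p f x\<bar> \<le> \<psi> (real n) * L / pi"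
    if N: "N > n" "N \<ge> N1" for N
  proof -
    let ?K = "dev_kernel \<psi> n p N (\<beta> * pi / 2)"
    have "(\<Sum>k\<le>N. vp_weight n N k * fA k f x) - U \<psi> n p f x =
        (\<Sum>k=1..N. ((vp_weight n N k - (if k < n then lam \<psi> n p k else 0)) * \<psi> (real k)) *
          (fa k \<phi> * cos (real k * x - \<beta> * pi / 2) + fb k \<phi> * sin (real k * x - \<beta> * pi / 2)))"
      unfolding deviation_sum_eq[OF p N(1)] by (intro sum.cong refl) (simp add: \<phi>(2))
    also have "\<dots> = \<psi> (real n) * (\<Sum>k=1..N. kcoef \<psi> n p N k *
          (fa k \<phi> * cos (real k * x - \<beta> * pi / 2) + fb k \<phi> * sin (real k * x - \<beta> * pi / 2)))"
      unfolding sum_distrib_left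
      by (intro sum.cong refl) (simp only: weight_minus_lam[OF M p N(1)] atLeastAtMost_iff mult.assoc)
    also have "\<dots> = \<psi> (real n) * ((LBINT t:{-pi..pi}. \<phi> t * ?K (x - t)) / pi)"
      unfolding dev_kernel_sum_eq_integral[OF \<phi>(1)] ..
    finally have "\<bar>(\<Sum>k\<le>N. vp_weight n N k * fA k f x) - U \<psi> n p f x\<bar> = \<psi> (real n) * (\<bar>LBINT t:{-pi..pi}. \<phi> t * ?K (x - t)\<bar> / pi)"
      using \<psi>n by (simp add: abs_mult)
    also have "\<dots> \<le> \<psi> (real n) * (L / pi)"
    proof (intro mult_left_mono divide_right_mono)
      have "\<bar>LBINT t:{-pi..pi}. \<phi> t * ?K (x - t)\<bar> \<le> 1 * (LBINT t:{-pi..pi}. \<bar>?K (x - t)\<bar>)"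
        by (intro ess_bounded_set_integral_le \<phi> continuous_on_compose2[OF continuous_dev_kernel] continuous_intros) auto
      also have "(LBINT t:{-pi..pi}. \<bar>?K (x - t)\<bar>) = (LBINT t:{-pi..pi}. \<bar>?K t\<bar>)"
        by (rule LBINT_periodic_reflect) (auto simp: dev_kernel_periodic intro!: continuous_intros continuous_dev_kernel)
      finally show "\<bar>LBINT t:{-pi..pi}. \<phi> t * ?K (x - t)\<bar> \<le> L" using L[OF N(2)] by simp
    qed (use \<psi>n in auto)
    finally show ?thesis by simp
  qed
  have "in_C f" using f by (simp add: Cpsi_def)
  hence "(\<lambda>N. \<bar>(\<Sum>k\<le>N. vp_weight n N k * fA k f x) - U \<psi> n p f x\<bar>) \<longlonglongrightarrow> \<bar>f x - U \<psi> n p f x\<bar>"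
    by (intro tendsto_intros vp_sum_tendsto)
  moreover have "eventually (\<lambda>N. \<bar>(\<Sum>k\<le>N. vp_weight n N k * fA k f x) - U \<psi> n p f x\<bar> \<le> \<psi> (real n) * L / pi) sequentially"
    using eventually_gt_at_top[of n] eventually_ge_at_top[of N1] by eventually_elim (rule bound)
  ultimately show ?thesis by (rule tendsto_upperbound) simp
qed

lemma Err_le:
  assumes "in_M \<psi>" "1 \<le> p" "p \<le> n"
    and "\<And>N. N \<ge> N1 \<Longrightarrow> (LBINT t:{-pi..pi}. \<bar>dev_kernel \<psi> n p N (\<beta> * pi / 2) t\<bar>) \<le> L"
  shows "Err \<psi> \<beta> n p \<le> ereal (\<psi> (real n) * L / pi)"
  unfolding Err_def
proof (intro SUP_least)
  fix f assume f: "f \<in> Cpsi \<psi> \<beta>"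
  show "ereal (normC (\<lambda>x. f x - U \<psi> n p f x)) \<le> ereal (\<psi> (real n) * L / pi)"
    unfolding normC_def ereal_less_eq using deviation_le[OF assms(1-3) f assms(4)]
    by (intro cSup_least) auto
qed

lemma in_C_minus_U: "in_C f \<Longrightarrow> in_C (\<lambda>x. f x - U \<psi> n p f x)"
proof -
  assume f: "in_C f"
  have "fA k f (x + 2 * pi) = fA k f x" for k x
  proof -
    have "real k * (x + 2 * pi) = real k * x + 2 * pi * of_int (int k)" by (simp add: algebra_simps)
    thus ?thesis using cos_int_2pin[of "int k"] sin_int_2pin[of "int k"]
      unfolding fA_def by (simp only: cos_add sin_add) simp
  qed
  moreover have "continuous_on UNIV (fA k f)" for k
    unfolding fA_def by (cases "k = 0") (auto intro!: continuous_intros)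
  ultimately show ?thesis using f unfolding in_C_def U_def by (auto intro!: continuous_intros)
qed

lemma in_C_le_normC:
  assumes "in_C g" shows "\<bar>g 0\<bar> \<le> normC g"
proof -
  have "continuous_on UNIV g" using assms by (simp add: in_C_def)
  then obtain C where C: "\<forall>t\<in>{-pi..pi}. \<bar>g t\<bar> \<le> C" using continuous_imp_bounded_Icc by blast
  have "\<bar>g t\<bar> \<le> C" for t
  proof -
    define m where "m = \<lfloor>(t + pi) / (2 * pi)\<rfloor>"
    have "of_int m \<le> (t + pi) / (2 * pi)" "(t + pi) / (2 * pi) < of_int m + 1" by (auto simp: m_def)
    hence "t - 2 * pi * of_int m \<in> {-pi..pi}" by (auto simp: field_simps)
    thus ?thesis using C in_C_periodic_int[OF assms, of "t - 2 * pi * of_int m" m] by auto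
  qed
  hence "bdd_above (range (\<lambda>x. \<bar>g x\<bar>))" by (auto simp: bdd_above_def)
  thus ?thesis unfolding normC_def by (intro cSup_upper) auto
qed

lemma in_C_trig_sum: "in_C (\<lambda>t. \<Sum>k=1..M. a k * cos (real k * t) + b k * sin (real k * t))"
proof -
  have "cos (real k * (x + 2 * pi)) = cos (real k * x)" "sin (real k * (x + 2 * pi)) = sin (real k * x)" for k x
  proof -
    have "real k * (x + 2 * pi) = real k * x + 2 * pi * of_int (int k)" by (simp add: algebra_simps)
    thus "cos (real k * (x + 2 * pi)) = cos (real k * x)" "sin (real k * (x + 2 * pi)) = sin (real k * x)"
      using cos_int_2pin[of "int k"] sin_int_2pin[of "int k"] by (simp_all add: cos_add sin_add)
  qed
  thus ?thesis unfolding in_C_def by (auto intro!: continuous_intros)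
qed

text \<open>The extremal function is obtained by applying the de la Vallee Poussin means to a bounded
  test function, so that only trigonometric polynomials occur; \<open>m\<close> pays for making its mean zero.\<close>

lemma Err_ge:
  assumes M: "in_M \<psi>" and p: "1 \<le> p" "p \<le> n" and N: "n < N"
    and h: "h \<in> borel_measurable borel" "\<And>t. \<bar>h t\<bar> \<le> 1"
    and m: "\<bar>LBINT t:{-pi..pi}. h t\<bar> \<le> 2 * pi * m"
  shows "ereal (\<psi> (real n) / pi * ((real N - real n) / ((real N + real n) * (1 + m))) *
     \<bar>LBINT t:{-pi..pi}. h t * dev_kernel \<psi> n p N (\<beta> * pi / 2) (- t)\<bar>) \<le> Err \<psi> \<beta> n p"
proof -
  define \<theta> where "\<theta> = \<beta> * pi / 2"
  define \<mu> where "\<mu> = (LBINT t:{-pi..pi}. h t) / (2 * pi)"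
  \<comment> \<open>The reciprocal of the bound for the means of \<open>g\<close>:
    \<open>1 + m\<close> bounds \<open>g\<close>, and \<open>(N + n) / (N - n)\<close> is the norm
    bound of the means.\<close>
  define r where "r = (real N - real n) / ((real N + real n) * (1 + m))"
  define g where "g t = h t - \<mu>" for t
  have \<psi>n: "\<psi> (real n) > 0" using M p by (auto simp: in_M_def)
  have \<mu>: "\<bar>\<mu>\<bar> \<le> m" using m by (simp add: \<mu>_def field_simps)
  hence m0: "m \<ge> 0" by linarith
  have r: "r > 0" using N m0 by (auto simp: r_def intro!: divide_pos_pos mult_pos_pos)
  have eh: "ess_bounded 1 h" using h by (auto simp: ess_bounded_def)
  have "\<bar>g t\<bar> \<le> 1 + m" for t using h(2)[of t] \<mu> by (simp add: g_def)
  hence eg: "ess_bounded (1 + m) g" using h unfolding ess_bounded_def g_def by auto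
  have split: "(LBINT t:{-pi..pi}. g t * u t) = (LBINT t:{-pi..pi}. h t * u t) - \<mu> * (LBINT t:{-pi..pi}. u t)"
    if "continuous_on UNIV u" for u
    unfolding g_def left_diff_distrib using that
    by (subst set_integral_diff; (intro ess_bounded_set_integrable_mult[OF eh] set_integrable_continuous_real continuous_intros)?; simp)
  have cos_int: "(LBINT t:{-pi..pi}. cos (real k * t)) = (if k = 0 then 2 * pi else 0)" for k
    using LBINT_cos_int[of "int k"] by simp
  have sin_int: "(LBINT t:{-pi..pi}. sin (real k * t)) = 0" for k using LBINT_sin_int[of "int k"] by simp
  \<comment> \<open>Subtracting the mean alters only the coefficient at \<open>0\<close>, and the
    kernel contains no such frequency; hence \<open>h\<close> itself can reappear in the final
    integral.\<close>
  have coef_a: "fa k g = fa k h" if "k \<ge> 1" for k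
    using that split[of "\<lambda>t. cos (real k * t)"] cos_int[of k] by (simp add: fa_def continuous_intros)
  have coef_b: "fb k g = fb k h" for k
    using split[of "\<lambda>t. sin (real k * t)"] sin_int[of k] by (simp add: fb_def continuous_intros)
  have coef_0: "fa 0 g = 0"
    using split[of "\<lambda>t. cos (real 0 * t)"] cos_int[of 0] by (simp add: fa_def \<mu>_def)
  define \<alpha> where "\<alpha> k = r * vp_weight n N k * fa k g" for k
  define \<gamma> where "\<gamma> k = r * vp_weight n N k * fb k g" for k
  define \<phi> where "\<phi> = (\<lambda>t. \<Sum>k=1..N. \<alpha> k * cos (real k * t) + \<gamma> k * sin (real k * t))"
  have \<phi>_eq: "\<phi> t = r * (\<Sum>k\<le>N. vp_weight n N k * fA k g t)" for t
  proof -
    have "(\<Sum>k\<le>N. vp_weight n N k * fA k g t) = (\<Sum>k=1..N. vp_weight n N k * fA k g t)"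
      by (intro sum.mono_neutral_right) (auto simp: fA_def coef_0 not_le)
    thus ?thesis unfolding \<phi>_def \<alpha>_def \<gamma>_def
      by (auto simp: fA_def sum_distrib_left algebra_simps intro!: sum.cong)
  qed
  have \<phi>_le: "\<bar>\<phi> t\<bar> \<le> 1" for t
  proof -
    have "\<bar>\<phi> t\<bar> = r * \<bar>\<Sum>k\<le>N. vp_weight n N k * fA k g t\<bar>" using r by (simp add: \<phi>_eq abs_mult)
    also have "\<dots> \<le> r * ((1 + m) * ((real N + real n) / (real N - real n)))"
      using r by (intro mult_left_mono vp_sum_le eg N) auto
    also have "\<dots> = 1" using N m0 by (auto simp: r_def)
    finally show ?thesis .
  qed
  \<comment> \<open>The rotation inverse to the one in \<open>Cpsi\<close>, so that
    \<open>\<phi>\<close> becomes the derivative of \<open>f\<close>.\<close>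
  define a where "a k = \<psi> (real k) * (\<alpha> k * cos \<theta> - \<gamma> k * sin \<theta>)" for k
  define b where "b k = \<psi> (real k) * (\<gamma> k * cos \<theta> + \<alpha> k * sin \<theta>)" for k
  define f where "f = (\<lambda>t. \<Sum>k=1..N. a k * cos (real k * t) + b k * sin (real k * t))"
  have faf: "fa k f = (if k \<in> {1..N} then a k else 0)" and fbf: "fb k f = (if k \<in> {1..N} then b k else 0)" for k
    unfolding f_def fa_trig_sum fb_trig_sum by auto
  have fa\<phi>: "fa k \<phi> = (if k \<in> {1..N} then \<alpha> k else 0)" and fb\<phi>: "fb k \<phi> = (if k \<in> {1..N} then \<gamma> k else 0)" for k
    unfolding \<phi>_def fa_trig_sum fb_trig_sum by auto
  have f_C: "in_C f" unfolding f_def by (rule in_C_trig_sum)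
  have "in_C \<phi>" unfolding \<phi>_def by (rule in_C_trig_sum)
  hence \<phi>_meas: "\<phi> \<in> borel_measurable lborel" by (auto simp: in_C_def intro: borel_measurable_continuous_onI)
  have f_in: "f \<in> Cpsi \<psi> \<beta>"
    unfolding Cpsi_def
  proof (intro CollectI conjI f_C exI[of _ \<phi>] \<phi>_meas AE_I2 \<phi>_le allI impI)
    show "fa 0 \<phi> = 0" by (simp add: fa\<phi>)
  next
    fix k :: nat assume k: "1 \<le> k"
    hence \<psi>k: "\<psi> (real k) > 0" using M by (auto simp: in_M_def)
    have cs: "(sin \<theta>)\<^sup>2 + (cos \<theta>)\<^sup>2 = 1" by simp
    have "a k * cos \<theta> + b k * sin \<theta> = \<psi> (real k) * \<alpha> k"
      unfolding a_def b_def using cs unfolding power2_eq_square by algebra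
    moreover have "b k * cos \<theta> - a k * sin \<theta> = \<psi> (real k) * \<gamma> k"
      unfolding a_def b_def using cs unfolding power2_eq_square by algebra
    ultimately show "fa k \<phi> = (fa k f * cos (\<beta> * pi / 2) + fb k f * sin (\<beta> * pi / 2)) / \<psi> (real k)"
      "fb k \<phi> = (fb k f * cos (\<beta> * pi / 2) - fa k f * sin (\<beta> * pi / 2)) / \<psi> (real k)"
      using \<psi>k by (auto simp: fa\<phi> fb\<phi> faf fbf \<theta>_def)
  qed
  have fA0: "fA k f 0 = \<psi> (real k) * (r * vp_weight n N k * (fa k h * cos (real k * 0 - \<theta>) + fb k h * sin (real k * 0 - \<theta>)))"
    if "k \<in> {1..N}" for k
    using that coef_a[of k] coef_b[of k]
    by (simp add: fA_def faf fbf a_def \<alpha>_def \<gamma>_def algebra_simps)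
  have f0: "f 0 = (\<Sum>k=1..N. fA k f 0)" by (simp add: fA_def faf) (simp add: f_def)
  have "U \<psi> n p f 0 = (\<Sum>k=1..N. (if k < n then lam \<psi> n p k else 0) * fA k f 0)"
  proof -
    have "U \<psi> n p f 0 = (\<Sum>k\<in>{..<n} \<inter> {1..N}. lam \<psi> n p k * fA k f 0)"
      unfolding U_def by (intro sum.mono_neutral_right) (auto simp: fA_def faf fbf)
    also have "\<dots> = (\<Sum>k=1..N. (if k < n then lam \<psi> n p k else 0) * fA k f 0)"
      by (intro sum.mono_neutral_cong_left) auto
    finally show ?thesis .
  qed
  hence "f 0 - U \<psi> n p f 0 = (\<Sum>k=1..N. (1 - (if k < n then lam \<psi> n p k else 0)) * fA k f 0)"
    unfolding f0 by (simp add: sum_subtractf left_diff_distrib)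
  also have "\<dots> = (\<Sum>k=1..N. r * (\<psi> (real n) * (kcoef \<psi> n p N k * (fa k h * cos (real k * 0 - \<theta>) + fb k h * sin (real k * 0 - \<theta>)))))"
  proof (intro sum.cong refl)
    fix k assume k: "k \<in> {1..N}"
    \<comment> \<open>Where \<open>lam\<close> is present, below \<open>n\<close>, the weight is
      \<open>1\<close>.\<close>
    have "(1 - (if k < n then lam \<psi> n p k else 0)) * vp_weight n N k = vp_weight n N k - (if k < n then lam \<psi> n p k else 0)"
      by (auto simp: vp_weight_def)
    moreover have "\<dots> * \<psi> (real k) = \<psi> (real n) * kcoef \<psi> n p N k"
      using weight_minus_lam[OF M p N, of k] k by auto
    ultimately have *: "(1 - (if k < n then lam \<psi> n p k else 0)) * (\<psi> (real k) * vp_weight n N k) = \<psi> (real n) * kcoef \<psi> n p N k"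
      by (simp add: mult_ac)
    have "(1 - (if k < n then lam \<psi> n p k else 0)) * fA k f 0 =
       r * (((1 - (if k < n then lam \<psi> n p k else 0)) * (\<psi> (real k) * vp_weight n N k)) * (fa k h * cos (real k * 0 - \<theta>) + fb k h * sin (real k * 0 - \<theta>)))"
      unfolding fA0[OF k] by (simp only: mult_ac)
    thus "(1 - (if k < n then lam \<psi> n p k else 0)) * fA k f 0 =
       r * (\<psi> (real n) * (kcoef \<psi> n p N k * (fa k h * cos (real k * 0 - \<theta>) + fb k h * sin (real k * 0 - \<theta>))))"
      unfolding * by (simp only: mult.assoc)
  qed
  also have "\<dots> = r * (\<psi> (real n) * ((LBINT t:{-pi..pi}. h t * dev_kernel \<psi> n p N \<theta> (- t)) / pi))"
    unfolding sum_distrib_left[symmetric] dev_kernel_sum_eq_integral[OF eh] by simp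
  finally have eq: "\<bar>f 0 - U \<psi> n p f 0\<bar> = \<psi> (real n) / pi * r * \<bar>LBINT t:{-pi..pi}. h t * dev_kernel \<psi> n p N \<theta> (- t)\<bar>"
    using r \<psi>n by (simp add: abs_mult)
  have "ereal (\<psi> (real n) / pi * r * \<bar>LBINT t:{-pi..pi}. h t * dev_kernel \<psi> n p N \<theta> (- t)\<bar>) \<le> ereal (normC (\<lambda>x. f x - U \<psi> n p f x))"
    unfolding eq[symmetric] using in_C_le_normC[OF in_C_minus_U[OF f_C]] by simp
  also have "\<dots> \<le> Err \<psi> \<beta> n p" unfolding Err_def by (rule SUP_upper[OF f_in])
  finally show ?thesis unfolding r_def \<theta>_def .
qed

section \<open>Approximation of the kernel in the mean\<close>

text \<open>Jordan's inequality with \<open>1/4\<close> in place of the sharp \<open>1/pi\<close>: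
  one duplication of the angle leaves only \<open>cos (pi / 4)\<close> to be known.\<close>

lemma sin_half_ge:
  assumes "0 \<le> t" "t \<le> pi" shows "t / 4 \<le> sin (t / 2)"
proof -
  have c: "cos x \<ge> sqrt 2 / 2" if "0 \<le> x" "x \<le> pi / 4" for x
    using cos_monotone_0_pi_le[of x "pi/4"] that by (simp add: cos_45)
  have "sin y \<ge> sqrt 2 / 2 * y" if y: "0 \<le> y" "y \<le> pi / 4" for y
  proof (cases "y = 0")
    case False
    hence "\<exists>z. 0 < z \<and> z < y \<and> sin y - sin 0 = (y - 0) * cos z"
      using y by (intro MVT2) auto
    then obtain z where z: "0 < z" "z < y" "sin y = y * cos z" by auto
    have "y * (sqrt 2 / 2) \<le> y * cos z" using z y by (intro mult_left_mono c) auto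
    thus ?thesis using z by (simp add: mult.commute)
  qed simp
  from this[of "t/4"] have s: "sqrt 2 / 2 * (t / 4) \<le> sin (t / 4)" using assms by simp
  have s0: "0 \<le> sin (t / 4)" using assms by (intro order.trans[OF _ s]) simp
  have "sin (t / 2) = 2 * sin (t / 4) * cos (t / 4)" using sin_double[of "t/4"] by simp
  moreover have "2 * (sqrt 2 / 2 * (t / 4)) * (sqrt 2 / 2) \<le> 2 * sin (t / 4) * cos (t / 4)"
    using s s0 c[of "t/4"] assms by (intro mult_mono) auto
  moreover have "2 * (sqrt 2 / 2 * (t / 4)) * (sqrt 2 / 2) = t / 4"
    by simp
  ultimately show ?thesis by linarith
qed

lemma sin_diff_le_min:
  fixes x y :: real
  shows "\<bar>sin x - sin y\<bar> \<le> \<bar>x - y\<bar>" "\<bar>sin x - sin y\<bar> \<le> 2"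
proof -
  have "\<bar>sin x - sin y\<bar> = 2 * \<bar>sin ((x - y) / 2)\<bar> * \<bar>cos ((x + y) / 2)\<bar>"
    by (simp add: sin_diff_sin abs_mult)
  also have "\<dots> \<le> 2 * \<bar>(x - y) / 2\<bar> * 1"
    by (intro mult_mono abs_sin_x_le_abs_x abs_cos_le_one) auto
  finally show "\<bar>sin x - sin y\<bar> \<le> \<bar>x - y\<bar>" by simp
  show "\<bar>sin x - sin y\<bar> \<le> 2" using abs_sin_le_one[of x] abs_sin_le_one[of y] by linarith
qed

lemma abel_bound:
  fixes c d :: "nat \<Rightarrow> real"
  assumes c: "\<And>k. \<bar>c k\<bar> \<le> 1" and "m < M"
    and nonneg: "\<And>k. m \<le> k \<Longrightarrow> k < M \<Longrightarrow> 0 \<le> d k"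
    and anti: "\<And>k. m \<le> k \<Longrightarrow> Suc k < M \<Longrightarrow> d (Suc k) \<le> d k"
  shows "\<bar>\<Sum>k=m..<M. d k * (c k - c (Suc k))\<bar> \<le> 2 * d m"
proof -
  \<comment> \<open>The partial sum is completed by its boundary term. Each step then adds a
    decrement of \<open>d\<close> times a value of \<open>c\<close>, and the bound grows by exactly
    that decrement; removing the boundary term at the end uses up the remaining
    \<open>d (m + j)\<close>.\<close>
  have *: "\<bar>(\<Sum>k=m..<Suc (m+j). d k * (c k - c (Suc k))) + d (m+j) * c (Suc (m+j))\<bar> \<le> 2 * d m - d (m+j)"
    if "m + j < M" for j
    using that
  proof (induction j)
    case 0
    have "\<bar>d m * c m\<bar> \<le> d m * 1" unfolding abs_mult using nonneg[of m] c[of m] 0 by (intro mult_mono) auto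
    thus ?case by (simp add: algebra_simps)
  next
    case (Suc j)
    let ?S = "(\<Sum>k=m..<Suc (m+j). d k * (c k - c (Suc k))) + d (m+j) * c (Suc (m+j))"
    have "\<bar>(d (m+j) - d (Suc (m+j))) * c (Suc (m+j))\<bar> \<le> (d (m+j) - d (Suc (m+j))) * 1"
      unfolding abs_mult using anti[of "m+j"] c[of "Suc (m+j)"] Suc.prems by (intro mult_mono) auto
    moreover have "\<bar>?S\<bar> \<le> 2 * d m - d (m+j)" using Suc by simp
    moreover have "(\<Sum>k=m..<Suc (m+Suc j). d k * (c k - c (Suc k))) + d (m+Suc j) * c (Suc (m+Suc j)) =
      ?S - (d (m+j) - d (Suc (m+j))) * c (Suc (m+j))" by (simp add: algebra_simps)
    ultimately show ?case by simp
  qed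
  define j where "j = M - Suc m"
  have j: "M = Suc (m + j)" "m + j < M" using \<open>m < M\<close> by (auto simp: j_def)
  have "\<bar>d (m+j) * c (Suc (m+j))\<bar> \<le> d (m+j) * 1"
    unfolding abs_mult using nonneg[of "m+j"] c j by (intro mult_mono) auto
  thus ?thesis using *[OF j(2)] unfolding j(1) by linarith
qed

text \<open>Multiplication by \<open>2 * sin (t / 2)\<close> turns each sine into a difference of
  consecutive cosines, to which Abel's bound applies.\<close>

lemma sin_sum_le:
  assumes t: "0 < t" "t \<le> pi" and "m < M"
    and nonneg: "\<And>k. m \<le> k \<Longrightarrow> k < M \<Longrightarrow> 0 \<le> d k"
    and anti: "\<And>k. m \<le> k \<Longrightarrow> Suc k < M \<Longrightarrow> d (Suc k) \<le> d k"
  shows "\<bar>\<Sum>k=m..<M. d k * sin ((real k + 1/2) * t - \<theta>)\<bar> \<le> 4 * d m / t"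
proof -
  have s: "sin (t / 2) \<ge> t / 4" "sin (t / 2) > 0" using sin_half_ge[of t] t by auto
  have "2 * sin (t / 2) * sin ((real k + 1/2) * t - \<theta>) = cos (real k * t - \<theta>) - cos (real (Suc k) * t - \<theta>)" for k
  proof -
    have "real k * t - \<theta> = ((real k + 1/2) * t - \<theta>) - t / 2"
      "real (Suc k) * t - \<theta> = ((real k + 1/2) * t - \<theta>) + t / 2" by (auto simp: algebra_simps)
    thus ?thesis by (simp only: cos_add cos_diff) simp
  qed
  hence "2 * sin (t / 2) * (\<Sum>k=m..<M. d k * sin ((real k + 1/2) * t - \<theta>)) =
      (\<Sum>k=m..<M. d k * (cos (real k * t - \<theta>) - cos (real (Suc k) * t - \<theta>)))"
    unfolding sum_distrib_left by (intro sum.cong refl) (metis mult.left_commute)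
  hence "\<bar>2 * sin (t / 2) * (\<Sum>k=m..<M. d k * sin ((real k + 1/2) * t - \<theta>))\<bar> \<le> 2 * d m"
    using abel_bound[of "\<lambda>k. cos (real k * t - \<theta>)" m M d] assms by simp
  hence "sin (t / 2) * \<bar>\<Sum>k=m..<M. d k * sin ((real k + 1/2) * t - \<theta>)\<bar> \<le> d m"
    using s by (simp add: abs_mult)
  moreover have "t / 4 * \<bar>\<Sum>k=m..<M. d k * sin ((real k + 1/2) * t - \<theta>)\<bar> \<le>
       sin (t / 2) * \<bar>\<Sum>k=m..<M. d k * sin ((real k + 1/2) * t - \<theta>)\<bar>"
    using s by (intro mult_right_mono) auto
  ultimately show ?thesis using t by (simp add: field_simps)
qed

text \<open>The cost of concentrating all weights \<open>d\<close> at frequency \<open>n\<close>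
  inside the window of width \<open>1 / R\<close>, and of discarding the mean outside it.\<close>

definition avg_error :: "(nat \<Rightarrow> real) \<Rightarrow> nat \<Rightarrow> nat \<Rightarrow> nat \<Rightarrow> real \<Rightarrow> real \<Rightarrow> real \<Rightarrow> real" where
  "avg_error d m M n R \<theta> t = ((\<Sum>k=m..<M. d k * sin ((real k + 1/2) * t - \<theta>)) -
     (if \<bar>t\<bar> \<le> 1 / R then sin (real n * t - \<theta>) else 0)) / (2 * sin (t / 2))"

text \<open>On this range the estimate rests on \<open>min 2 (a * t) \<le> 3 * a * t / (1 + a * t)\<close>, whose quotient by
  \<open>t\<close> integrates to a logarithm.\<close>

lemma avg_error_near:
  assumes t: "0 < t" "t \<le> pi" "t \<le> 1 / R" and sum: "(\<Sum>k=m..<M. d k) = 1"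
    and nonneg: "\<And>k. m \<le> k \<Longrightarrow> k < M \<Longrightarrow> 0 \<le> d k"
  shows "\<bar>avg_error d m M n R \<theta> t\<bar> \<le>
    6 * (\<Sum>k=m..<M. d k * (\<bar>real k + 1/2 - real n\<bar> / (1 + \<bar>real k + 1/2 - real n\<bar> * t)))"
proof -
  define a where "a k = \<bar>real k + 1/2 - real n\<bar>" for k
  have s: "sin (t / 2) \<ge> t / 4" "sin (t / 2) > 0" using sin_half_ge[of t] t by auto
  have "sin (real n * t - \<theta>) = (\<Sum>k=m..<M. d k * sin (real n * t - \<theta>))"
    unfolding sum_distrib_right[symmetric] sum by simp
  hence num: "(\<Sum>k=m..<M. d k * sin ((real k + 1/2) * t - \<theta>)) - (if \<bar>t\<bar> \<le> 1 / R then sin (real n * t - \<theta>) else 0) =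
    (\<Sum>k=m..<M. d k * (sin ((real k + 1/2) * t - \<theta>) - sin (real n * t - \<theta>)))"
    using t by (simp add: right_diff_distrib sum_subtractf)
  have "\<bar>\<Sum>k=m..<M. d k * (sin ((real k + 1/2) * t - \<theta>) - sin (real n * t - \<theta>))\<bar> \<le>
     (\<Sum>k=m..<M. d k * (3 * (a k * t / (1 + a k * t))))"
  proof (rule order.trans[OF sum_abs], rule sum_mono)
    fix k assume k: "k \<in> {m..<M}"
    have at: "a k * t \<ge> 0" using t by (simp add: a_def)
    have "(real k + 1/2) * t - \<theta> - (real n * t - \<theta>) = (real k + 1/2 - real n) * t" by (simp add: algebra_simps)
    hence "\<bar>(real k + 1/2) * t - \<theta> - (real n * t - \<theta>)\<bar> = a k * t" using t by (simp only: abs_mult a_def)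
    hence "\<bar>sin ((real k + 1/2) * t - \<theta>) - sin (real n * t - \<theta>)\<bar> \<le> min 2 (a k * t)"
      using sin_diff_le_min[of "(real k + 1/2) * t - \<theta>" "real n * t - \<theta>"] by simp
    also have "min 2 (a k * t) \<le> 3 * (a k * t / (1 + a k * t))"
    proof (cases "a k * t \<le> 2")
      case True
      have "a k * t * (1 + a k * t) \<le> a k * t * 3" using True at by (intro mult_left_mono) auto
      thus ?thesis using True at by (simp add: min_def field_simps)
    next
      case False
      thus ?thesis using at by (simp add: min_def field_simps)
    qed
    finally show "\<bar>d k * (sin ((real k + 1/2) * t - \<theta>) - sin (real n * t - \<theta>))\<bar> \<le> d k * (3 * (a k * t / (1 + a k * t)))"
      unfolding abs_mult using nonneg[of k] k by (intro mult_mono) auto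
  qed
  also have "\<dots> = 3 * t * (\<Sum>k=m..<M. d k * (a k / (1 + a k * t)))"
    unfolding sum_distrib_left by (intro sum.cong) auto
  finally have N: "\<bar>\<Sum>k=m..<M. d k * (sin ((real k + 1/2) * t - \<theta>) - sin (real n * t - \<theta>))\<bar> \<le>
     3 * t * (\<Sum>k=m..<M. d k * (a k / (1 + a k * t)))" .
  have S0: "0 \<le> (\<Sum>k=m..<M. d k * (a k / (1 + a k * t)))"
    using nonneg t by (intro sum_nonneg mult_nonneg_nonneg divide_nonneg_nonneg) (auto simp: a_def)
  have "\<bar>avg_error d m M n R \<theta> t\<bar> = \<bar>\<Sum>k=m..<M. d k * (sin ((real k + 1/2) * t - \<theta>) - sin (real n * t - \<theta>))\<bar> / (2 * sin (t / 2))"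
    unfolding avg_error_def num using s by simp
  also have "\<dots> \<le> (3 * t * (\<Sum>k=m..<M. d k * (a k / (1 + a k * t)))) / (2 * (t / 4))"
    using s t S0 by (intro frac_le N mult_left_mono mult_nonneg_nonneg) auto
  also have "\<dots> = 6 * (\<Sum>k=m..<M. d k * (a k / (1 + a k * t)))" using t by simp
  finally show ?thesis unfolding a_def .
qed

lemma avg_error_far:
  assumes t: "0 < t" "t \<le> pi" "1 / R < t" and R: "R \<ge> 1" and "m < M"
    and nonneg: "\<And>k. m \<le> k \<Longrightarrow> k < M \<Longrightarrow> 0 \<le> d k"
    and anti: "\<And>k. m \<le> k \<Longrightarrow> Suc k < M \<Longrightarrow> d (Suc k) \<le> d k"
  shows "\<bar>avg_error d m M n R \<theta> t\<bar> \<le> 32 * d m * (R\<^sup>2 / (1 + R * t)\<^sup>2)"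
proof -
  have s: "sin (t / 2) \<ge> t / 4" "sin (t / 2) > 0" using sin_half_ge[of t] t by auto
  have d0: "d m \<ge> 0" using nonneg \<open>m < M\<close> by auto
  have "\<bar>avg_error d m M n R \<theta> t\<bar> = \<bar>\<Sum>k=m..<M. d k * sin ((real k + 1/2) * t - \<theta>)\<bar> / (2 * sin (t / 2))"
    unfolding avg_error_def using s t by simp
  also have "\<dots> \<le> (4 * d m / t) / (2 * (t / 4))"
    using s t d0 by (intro frac_le sin_sum_le assms mult_left_mono) auto
  also have "\<dots> = 8 * d m * (1 / t\<^sup>2)" using t by (simp add: power2_eq_square field_simps)
  \<comment> \<open>Outside the window \<open>1 / t\<^sup>2\<close> is comparable with this
    function, which, unlike it, is continuous up to \<open>0\<close> and can be integrated over all
    of \<open>[0, pi]\<close>.\<close>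
  also have "\<dots> \<le> 8 * d m * (4 * (R\<^sup>2 / (1 + R * t)\<^sup>2))"
  proof (intro mult_left_mono)
    have "1 + R * t \<le> 2 * (R * t)" using t R by (simp add: field_simps)
    hence "(1 + R * t)\<^sup>2 \<le> (2 * (R * t))\<^sup>2" using t R by (intro power_mono) auto
    moreover have "0 < (1 + R * t)\<^sup>2" using t R by (intro zero_less_power add_pos_nonneg) auto
    ultimately show "1 / t\<^sup>2 \<le> 4 * (R\<^sup>2 / (1 + R * t)\<^sup>2)"
      using t by (simp add: divide_le_eq le_divide_eq power_mult_distrib mult_ac)
  qed (use d0 in auto)
  finally show ?thesis by simp
qed

lemma set_integral_indicator_Icc:
  fixes u :: "real \<Rightarrow> real"
  assumes "a \<le> c" "c \<le> b"
  shows "(LBINT t:{a..b}. indicator {a..c} t * u t) = (LBINT t:{a..c}. u t)"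
    "set_integrable lborel {a..b} (\<lambda>t. indicator {a..c} t * u t) \<longleftrightarrow> set_integrable lborel {a..c} u"
proof -
  have "(\<lambda>t. indicator {a..b} t *\<^sub>R (indicator {a..c} t * u t)) = (\<lambda>t. indicator {a..c} t *\<^sub>R u t)"
    using assms by (auto simp: indicator_def)
  thus "(LBINT t:{a..b}. indicator {a..c} t * u t) = (LBINT t:{a..c}. u t)"
    "set_integrable lborel {a..b} (\<lambda>t. indicator {a..c} t * u t) \<longleftrightarrow> set_integrable lborel {a..c} u"
    unfolding set_lebesgue_integral_def set_integrable_def by simp_all
qed

text \<open>Both majorants have explicit primitives: inside the window each weight contributes a
  logarithm, outside it the integral of \<open>R\<^sup>2 / (1 + R * t)\<^sup>2\<close> is at most
  \<open>R\<close>.\<close>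

lemma avg_error_integral:
  assumes R: "R \<ge> 1" and "m < M" and sum: "(\<Sum>k=m..<M. d k) = 1"
    and nonneg: "\<And>k. m \<le> k \<Longrightarrow> k < M \<Longrightarrow> 0 \<le> d k"
    and anti: "\<And>k. m \<le> k \<Longrightarrow> Suc k < M \<Longrightarrow> d (Suc k) \<le> d k"
  shows "set_integrable lborel {0..pi} (avg_error d m M n R \<theta>)"
    "(LBINT t:{0..pi}. \<bar>avg_error d m M n R \<theta> t\<bar>) \<le>
       6 * (\<Sum>k=m..<M. d k * ln (1 + \<bar>real k + 1/2 - real n\<bar> / R)) + 32 * d m * R"
proof -
  define a where "a k = \<bar>real k + 1/2 - real n\<bar>" for k
  define u where "u t = 6 * (\<Sum>k=m..<M. d k * (a k / (1 + a k * t)))" for t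
  define v where "v t = 32 * d m * (R\<^sup>2 / (1 + R * t)\<^sup>2)" for t
  have d0: "d m \<ge> 0" using nonneg \<open>m < M\<close> by auto
  have R1: "1 / R \<le> 1" "0 < 1 / R" using R by auto
  hence R2: "1 / R \<le> pi" using pi_gt3 by linarith
  have pos: "1 + a k * t > 0" if "t \<ge> 0" for k t using that by (auto simp: a_def intro: add_pos_nonneg)
  have posR: "1 + R * t > 0" if "t \<ge> 0" for t using that R by (auto intro: add_pos_nonneg)
  have u0: "u t \<ge> 0" if "t \<ge> 0" for t
    unfolding u_def using nonneg that
    by (intro mult_nonneg_nonneg sum_nonneg divide_nonneg_nonneg) (auto simp: a_def)
  have v0: "v t \<ge> 0" if "t \<ge> 0" for t unfolding v_def using d0 that by simp
  have le: "\<bar>avg_error d m M n R \<theta> t\<bar> \<le> indicator {0..1/R} t * u t + v t" if t: "t \<in> {0..pi}" for t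
  proof (cases "t = 0")
    case True
    \<comment> \<open>Division by zero makes \<open>avg_error\<close> equal to \<open>0\<close>
      here.\<close>
    thus ?thesis using u0[of 0] v0[of 0] R1 by (simp add: avg_error_def)
  next
    case False
    show ?thesis
    proof (cases "t \<le> 1 / R")
      case True
      have "\<bar>avg_error d m M n R \<theta> t\<bar> \<le> u t"
        unfolding u_def a_def using True False t sum nonneg by (intro avg_error_near) auto
      thus ?thesis using True t v0[of t] by (simp add: indicator_def)
    next
      case False
      have "\<bar>avg_error d m M n R \<theta> t\<bar> \<le> v t"
        unfolding v_def using False \<open>t \<noteq> 0\<close> t R \<open>m < M\<close> nonneg anti by (intro avg_error_far) auto
      thus ?thesis using False t by (simp add: indicator_def)
    qed
  qed
  have cu: "continuous_on {0..1/R} u"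
    unfolding u_def using pos by (intro continuous_intros) (auto simp: less_imp_neq[symmetric])
  have cv: "continuous_on {0..pi} v"
    unfolding v_def using posR by (intro continuous_intros) (auto simp: less_imp_neq[symmetric])
  have iu: "set_integrable lborel {0..pi} (\<lambda>t. indicator {0..1/R} t * u t)"
    using R1 R2 by (subst set_integral_indicator_Icc) (auto intro!: borel_integrable_atLeastAtMost' cu)
  have iv: "set_integrable lborel {0..pi} v" by (intro borel_integrable_atLeastAtMost' cv)
  have iuv: "set_integrable lborel {0..pi} (\<lambda>t. indicator {0..1/R} t * u t + v t)"
    by (intro set_integral_add iu iv)
  have meas: "avg_error d m M n R \<theta> \<in> borel_measurable borel"
    unfolding avg_error_def by measurable
  show int: "set_integrable lborel {0..pi} (avg_error d m M n R \<theta>)"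
    by (rule set_integrable_bound[OF iuv])
       (use meas le in \<open>auto simp: set_borel_measurable_def intro!: AE_I2 order.trans[OF le]\<close>)
  have "(LBINT t:{0..pi}. \<bar>avg_error d m M n R \<theta> t\<bar>) \<le> (LBINT t:{0..pi}. indicator {0..1/R} t * u t + v t)"
    using le by (intro set_integral_mono set_integrable_abs int iuv)
  also have "\<dots> = (LBINT t:{0..pi}. indicator {0..1/R} t * u t) + (LBINT t:{0..pi}. v t)"
    by (intro set_integral_add iu iv)
  also have "(LBINT t:{0..pi}. indicator {0..1/R} t * u t) = (LBINT t:{0..1/R}. u t)"
    using R1 R2 by (intro set_integral_indicator_Icc) auto
  also have "(LBINT t:{0..1/R}. u t) = 6 * (\<Sum>k=m..<M. d k * ln (1 + a k * (1 / R))) - 6 * (\<Sum>k=m..<M. d k * ln (1 + a k * 0))"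
  proof (rule set_integral_FTC_Icc)
    fix t :: real assume t: "0 \<le> t" "t \<le> 1 / R"
    show "((\<lambda>t. 6 * (\<Sum>k=m..<M. d k * ln (1 + a k * t))) has_real_derivative u t) (at t)"
      unfolding u_def using pos[OF t(1)] by (auto intro!: derivative_eq_intros simp: field_simps)
    show "isCont u t" unfolding u_def
      using pos[OF t(1)] by (intro continuous_intros) (auto simp: less_imp_neq[symmetric])
  qed (use R1 in auto)
  also have "(LBINT t:{0..pi}. v t) = - 32 * d m * (R / (1 + R * pi)) - (- 32 * d m * (R / (1 + R * 0)))"
  proof (rule set_integral_FTC_Icc)
    fix t :: real assume t: "0 \<le> t" "t \<le> pi"
    have "1 + R * t \<noteq> 0" using posR[OF t(1)] by simp
    thus "((\<lambda>t. - 32 * d m * (R / (1 + R * t))) has_real_derivative v t) (at t)"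
      unfolding v_def by (auto intro!: derivative_eq_intros simp: power2_eq_square)
    show "isCont v t" unfolding v_def
      using posR[OF t(1)] by (intro continuous_intros) (auto simp: less_imp_neq[symmetric])
  qed (use pi_gt_zero in auto)
  also have "\<dots> \<le> 32 * d m * R"
    using d0 R posR[of pi] by (simp add: divide_nonneg_nonneg)
  finally show "(LBINT t:{0..pi}. \<bar>avg_error d m M n R \<theta> t\<bar>) \<le>
       6 * (\<Sum>k=m..<M. d k * ln (1 + \<bar>real k + 1/2 - real n\<bar> / R)) + 32 * d m * R"
    by (simp add: a_def)
qed

section \<open>Splitting of the kernel by summation by parts\<close>

definition main_part :: "nat \<Rightarrow> real \<Rightarrow> real \<Rightarrow> real \<Rightarrow> real \<Rightarrow> real" where
  "main_part n R S \<theta> t = ((if \<bar>t\<bar> \<le> 1 / R then 1 else 0) - (if \<bar>t\<bar> \<le> 1 / S then 1 else 0)) *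
     (sin (real n * t - \<theta>) / (2 * sin (t / 2)))"

definition cut_lo :: "real \<Rightarrow> real \<Rightarrow> real" where "cut_lo R S = min (1 / R) (1 / S)"

definition cut_hi :: "real \<Rightarrow> real \<Rightarrow> real" where "cut_hi R S = max (1 / R) (1 / S)"

lemma cut_lo_hi:
  assumes "R \<ge> 1" "S \<ge> 1" shows "0 < cut_lo R S" "cut_lo R S \<le> cut_hi R S" "cut_hi R S \<le> 1"
  using assms by (auto simp: cut_lo_def cut_hi_def)

text \<open>Below \<open>cut_lo\<close> both windows are open and cancel, so the pole of
  \<open>1 / sin (t / 2)\<close> never enters; which window is the wider one decides the
  sign.\<close>

lemma main_part_half:
  assumes "R \<ge> 1" "S \<ge> 1" "0 \<le> t"
  shows "main_part n R S \<theta> t = (if R \<le> S then 1 else -1) *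
    (if cut_lo R S < t \<and> t \<le> cut_hi R S then sin (real n * t - \<theta>) / (2 * sin (t / 2)) else 0)"
proof (cases "R \<le> S")
  case True
  hence "1 / S \<le> 1 / R" using assms by (simp add: frac_le)
  thus ?thesis using True assms by (auto simp: main_part_def cut_lo_def cut_hi_def min_def max_def)
next
  case False
  hence "1 / R < 1 / S" using assms by (simp add: frac_less2)
  thus ?thesis using False assms by (auto simp: main_part_def cut_lo_def cut_hi_def min_def max_def)
qed

lemma borel_measurable_main_part [measurable]: "main_part n R S \<theta> \<in> borel_measurable borel"
  unfolding main_part_def by measurable

lemma main_part_integrable:
  assumes "R \<ge> 1" "S \<ge> 1"
  shows "set_integrable lborel {0..pi} (main_part n R S \<theta>)"
proof -
  note l = cut_lo_hi[OF assms]
  show ?thesis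
  proof (rule set_integrable_bounded_real[where B = "2 / cut_lo R S"], measurable, intro AE_I2 impI)
    fix t assume t: "t \<in> {0..pi}"
    show "\<bar>main_part n R S \<theta> t\<bar> \<le> 2 / cut_lo R S"
    proof (cases "cut_lo R S < t")
      case False thus ?thesis using t l by (simp add: main_part_half[OF assms])
    next
      case True
      have "sin (t / 2) \<ge> t / 4" using sin_half_ge t by auto
      hence "\<bar>sin (real n * t - \<theta>) / (2 * sin (t / 2))\<bar> \<le> 1 / (2 * (cut_lo R S / 4))"
        unfolding abs_divide using True l by (intro frac_le) auto
      thus ?thesis using t l by (auto simp: main_part_half[OF assms] abs_mult)
    qed
  qed
qed

lemma summation_by_parts:
  fixes c s :: "nat \<Rightarrow> real"
  shows "(\<Sum>k=1..N. c k * (s k - s (k - 1))) = (\<Sum>k<N. (c k - c (Suc k)) * s k) + c N * s N - c 0 * s 0"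
  by (induction N) (auto simp: algebra_simps)

context class_M begin

lemma kcoef_n: "1 \<le> p \<Longrightarrow> p \<le> n \<Longrightarrow> n < N \<Longrightarrow> kcoef \<psi> n p N n = 1"
  using pos[of "real n"] by (auto simp: kcoef_def)

lemma kcoef_tail:
  "1 \<le> p \<Longrightarrow> p \<le> n \<Longrightarrow> n \<le> k \<Longrightarrow>
    kcoef \<psi> n p N k = \<psi> (real k) / \<psi> (real n) * ((real N - real k) / (real N - real n))"
  by (auto simp: kcoef_def)

text \<open>Both boundary terms vanish, the upper one because the weight is \<open>0\<close> at
  \<open>N\<close>. The rise of the multipliers gives the weights \<open>1 / p\<close> with a minus
  sign, their fall the weights above \<open>n\<close>. \<open>R\<close> is arbitrary: its window is
  added in \<open>main_part\<close> and removed in \<open>avg_error\<close>.\<close>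

lemma dev_kernel_eq:
  assumes p: "1 \<le> p" "p \<le> n" "n < N" and t: "0 < t" "t \<le> pi"
  shows "dev_kernel \<psi> n p N \<theta> t = main_part n R (real p) \<theta> t
     + avg_error (\<lambda>k. kcoef \<psi> n p N k - kcoef \<psi> n p N (Suc k)) n N n R \<theta> t
     - avg_error (\<lambda>k. 1 / real p) (n - p) n n (real p) \<theta> t"
proof -
  define c where "c = kcoef \<psi> n p N"
  define s where "s k = sin ((real k + 1/2) * t - \<theta>)" for k
  have sp: "sin (t / 2) > 0" using sin_half_ge[of t] t by auto
  have c0: "c 0 = 0" using p by (simp add: c_def kcoef_def)
  have cN: "c N = 0" using p by (simp add: c_def kcoef_def)
  have "2 * sin (t / 2) * dev_kernel \<psi> n p N \<theta> t = (\<Sum>k=1..N. c k * (s k - s (k - 1)))"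
    unfolding dev_kernel_def sum_distrib_left
  proof (intro sum.cong refl)
    fix k assume k: "k \<in> {1..N}"
    have "(real k + 1/2) * t - \<theta> = (real k * t - \<theta>) + t / 2"
      "(real (k - 1) + 1/2) * t - \<theta> = (real k * t - \<theta>) - t / 2" using k by (auto simp: algebra_simps of_nat_diff)
    hence "s k - s (k - 1) = 2 * sin (t / 2) * cos (real k * t - \<theta>)"
      unfolding s_def by (simp only: sin_add sin_diff) simp
    thus "2 * sin (t / 2) * (kcoef \<psi> n p N k * cos (real k * t - \<theta>)) = c k * (s k - s (k - 1))"
      by (simp add: c_def)
  qed
  also have "\<dots> = (\<Sum>k<N. (c k - c (Suc k)) * s k)" unfolding summation_by_parts c0 cN by simp
  also have "{..<N} = {..<n - p} \<union> {n - p..<n} \<union> {n..<N}" using p by auto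
  also have "(\<Sum>k\<in>{..<n - p} \<union> {n - p..<n} \<union> {n..<N}. (c k - c (Suc k)) * s k) =
      (\<Sum>k<n - p. (c k - c (Suc k)) * s k) + (\<Sum>k=n-p..<n. (c k - c (Suc k)) * s k) + (\<Sum>k=n..<N. (c k - c (Suc k)) * s k)"
    using p by (subst sum.union_disjoint; (subst sum.union_disjoint)?; auto)
  also have "(\<Sum>k<n - p. (c k - c (Suc k)) * s k) = 0"
    by (intro sum.neutral) (auto simp: c_def kcoef_def)
  also have "(\<Sum>k=n-p..<n. (c k - c (Suc k)) * s k) = - (\<Sum>k=n-p..<n. 1 / real p * s k)"
    unfolding sum_negf[symmetric]
  proof (intro sum.cong refl)
    fix k assume k: "k \<in> {n-p..<n}"
    \<comment> \<open>The linear formula also holds at the two ends, where \<open>kcoef\<close>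
      takes its values \<open>0\<close> and \<open>1\<close> from the neighbouring branches.\<close>
    have lin: "c j = (real j - real n + real p) / real p" if "n - p \<le> j" "j \<le> n" for j
    proof (cases "j = n")
      case True thus ?thesis using kcoef_n[OF p] p by (simp add: c_def)
    next
      case False thus ?thesis using that p by (cases "j = n - p") (auto simp: c_def kcoef_def of_nat_diff)
    qed
    have "c k - c (Suc k) = - (1 / real p)"
      using k p lin[of k] lin[of "Suc k"] by (simp add: field_simps)
    thus "(c k - c (Suc k)) * s k = - (1 / real p * s k)" by simp
  qed
  finally have eq: "dev_kernel \<psi> n p N \<theta> t =
     ((\<Sum>k=n..<N. (c k - c (Suc k)) * s k) - (\<Sum>k=n-p..<n. 1 / real p * s k)) / (2 * sin (t / 2))"
    using sp by (simp add: field_simps)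
  show ?thesis unfolding eq main_part_def avg_error_def c_def s_def
    by (simp add: diff_divide_distrib left_diff_distrib)
qed

lemma kcoef_difference:
  assumes "1 \<le> p" "p \<le> n" "n \<le> k"
  shows "kcoef \<psi> n p N k - kcoef \<psi> n p N (Suc k) =
    (\<psi> (real k) * (real N - real k) - \<psi> (real (Suc k)) * (real N - real (Suc k))) / (\<psi> (real n) * (real N - real n))"
  using assms kcoef_tail[of p n k N] kcoef_tail[of p n "Suc k" N]
  by (simp add: times_divide_times_eq diff_divide_distrib[symmetric])

lemma kcoef_difference_nonneg:
  assumes "1 \<le> p" "p \<le> n" "n \<le> k" "k < N"
  shows "0 \<le> kcoef \<psi> n p N k - kcoef \<psi> n p N (Suc k)"
proof -
  have "\<psi> (real (Suc k)) * (real N - real (Suc k)) \<le> \<psi> (real k) * (real N - real k)"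
    using assms pos[of "real (Suc k)"] pos[of "real k"] by (intro mult_mono decreasing) auto
  moreover have "\<psi> (real n) * (real N - real n) > 0" using pos[of "real n"] assms by simp
  ultimately show ?thesis unfolding kcoef_difference[OF assms(1-3)] by simp
qed

text \<open>A convex decreasing sequence times a nonnegative decreasing linear one is convex: with
  \<open>x = N - k\<close> the second difference is
  \<open>x * (u 0 - 2 * u 1 + u 2) + 2 * (u 1 - u 2)\<close>.\<close>

lemma kcoef_difference_antimono:
  assumes "1 \<le> p" "p \<le> n" "n \<le> k" "Suc k < N"
  shows "kcoef \<psi> n p N (Suc k) - kcoef \<psi> n p N (Suc (Suc k)) \<le> kcoef \<psi> n p N k - kcoef \<psi> n p N (Suc k)"
proof -
  define u where "u j = \<psi> (real (k + j))" for j
  define x where "x = real N - real k"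
  have x: "x \<ge> 0" using assms by (simp add: x_def)
  have c: "u 0 - 2 * u 1 + u 2 \<ge> 0"
    using three_slopes[of "real k" "real k + 1" "real k + 2"] assms by (simp add: u_def add.commute)
  have m: "u 1 - u 2 \<ge> 0" using decreasing[of "real k + 1" "real k + 2"] by (simp add: u_def add.commute)
  have "u 1 * (x - 1) - u 2 * (x - 2) \<le> u 0 * x - u 1 * (x - 1)"
    using mult_nonneg_nonneg[OF c x] m by (simp add: algebra_simps)
  hence "(\<psi> (real (Suc k)) * (real N - real (Suc k)) - \<psi> (real (Suc (Suc k))) * (real N - real (Suc (Suc k))))
     \<le> (\<psi> (real k) * (real N - real k) - \<psi> (real (Suc k)) * (real N - real (Suc k)))"
    by (simp add: u_def x_def algebra_simps)
  moreover have "\<psi> (real n) * (real N - real n) > 0" using pos[of "real n"] assms by simp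
  ultimately show ?thesis using assms by (simp add: kcoef_difference divide_right_mono)
qed

end

section \<open>Bounds for the weights above \<open>n\<close> in the class F\<close>

context class_F begin

text \<open>A bandwidth below the spacing \<open>1\<close> of the frequencies has no effect; this
  floor also merges the three cases of \<open>Apsi\<close> into one formula.\<close>

definition Tmax :: "nat \<Rightarrow> real" where "Tmax n = max 1 (Tfun \<psi> (real n))"

text \<open>\<open>K\<close> accounts for the drop of \<open>\<psi>\<close>, and \<open>1\<close>
  for the slope \<open>1 / (N - n)\<close> of the linear factor, which
  \<open>N - n \<ge> Tmax n\<close> keeps below the reciprocal bandwidth.\<close>

lemma first_weight_le:
  assumes "1 \<le> p" "p \<le> n" "2 \<le> n" "real n + Tmax n \<le> real N"
  shows "(kcoef \<psi> n p N n - kcoef \<psi> n p N (Suc n)) * Tmax n \<le> K + 1"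
proof -
  have T1: "Tmax n \<ge> 1" by (simp add: Tmax_def)
  have nN: "n < N" using assms T1 by linarith
  define q where "q = \<psi> (real n + 1) / \<psi> (real n)"
  have pn: "\<psi> (real n) > 0" "\<psi> (real n + 1) > 0" using pos assms by auto
  have q: "0 \<le> q" "q \<le> 1" using pn decreasing[of "real n" "real n + 1"] assms by (auto simp: q_def)
  have "kcoef \<psi> n p N (Suc n) = q * ((real N - real n - 1) / (real N - real n))"
    using assms by (subst kcoef_tail) (auto simp: q_def add.commute)
  also have "\<dots> = q - q / (real N - real n)" using nN by (simp add: field_simps)
  finally have "(kcoef \<psi> n p N n - kcoef \<psi> n p N (Suc n)) * Tmax n = (1 - q) * Tmax n + q * (Tmax n / (real N - real n))"
    using kcoef_n[OF assms(1,2) nN] by (simp only:) (simp add: algebra_simps)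
  moreover have "q * (Tmax n / (real N - real n)) \<le> 1 * 1"
    using q assms nN T1 by (intro mult_mono) auto
  moreover have "(1 - q) * Tmax n \<le> K"
  proof (cases "Tfun \<psi> (real n) \<le> 1")
    case True
    thus ?thesis using q K_ge_1 by (simp add: Tmax_def max_def)
  next
    case False
    have "(\<psi> (real n) - \<psi> (real n + 1)) * Tfun \<psi> (real n) \<le> K * \<psi> (real n)"
      using first_difference_le[of "real n"] assms by simp
    thus ?thesis using False pn by (simp add: Tmax_def max_def q_def field_simps)
  qed
  ultimately show ?thesis by simp
qed

text \<open>The logarithm is at most a constant over \<open>sqrt c\<^sub>k\<close>, and \<open>(c\<^sub>k - c\<^sub>k\<^sub>+\<^sub>1) / sqrt c\<^sub>k\<close> is dominated by
  the telescoping \<open>2 * (sqrt c\<^sub>k - sqrt c\<^sub>k\<^sub>+\<^sub>1)\<close>.\<close>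

lemma kcoef_log_sum_le:
  assumes "1 \<le> p" "p \<le> n" "2 \<le> n" "n < N"
  shows "(\<Sum>k=n..<N. (kcoef \<psi> n p N k - kcoef \<psi> n p N (Suc k)) * ln (1 + \<bar>real k + 1/2 - real n\<bar> / Tmax n)) \<le> 8 * ln (K + 3)"
proof -
  define c where "c = kcoef \<psi> n p N"
  have L: "ln (K + 3) \<ge> 0" using K_ge_1 by simp
  have pn: "\<psi> (real n) > 0" using pos assms by auto
  have cnn: "c k \<ge> 0" if "n \<le> k" "k \<le> N" for k
    unfolding c_def using that assms pos[of "real k"] pn by (subst kcoef_tail) auto
  have "(c k - c (Suc k)) * ln (1 + \<bar>real k + 1/2 - real n\<bar> / Tmax n) \<le> 8 * ln (K + 3) * (sqrt (c k) - sqrt (c (Suc k)))"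
    if k: "n \<le> k" "k < N" for k
  proof -
    have pk: "\<psi> (real k) > 0" using pos k assms by auto
    have ck_eq: "c k = \<psi> (real k) / \<psi> (real n) * ((real N - real k) / (real N - real n))"
      unfolding c_def using k assms by (subst kcoef_tail) auto
    have ck: "0 < c k" unfolding ck_eq using k pk pn by simp
    have ck': "c k \<le> \<psi> (real k) / \<psi> (real n)"
      unfolding ck_eq using k pk pn by (intro mult_left_le) auto
    have d: "0 \<le> c k - c (Suc k)" unfolding c_def using kcoef_difference_nonneg assms k by auto
    have cS: "0 \<le> c (Suc k)" using cnn k by simp
    have "ln (1 + \<bar>real k + 1/2 - real n\<bar> / Tmax n) = ln (1 + (real k + 1/2 - real n) / Tmax n)" using k by simp
    also have "\<dots> \<le> 4 * ln (K + 3) / sqrt (\<psi> (real k) / \<psi> (real n))"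
      using assms k by (intro ln_distance_le) (auto simp: Tmax_def)
    also have "\<dots> \<le> 4 * ln (K + 3) / sqrt (c k)"
      using L ck ck' by (intro divide_left_mono mult_pos_pos) auto
    finally have "(c k - c (Suc k)) * ln (1 + \<bar>real k + 1/2 - real n\<bar> / Tmax n) \<le> (c k - c (Suc k)) * (4 * ln (K + 3) / sqrt (c k))"
      using d by (rule mult_left_mono)
    also have "\<dots> = ((sqrt (c k) - sqrt (c (Suc k))) * (sqrt (c k) + sqrt (c (Suc k)))) * (4 * ln (K + 3) / sqrt (c k))"
      using ck cS by (simp add: algebra_simps)
    also have "\<dots> \<le> ((sqrt (c k) - sqrt (c (Suc k))) * (2 * sqrt (c k))) * (4 * ln (K + 3) / sqrt (c k))"
      using d L ck by (intro mult_right_mono mult_left_mono) auto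
    also have "\<dots> = 8 * ln (K + 3) * (sqrt (c k) - sqrt (c (Suc k)))" using ck by simp
    finally show ?thesis .
  qed
  hence "(\<Sum>k=n..<N. (c k - c (Suc k)) * ln (1 + \<bar>real k + 1/2 - real n\<bar> / Tmax n)) \<le>
      (\<Sum>k=n..<N. 8 * ln (K + 3) * (sqrt (c k) - sqrt (c (Suc k))))"
    by (intro sum_mono) auto
  also have "\<dots> = 8 * ln (K + 3) * (sqrt (c n) - sqrt (c N))"
    unfolding sum_distrib_left[symmetric] using sum_Suc_diff'[of n N "\<lambda>k. - sqrt (c k)"] assms by simp
  also have "\<dots> \<le> 8 * ln (K + 3) * 1"
    using L cnn[of N] kcoef_n[OF assms(1,2,4)] assms by (intro mult_left_mono) (auto simp: c_def)
  finally show ?thesis by (simp add: c_def)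
qed

text \<open>The frequencies above \<open>n\<close> contribute
  \<open>6 * (8 * ln (K + 3)) + 32 * (K + 1)\<close>, the uniform weights below \<open>n\<close>
  contribute \<open>6 + 32\<close>.\<close>

definition kernel_bound :: real where "kernel_bound = 48 * ln (K + 3) + 32 * (K + 2) + 6"

lemma kernel_minus_main_part:
  assumes p: "1 \<le> p" "p \<le> n" "2 \<le> n" "real n + Tmax n \<le> real N"
  shows "(LBINT t:{0..pi}. \<bar>dev_kernel \<psi> n p N \<theta> t - main_part n (Tmax n) (real p) \<theta> t\<bar>) \<le> kernel_bound"
proof -
  define R where "R = Tmax n"
  have R: "R \<ge> 1" by (simp add: Tmax_def R_def)
  have nN: "n < N" using p R unfolding R_def by linarith
  define c where "c = kcoef \<psi> n p N"
  define d where "d k = c k - c (Suc k)" for k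
  have sum1: "(\<Sum>k=n..<N. d k) = 1"
    using sum_Suc_diff'[of n N "\<lambda>k. - c k"] nN kcoef_n[OF p(1,2) nN] by (simp add: d_def c_def kcoef_def)
  have d: "0 \<le> d k" if "n \<le> k" "k < N" for k
    unfolding d_def c_def using kcoef_difference_nonneg p that by auto
  have da: "d (Suc k) \<le> d k" if "n \<le> k" "Suc k < N" for k
    unfolding d_def c_def using kcoef_difference_antimono p that by auto
  have E1: "set_integrable lborel {0..pi} (avg_error d n N n R \<theta>)"
    "(LBINT t:{0..pi}. \<bar>avg_error d n N n R \<theta> t\<bar>) \<le>
       6 * (\<Sum>k=n..<N. d k * ln (1 + \<bar>real k + 1/2 - real n\<bar> / R)) + 32 * d n * R"
    using avg_error_integral[of R n N d n \<theta>] R nN sum1 d da by blast+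
  have "n - p < n" "(\<Sum>k=n-p..<n. 1 / real p) = 1" using p by auto
  note E2 = avg_error_integral[of "real p" "n - p" n "\<lambda>k. 1 / real p" n \<theta>, OF _ this]
  have p1: "real p \<ge> 1" using p by simp
  let ?e1 = "avg_error d n N n R \<theta>" and ?e2 = "avg_error (\<lambda>k. 1 / real p) (n - p) n n (real p) \<theta>"
  have ie1: "set_integrable lborel {0..pi} ?e1" by (rule E1(1))
  have ie2: "set_integrable lborel {0..pi} ?e2" using p1 by (intro E2(1)) auto
  have "(LBINT t:{0..pi}. \<bar>dev_kernel \<psi> n p N \<theta> t - main_part n R (real p) \<theta> t\<bar>) \<le> (LBINT t:{0..pi}. \<bar>?e1 t\<bar> + \<bar>?e2 t\<bar>)"
  proof (rule set_integral_mono_AE)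
    show "set_integrable lborel {0..pi} (\<lambda>t. \<bar>dev_kernel \<psi> n p N \<theta> t - main_part n R (real p) \<theta> t\<bar>)"
      using R p1 by (intro set_integrable_abs set_integral_diff main_part_integrable
         set_integrable_continuous_real continuous_dev_kernel)
    show "set_integrable lborel {0..pi} (\<lambda>t. \<bar>?e1 t\<bar> + \<bar>?e2 t\<bar>)"
      by (intro set_integrable_abs set_integral_add ie1 ie2)
    have "AE t in lborel. t \<noteq> (0::real)" by (rule AE_lborel_singleton)
    thus "AE t\<in>{0..pi} in lborel. \<bar>dev_kernel \<psi> n p N \<theta> t - main_part n R (real p) \<theta> t\<bar> \<le> \<bar>?e1 t\<bar> + \<bar>?e2 t\<bar>"
    proof (rule AE_mp, intro AE_I2 impI)
      fix t :: real assume "t \<noteq> 0" "t \<in> {0..pi}"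
      hence "dev_kernel \<psi> n p N \<theta> t - main_part n R (real p) \<theta> t = ?e1 t - ?e2 t"
        unfolding d_def c_def by (subst dev_kernel_eq[OF p(1,2) nN, of _ _ R]) auto
      thus "\<bar>dev_kernel \<psi> n p N \<theta> t - main_part n R (real p) \<theta> t\<bar> \<le> \<bar>?e1 t\<bar> + \<bar>?e2 t\<bar>" by simp
    qed
  qed
  also have "\<dots> = (LBINT t:{0..pi}. \<bar>?e1 t\<bar>) + (LBINT t:{0..pi}. \<bar>?e2 t\<bar>)"
    by (intro set_integral_add set_integrable_abs ie1 ie2)
  also have "(LBINT t:{0..pi}. \<bar>?e1 t\<bar>) \<le> 6 * (8 * ln (K + 3)) + 32 * (K + 1)"
  proof (rule order.trans[OF E1(2)], unfold mult.assoc[of 32], intro add_mono mult_left_mono)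
    show "(\<Sum>k=n..<N. d k * ln (1 + \<bar>real k + 1/2 - real n\<bar> / R)) \<le> 8 * ln (K + 3)"
      using kcoef_log_sum_le[OF p(1-3) nN] by (simp add: d_def c_def R_def)
    show "d n * R \<le> K + 1" using first_weight_le[OF p] by (simp add: d_def c_def R_def)
  qed auto
  \<comment> \<open>All \<open>p\<close> frequencies lie within distance \<open>p\<close> of
    \<open>n\<close>, so every logarithm is at most \<open>1\<close>, and weight times bandwidth is
    exactly \<open>1\<close>.\<close>
  also have "(LBINT t:{0..pi}. \<bar>?e2 t\<bar>) \<le> 6 * 1 + 32 * (1 / real p) * real p"
  proof -
    have "(\<Sum>k=n-p..<n. 1 / real p * ln (1 + \<bar>real k + 1/2 - real n\<bar> / real p)) \<le> (\<Sum>k=n-p..<n. 1 / real p * 1)"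
    proof (intro sum_mono mult_left_mono)
      fix k assume k: "k \<in> {n-p..<n}"
      have "\<bar>real k + 1/2 - real n\<bar> \<le> real p" using k p by (auto simp: of_nat_diff abs_le_iff)
      hence "\<bar>real k + 1/2 - real n\<bar> / real p \<le> 1" using p by simp
      moreover have "ln (1 + \<bar>real k + 1/2 - real n\<bar> / real p) \<le> \<bar>real k + 1/2 - real n\<bar> / real p"
        using ln_add_one_self_le_self[of "\<bar>real k + 1/2 - real n\<bar> / real p"] by simp
      ultimately show "ln (1 + \<bar>real k + 1/2 - real n\<bar> / real p) \<le> 1" by linarith
    qed auto
    also have "\<dots> = 1" using p by simp
    finally show ?thesis using E2(2)[OF p1] by force
  qed
  finally show ?thesis using p1 by (simp add: kernel_bound_def R_def)
qed

end

section \<open>The main term\<close>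

lemma periodic_oscillation_le:
  fixes G g :: "real \<Rightarrow> real"
  assumes per: "\<And>x. G (x + L) = G x" and L: "L > 0"
    and G: "\<And>y. (G has_real_derivative g y) (at y)" and g: "\<And>y. \<bar>g y\<bar> \<le> 1"
  shows "\<bar>G x - G y\<bar> \<le> L"
proof -
  define m where "m = \<lfloor>(x - y) / L\<rfloor>"
  define z where "z = x - L * of_int m"
  have "of_int m \<le> (x - y) / L" "(x - y) / L < of_int m + 1" by (auto simp: m_def)
  hence z: "0 \<le> z - y" "z - y \<le> L" using L by (auto simp: z_def field_simps)
  have "G x = G z" using periodic_int[of G L z m] per by (simp add: z_def)
  moreover have "\<bar>G z - G y\<bar> \<le> 1 * \<bar>z - y\<bar>"
    using field_differentiable_bound[of UNIV G g 1 z y] G g by (auto simp: has_field_derivative_at_within)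
  ultimately show ?thesis using z by auto
qed

text \<open>Subtracting the mean \<open>2 / pi\<close> makes the primitive periodic with period
  \<open>pi\<close>; its oscillation is then bounded by that period.\<close>

lemma abs_sin_antiderivative:
  obtains G where "\<And>y. (G has_real_derivative \<bar>sin y\<bar> - 2 / pi) (at y)" "\<And>x y. \<bar>G x - G y\<bar> \<le> pi"
proof -
  have cont: "continuous_on UNIV (\<lambda>y::real. \<bar>sin y\<bar> - 2 / pi)" by (intro continuous_intros)
  then obtain G where G: "\<And>y. (G has_real_derivative \<bar>sin y\<bar> - 2 / pi) (at y)"
    using continuous_antiderivative by blast
  have "((\<lambda>x. G (x + pi) - G x) has_real_derivative 0) (at x)" for x
    by (auto intro!: derivative_eq_intros DERIV_chain'[OF _ G])
  hence "G (x + pi) - G x = G (0 + pi) - G 0" for x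
    using DERIV_isconst_all[of "\<lambda>x. G (x + pi) - G x" x 0] by blast
  moreover have "G (0 + pi) - G 0 = 0"
  proof -
    have "G pi - G 0 = (LBINT y:{0..pi}. \<bar>sin y\<bar> - 2 / pi)"
      using set_integral_FTC_real[OF _ G cont, of 0 pi] by simp
    also have "\<dots> = (LBINT y:{0..pi}. sin y - 2 / pi)"
      by (intro set_lebesgue_integral_cong) (auto simp: sin_ge_zero)
    also have "\<dots> = (- cos pi - 2 / pi * pi) - (- cos 0 - 2 / pi * 0)"
      by (intro set_integral_FTC_real continuous_intros) (auto intro!: derivative_eq_intros)
    finally show ?thesis by simp
  qed
  ultimately have per: "G (x + pi) = G x" for x by (metis diff_eq_diff_eq eq_iff_diff_eq_0)
  have "0 \<le> 2 / pi" "2 / pi \<le> 1" using pi_gt3 by auto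
  hence "\<bar>\<bar>sin y\<bar> - 2 / pi\<bar> \<le> 1" for y
    using abs_sin_le_one[of y] abs_ge_zero[of "sin y"] by linarith
  hence "\<bar>G x - G y\<bar> \<le> pi" for x y using periodic_oscillation_le[OF per pi_gt_zero G] by blast
  thus ?thesis using that G by blast
qed

text \<open>Integration by parts: the periodic primitive \<open>H\<close> is bounded, so
  \<open>H t / (w * t)\<close> and the leftover integral of \<open>H t / (w * t\<^sup>2)\<close> are
  both of order \<open>1 / (w * a)\<close>, whatever the phase.\<close>

lemma abs_sin_over_t_integral:
  assumes ab: "0 < a" "a \<le> b" and w: "w > 0"
  shows "\<bar>(LBINT t:{a..b}. \<bar>sin (w * t - \<theta>)\<bar> / t) - 2 / pi * ln (b / a)\<bar> \<le> 2 * pi / (w * a)"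
proof -
  obtain G where G: "\<And>y. (G has_real_derivative \<bar>sin y\<bar> - 2 / pi) (at y)" and Gb: "\<And>x y. \<bar>G x - G y\<bar> \<le> pi"
    using abs_sin_antiderivative by blast
  have contG: "isCont G y" for y using G DERIV_isCont by blast
  define H where "H t = G (w * t - \<theta>) - G 0" for t
  have H: "\<bar>H t\<bar> \<le> pi" for t unfolding H_def by (rule Gb)
  have dH: "(H has_real_derivative w * (\<bar>sin (w * t - \<theta>)\<bar> - 2 / pi)) (at t)" for t
    unfolding H_def by (auto intro!: derivative_eq_intros DERIV_chain'[OF _ G])
  have contH: "isCont H t" for t using dH DERIV_isCont by blast
  have contH': "continuous_on S H" for S using contH by (auto intro: continuous_at_imp_continuous_on)
  define q where "q t = \<bar>sin (w * t - \<theta>)\<bar> / t - H t / (w * t\<^sup>2)" for t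
  have 1: "(LBINT t:{a..b}. q t) = (H b / (w * b) + 2 / pi * ln b) - (H a / (w * a) + 2 / pi * ln a)"
  proof (rule set_integral_FTC_Icc)
    fix t :: real assume t: "a \<le> t" "t \<le> b"
    hence "t > 0" using ab by simp
    thus "((\<lambda>t. H t / (w * t) + 2 / pi * ln t) has_real_derivative q t) (at t)"
      using w unfolding q_def
      by (auto intro!: derivative_eq_intros dH simp: field_simps power2_eq_square)
    show "isCont q t" unfolding q_def using \<open>t > 0\<close> w
      by (intro continuous_intros contH) auto
  qed (rule ab)
  have int1: "set_integrable lborel {a..b} (\<lambda>t. \<bar>sin (w * t - \<theta>)\<bar> / t)"
    using ab by (intro borel_integrable_atLeastAtMost' continuous_intros) auto
  have int2: "set_integrable lborel {a..b} (\<lambda>t. H t / (w * t\<^sup>2))"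
    using ab w by (intro borel_integrable_atLeastAtMost' continuous_intros contH') auto
  have int3: "set_integrable lborel {a..b} (\<lambda>t. pi / (w * t\<^sup>2))"
    using ab w by (intro borel_integrable_atLeastAtMost' continuous_intros) auto
  have 2: "(LBINT t:{a..b}. q t) = (LBINT t:{a..b}. \<bar>sin (w * t - \<theta>)\<bar> / t) - (LBINT t:{a..b}. H t / (w * t\<^sup>2))"
    unfolding q_def by (intro set_integral_diff int1 int2)
  have "\<bar>LBINT t:{a..b}. H t / (w * t\<^sup>2)\<bar> \<le> (LBINT t:{a..b}. \<bar>H t / (w * t\<^sup>2)\<bar>)"
    using set_integral_norm_bound[OF int2] by simp
  also have "\<dots> \<le> (LBINT t:{a..b}. pi / (w * t\<^sup>2))"
    using w H by (intro set_integral_mono set_integrable_abs int2 int3) (auto simp: abs_mult intro!: divide_right_mono)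
  also have "\<dots> = - pi / (w * b) - (- pi / (w * a))"
  proof (rule set_integral_FTC_Icc)
    fix t :: real assume t: "a \<le> t" "t \<le> b"
    hence "t > 0" using ab by simp
    thus "((\<lambda>t. - pi / (w * t)) has_real_derivative pi / (w * t\<^sup>2)) (at t)"
      using w by (auto intro!: derivative_eq_intros simp: field_simps power2_eq_square)
    show "isCont (\<lambda>t. pi / (w * t\<^sup>2)) t" using \<open>t > 0\<close> w
      by (intro continuous_intros) auto
  qed (rule ab)
  finally have 3: "\<bar>LBINT t:{a..b}. H t / (w * t\<^sup>2)\<bar> \<le> pi / (w * a) - pi / (w * b)" by simp
  have 4: "\<bar>H b / (w * b)\<bar> \<le> pi / (w * b)" "\<bar>H a / (w * a)\<bar> \<le> pi / (w * a)"
    using ab w H by (auto simp: abs_mult intro!: divide_right_mono)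
  have "ln (b / a) = ln b - ln a" using ab by (simp add: ln_div)
  hence 5: "2 / pi * ln (b / a) = 2 / pi * ln b - 2 / pi * ln a" by (simp add: right_diff_distrib)
  \<comment> \<open>The boundary term at \<open>b\<close> costs \<open>B\<close>, exactly what the
    leftover integral saves.\<close>
  have arith: "\<bar>I - L\<bar> \<le> 2 * A" if "\<bar>hb\<bar> \<le> B" "\<bar>ha\<bar> \<le> A" "L = lb - la" "Q = hb + lb - (ha + la)" "Q = I - J" "\<bar>J\<bar> \<le> A - B"
    for I J L A B Q ha hb la lb :: real using that by linarith
  from arith[OF 4 5 1 2 3] show ?thesis by simp
qed

lemma inverse_sin_half:
  fixes t :: real
  assumes "0 < t" "t \<le> 1"
  shows "0 \<le> 1 / (2 * sin (t / 2)) - 1 / t" "1 / (2 * sin (t / 2)) - 1 / t \<le> 1"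
proof -
  have s: "t / 4 \<le> sin (t / 2)" using sin_half_ge[of t] assms pi_gt3 by simp
  have s1: "sin (t / 2) \<le> t / 2" using sin_x_le_x[of "t/2"] assms by simp
  have "\<bar>sin (t / 2) - (\<Sum>m<3. sin_coeff m * (t / 2) ^ m)\<bar> \<le> inverse (fact 3) * \<bar>t / 2\<bar> ^ 3"
    by (rule Maclaurin_sin_bound)
  hence "\<bar>sin (t / 2) - t / 2\<bar> \<le> t ^ 3 / 48"
    using assms by (simp add: eval_nat_numeral sin_coeff_def)
  hence s2: "t - 2 * sin (t / 2) \<le> t ^ 3 / 24" by linarith
  have eq: "1 / (2 * sin (t / 2)) - 1 / t = (t - 2 * sin (t / 2)) / (2 * sin (t / 2) * t)"
    using s assms by (simp add: field_simps)
  show "0 \<le> 1 / (2 * sin (t / 2)) - 1 / t" unfolding eq using s s1 assms by simp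
  have "(t - 2 * sin (t / 2)) / (2 * sin (t / 2) * t) \<le> (t ^ 3 / 24) / (2 * (t / 4) * t)"
    using s s1 s2 assms by (intro frac_le mult_right_mono mult_left_mono) auto
  also have "\<dots> = t / 12" using assms by (simp add: power3_eq_cube field_simps)
  finally show "1 / (2 * sin (t / 2)) - 1 / t \<le> 1" unfolding eq using assms by linarith
qed

lemma abs_sin_over_sin_integral:
  assumes ab: "0 < a" "a \<le> b" "b \<le> 1" and w: "w > 0"
  shows "\<bar>(LBINT t:{a..b}. \<bar>sin (w * t - \<theta>)\<bar> / (2 * sin (t / 2))) - 2 / pi * ln (b / a)\<bar> \<le> 1 + 2 * pi / (w * a)"
proof -
  have sp: "sin (t / 2) > 0" if "a \<le> t" "t \<le> b" for t
    using sin_half_ge[of t] that ab pi_gt3 by auto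
  let ?f = "\<lambda>t. \<bar>sin (w * t - \<theta>)\<bar> / (2 * sin (t / 2))" and ?g = "\<lambda>t. \<bar>sin (w * t - \<theta>)\<bar> / t"
  have int1: "set_integrable lborel {a..b} ?f"
    using sp by (intro borel_integrable_atLeastAtMost' continuous_intros) (auto simp: less_imp_neq[symmetric])
  have int2: "set_integrable lborel {a..b} ?g"
    using ab by (intro borel_integrable_atLeastAtMost' continuous_intros) auto
  define v where "v t = \<bar>sin (w * t - \<theta>)\<bar> * (1 / (2 * sin (t / 2)) - 1 / t)" for t
  have v_eq: "v = (\<lambda>t. ?f t - ?g t)" by (simp add: v_def right_diff_distrib fun_eq_iff)
  have int3: "set_integrable lborel {a..b} v" unfolding v_eq by (rule set_integral_diff(1)[OF int1 int2])
  have 1: "(LBINT t:{a..b}. v t) = (LBINT t:{a..b}. ?f t) - (LBINT t:{a..b}. ?g t)"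
    unfolding v_eq by (rule set_integral_diff(2)[OF int1 int2])
  have "\<bar>LBINT t:{a..b}. v t\<bar> \<le> (LBINT t:{a..b}. \<bar>v t\<bar>)"
    using set_integral_norm_bound[OF int3] by simp
  also have "\<dots> \<le> (LBINT t:{a..b}. 1)"
  proof (rule set_integral_mono)
    show "set_integrable lborel {a..b} (\<lambda>t. \<bar>v t\<bar>)" using int3 by (rule set_integrable_abs)
    show "set_integrable lborel {a..b} (\<lambda>t. 1 :: real)" by (intro set_integrable_continuous_real continuous_intros)
    fix t assume t: "t \<in> {a..b}"
    have "\<bar>\<bar>sin (w * t - \<theta>)\<bar> * (1 / (2 * sin (t / 2)) - 1 / t)\<bar> \<le> 1 * 1"
      unfolding abs_mult using inverse_sin_half[of t] t ab by (intro mult_mono) auto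
    thus "\<bar>v t\<bar> \<le> 1" by (simp add: v_def)
  qed
  also have "(LBINT t:{a..b}. 1 :: real) = b - a"
    using ab by (intro set_integral_FTC_real) (auto intro!: derivative_eq_intros)
  finally have 2: "\<bar>LBINT t:{a..b}. v t\<bar> \<le> 1" using ab by linarith
  have arith: "\<bar>F - L\<bar> \<le> 1 + Z" if "V = F - G" "\<bar>V\<bar> \<le> 1" "\<bar>G - L\<bar> \<le> Z" for V F G L Z :: real
    using that by linarith
  from arith[OF 1 2 abs_sin_over_t_integral[OF ab(1,2) w]] show ?thesis .
qed

section \<open>A test function for the lower bound\<close>

text \<open>A continuous substitute for the sign function, so that \<open>soft_sgn e (sin y)\<close> has a classical
  antiderivative.\<close>

definition soft_sgn :: "real \<Rightarrow> real \<Rightarrow> real" where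
  "soft_sgn e s = s / sqrt (s\<^sup>2 + e\<^sup>2)"

lemma soft_sgn_props:
  assumes e: "e > 0"
  shows "\<bar>soft_sgn e s\<bar> \<le> 1" "soft_sgn e (- s) = - soft_sgn e s" "s * soft_sgn e s \<ge> \<bar>s\<bar> - e"
    "continuous_on UNIV (soft_sgn e)"
proof -
  have pos: "s\<^sup>2 + e\<^sup>2 > 0" for s using e by (intro add_nonneg_pos) auto
  have "\<bar>s\<bar> \<le> sqrt (s\<^sup>2 + e\<^sup>2)" by (intro real_le_rsqrt) simp
  thus "\<bar>soft_sgn e s\<bar> \<le> 1" using pos[of s] by (simp add: soft_sgn_def)
  show "soft_sgn e (- s) = - soft_sgn e s" by (simp add: soft_sgn_def)
  have sq: "sqrt (s\<^sup>2 + e\<^sup>2) \<le> \<bar>s\<bar> + e" using e by (intro real_le_lsqrt) (auto simp: power2_sum)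
  have "(\<bar>s\<bar> - e) * sqrt (s\<^sup>2 + e\<^sup>2) \<le> s\<^sup>2"
  proof (cases "\<bar>s\<bar> \<le> e")
    case True
    hence "(\<bar>s\<bar> - e) * sqrt (s\<^sup>2 + e\<^sup>2) \<le> 0" by (intro mult_nonpos_nonneg) auto
    thus ?thesis using zero_le_power2[of s] by linarith
  next
    case False
    hence "(\<bar>s\<bar> - e) * sqrt (s\<^sup>2 + e\<^sup>2) \<le> (\<bar>s\<bar> - e) * (\<bar>s\<bar> + e)" using sq by (intro mult_left_mono) auto
    also have "\<dots> = s\<^sup>2 - e\<^sup>2" by (simp add: algebra_simps power2_eq_square)
    finally show ?thesis using zero_le_power2[of e] by linarith
  qed
  hence "\<bar>s\<bar> - e \<le> s\<^sup>2 / sqrt (s\<^sup>2 + e\<^sup>2)" using pos[of s] by (simp add: le_divide_eq)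
  thus "s * soft_sgn e s \<ge> \<bar>s\<bar> - e" by (simp add: soft_sgn_def power2_eq_square)
  show "continuous_on UNIV (soft_sgn e)"
    unfolding soft_sgn_def using pos by (intro continuous_intros) (auto simp: less_imp_neq[symmetric])
qed

lemma soft_sgn_sin_integral_le:
  assumes e: "e > 0" and w: "w > 0" and ab: "a \<le> b"
  shows "\<bar>LBINT t:{a..b}. soft_sgn e (sin (w * t - \<theta>))\<bar> \<le> 2 * pi / w"
proof -
  let ?g = "\<lambda>y. soft_sgn e (sin y)"
  note cont = soft_sgn_props(4)[OF e]
  have cg: "continuous_on UNIV ?g" by (intro continuous_on_compose2[OF cont] continuous_intros) auto
  then obtain G where G: "\<And>y. (G has_real_derivative ?g y) (at y)"
    using continuous_antiderivative by blast
  \<comment> \<open>The integrand changes sign under a shift by \<open>pi\<close>, because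
    \<open>soft_sgn\<close> is odd. Applying the resulting constancy twice makes the primitive
    periodic with period \<open>2 * pi\<close>.\<close>
  have "((\<lambda>x. G (x + pi) + G x) has_real_derivative 0) (at x)" for x
    using soft_sgn_props(2)[OF e, of "sin x"]
    by (auto intro!: derivative_eq_intros DERIV_chain'[OF _ G])
  hence c: "G (x + pi) + G x = G (0 + pi) + G 0" for x
    using DERIV_isconst_all[of "\<lambda>x. G (x + pi) + G x" x 0] by blast
  have per: "G (x + 2 * pi) = G x" for x using c[of x] c[of "x + pi"] by (simp add: add.assoc)
  have osc: "\<bar>G x - G y\<bar> \<le> 2 * pi" for x y
    using periodic_oscillation_le[OF per _ G] soft_sgn_props(1)[OF e] by auto
  have "(LBINT t:{a..b}. soft_sgn e (sin (w * t - \<theta>))) = G (w * b - \<theta>) / w - G (w * a - \<theta>) / w"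
    using w ab by (intro set_integral_FTC_real)
      (auto intro!: derivative_eq_intros DERIV_chain'[OF _ G] continuous_on_compose2[OF cont] continuous_intros)
  also have "\<bar>\<dots>\<bar> = \<bar>G (w * b - \<theta>) - G (w * a - \<theta>)\<bar> / w" using w by (simp add: diff_divide_distrib[symmetric])
  also have "\<dots> \<le> 2 * pi / w" using osc w by (intro divide_right_mono) auto
  finally show ?thesis .
qed

text \<open>A softened sign of \<open>main_part\<close>: the factors are the signs of the window
  difference, of \<open>sin (t / 2)\<close>, and of the oscillation. The softening
  \<open>cut_lo\<close> is the largest scale, up to a constant, at which the pointwise loss stays
  bounded on the support.\<close>

definition test_fun :: "nat \<Rightarrow> real \<Rightarrow> real \<Rightarrow> real \<Rightarrow> real \<Rightarrow> real" where
  "test_fun n R S \<theta> t = (if R \<le> S then 1 else -1) * (if 0 \<le> t then 1 else -1) *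
     (if cut_lo R S < \<bar>t\<bar> \<and> \<bar>t\<bar> \<le> cut_hi R S then soft_sgn (cut_lo R S) (sin (real n * t - \<theta>)) else 0)"

lemma borel_measurable_soft_sgn: "e > 0 \<Longrightarrow> soft_sgn e \<in> borel_measurable borel"
  by (intro borel_measurable_continuous_onI soft_sgn_props)

lemma test_fun_props:
  assumes "R \<ge> 1" "S \<ge> 1"
  shows "test_fun n R S \<theta> \<in> borel_measurable borel" "\<bar>test_fun n R S \<theta> t\<bar> \<le> 1"
    "test_fun n R S \<theta> (- t) = test_fun n R S (- \<theta>) t"
proof -
  note lo = cut_lo_hi(1)[OF assms]
  note [measurable] = borel_measurable_soft_sgn[OF lo]
  show "test_fun n R S \<theta> \<in> borel_measurable borel" unfolding test_fun_def by measurable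
  show "\<bar>test_fun n R S \<theta> t\<bar> \<le> 1"
    using soft_sgn_props(1)[OF lo] by (auto simp: test_fun_def abs_mult)
  show "test_fun n R S \<theta> (- t) = test_fun n R S (- \<theta>) t"
  proof (cases "t = 0")
    case True thus ?thesis using lo by (simp add: test_fun_def)
  next
    case False
    have "real n * (- t) - \<theta> = - (real n * t - (- \<theta>))" by simp
    hence "sin (real n * (- t) - \<theta>) = - sin (real n * t - (- \<theta>))" by (simp only: sin_minus)
    thus ?thesis using False soft_sgn_props(2)[OF lo, of "sin (real n * t - (- \<theta>))"]
      by (auto simp: test_fun_def)
  qed
qed

lemma set_integral_restrict:
  fixes u :: "real \<Rightarrow> real"
  assumes "u \<in> borel_measurable borel" "0 \<le> a" "b \<le> c"
  shows "(LBINT t:{0..c}. (if a < t \<and> t \<le> b then u t else 0)) = (LBINT t:{a..b}. u t)"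
proof -
  have [measurable]: "u \<in> borel_measurable borel" by fact
  have "AE t in lborel. t \<noteq> a" by (rule AE_lborel_singleton)
  hence "AE t in lborel. indicator {0..c} t *\<^sub>R (if a < t \<and> t \<le> b then u t else 0) = indicator {a..b} t *\<^sub>R u t"
    by (rule AE_mp, intro AE_I2 impI) (use assms in \<open>auto simp: indicator_def\<close>)
  thus ?thesis unfolding set_lebesgue_integral_def by (intro integral_cong_AE) measurable
qed

lemma main_part_norm:
  assumes RS: "R \<ge> 1" "S \<ge> 1" and n: "n > 0"
  shows "\<bar>(LBINT t:{0..pi}. \<bar>main_part n R S \<theta> t\<bar>) - 2 / pi * ln (cut_hi R S / cut_lo R S)\<bar> \<le> 1 + 2 * pi / (real n * cut_lo R S)"
proof -
  note l = cut_lo_hi[OF RS]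
  have s: "sin (t / 2) \<ge> 0" if "0 \<le> t" "t \<le> pi" for t using sin_half_ge[of t] that by simp
  have "(LBINT t:{0..pi}. \<bar>main_part n R S \<theta> t\<bar>) =
     (LBINT t:{0..pi}. (if cut_lo R S < t \<and> t \<le> cut_hi R S then \<bar>sin (real n * t - \<theta>)\<bar> / (2 * sin (t / 2)) else 0))"
    using s by (intro set_lebesgue_integral_cong) (auto simp: main_part_half[OF RS])
  also have "\<dots> = (LBINT t:{cut_lo R S..cut_hi R S}. \<bar>sin (real n * t - \<theta>)\<bar> / (2 * sin (t / 2)))"
    using l pi_gt3 by (intro set_integral_restrict) auto
  finally show ?thesis using abs_sin_over_sin_integral[OF l, of "real n" \<theta>] n by simp
qed

lemma set_integrable_mult_bounded:
  fixes h g :: "real \<Rightarrow> real"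
  assumes g: "set_integrable lborel {a..b} g" and "g \<in> borel_measurable borel"
    and "h \<in> borel_measurable borel" "\<And>t. \<bar>h t\<bar> \<le> 1"
  shows "set_integrable lborel {a..b} (\<lambda>t. h t * g t)"
proof (rule set_integrable_bound[OF g])
  have [measurable]: "h \<in> borel_measurable borel" "g \<in> borel_measurable borel" by fact+
  show "set_borel_measurable lborel {a..b} (\<lambda>t. h t * g t)"
    unfolding set_borel_measurable_def by measurable
  have "\<bar>h t\<bar> * \<bar>g t\<bar> \<le> 1 * \<bar>g t\<bar>" for t using assms(4) by (intro mult_right_mono) auto
  thus "AE t in lborel. t \<in> {a..b} \<longrightarrow> norm (h t * g t) \<le> norm (g t)" by (simp add: abs_mult)
qed

lemma test_fun_main_part:
  assumes RS: "R \<ge> 1" "S \<ge> 1"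
  shows "(LBINT t:{0..pi}. test_fun n R S \<theta> t * main_part n R S \<theta> t) \<ge> (LBINT t:{0..pi}. \<bar>main_part n R S \<theta> t\<bar>) - 2 * pi"
proof -
  note l = cut_lo_hi[OF RS]
  have ic: "set_integrable lborel {0..pi} (\<lambda>t. 2 :: real)" by (intro set_integrable_continuous_real continuous_intros)
  have im: "set_integrable lborel {0..pi} (\<lambda>t. \<bar>main_part n R S \<theta> t\<bar>)"
    by (intro set_integrable_abs main_part_integrable RS)
  have "(LBINT t:{0..pi}. 2 :: real) = 2 * pi - 2 * 0"
    by (intro set_integral_FTC_real) (auto intro!: derivative_eq_intros)
  hence "(LBINT t:{0..pi}. \<bar>main_part n R S \<theta> t\<bar>) - 2 * pi = (LBINT t:{0..pi}. \<bar>main_part n R S \<theta> t\<bar> - 2)"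
    using set_integral_diff(2)[OF im ic] by simp
  also have "\<dots> \<le> (LBINT t:{0..pi}. test_fun n R S \<theta> t * main_part n R S \<theta> t)"
  proof (rule set_integral_mono)
    show "set_integrable lborel {0..pi} (\<lambda>t. \<bar>main_part n R S \<theta> t\<bar> - 2)" by (rule set_integral_diff(1)[OF im ic])
    show "set_integrable lborel {0..pi} (\<lambda>t. test_fun n R S \<theta> t * main_part n R S \<theta> t)"
      by (intro set_integrable_mult_bounded main_part_integrable test_fun_props RS borel_measurable_main_part)
    fix t assume t: "t \<in> {0..pi}"
    show "\<bar>main_part n R S \<theta> t\<bar> - 2 \<le> test_fun n R S \<theta> t * main_part n R S \<theta> t"
    proof (cases "cut_lo R S < t \<and> t \<le> cut_hi R S")
      case False
      thus ?thesis using t by (auto simp: main_part_half[OF RS])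
    next
      case True
      define x where "x = sin (real n * t - \<theta>)"
      have s: "sin (t / 2) \<ge> t / 4" using sin_half_ge t by auto
      hence s0: "sin (t / 2) > 0" using True l by simp
      \<comment> \<open>The loss \<open>e / (2 * sin (t / 2))\<close> of the softened sign is at
        most \<open>2\<close> here because \<open>t\<close> exceeds
        \<open>e = cut_lo\<close>.\<close>
      have "cut_lo R S / (2 * sin (t / 2)) \<le> cut_lo R S / (2 * (cut_lo R S / 4))"
        using s True l by (intro frac_le) auto
      hence "cut_lo R S / (2 * sin (t / 2)) \<le> 2" using l by simp
      moreover have "(\<bar>x\<bar> - cut_lo R S) / (2 * sin (t / 2)) \<le> (x * soft_sgn (cut_lo R S) x) / (2 * sin (t / 2))"
        using s0 soft_sgn_props(3)[OF l(1), of x] by (intro divide_right_mono) auto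
      moreover have "\<bar>main_part n R S \<theta> t\<bar> = \<bar>x\<bar> / (2 * sin (t / 2))"
        using True t s0 by (simp add: main_part_half[OF RS] x_def)
      moreover have "test_fun n R S \<theta> t * main_part n R S \<theta> t = (x * soft_sgn (cut_lo R S) x) / (2 * sin (t / 2))"
        using True t by (simp add: main_part_half[OF RS] test_fun_def x_def)
      ultimately show ?thesis by (simp add: diff_divide_distrib)
    qed
  qed
  finally show ?thesis .
qed

text \<open>Needed for the correction that gives the test function mean zero: the loss it causes is
  of relative order \<open>1 / n\<close>.\<close>

lemma test_fun_mean:
  assumes RS: "R \<ge> 1" "S \<ge> 1" and n: "n > 0"
  shows "\<bar>LBINT t:{0..pi}. test_fun n R S \<theta> t\<bar> \<le> 2 * pi / real n"
proof -
  note l = cut_lo_hi[OF RS]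
  note [measurable] = borel_measurable_soft_sgn[OF l(1)]
  have "(LBINT t:{0..pi}. test_fun n R S \<theta> t) = (LBINT t:{0..pi}. (if R \<le> S then 1 else -1) *
      (if cut_lo R S < t \<and> t \<le> cut_hi R S then soft_sgn (cut_lo R S) (sin (real n * t - \<theta>)) else 0))"
    by (intro set_lebesgue_integral_cong) (auto simp: test_fun_def)
  also have "\<dots> = (if R \<le> S then 1 else -1) * (LBINT t:{cut_lo R S..cut_hi R S}. soft_sgn (cut_lo R S) (sin (real n * t - \<theta>)))"
    unfolding set_integral_mult_right using l pi_gt3 by (subst set_integral_restrict) auto
  also have "\<bar>\<dots>\<bar> = \<bar>LBINT t:{cut_lo R S..cut_hi R S}. soft_sgn (cut_lo R S) (sin (real n * t - \<theta>))\<bar>" by (simp add: abs_mult)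
  also have "\<dots> \<le> 2 * pi / real n" using l n by (intro soft_sgn_sin_integral_le) auto
  finally show ?thesis .
qed

lemma LBINT_symmetric_split:
  fixes F :: "real \<Rightarrow> real"
  assumes F: "set_integrable lborel {-c..c} F" "F \<in> borel_measurable borel" and c: "c \<ge> 0"
  shows "(LBINT t:{-c..c}. F t) = (LBINT t:{0..c}. F t) + (LBINT t:{0..c}. F (- t))"
proof -
  have [measurable]: "F \<in> borel_measurable borel" by fact
  have "{-c..c} = {-c..<0} \<union> {0..c}" using c by auto
  hence "(LBINT t:{-c..c}. F t) = (LBINT t:{-c..<0} \<union> {0..c}. F t)" by simp
  also have "\<dots> = (LBINT t:{-c..<0}. F t) + (LBINT t:{0..c}. F t)"
    using c by (intro set_integral_Un set_integrable_subset[OF F(1)]) auto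
  also have "(LBINT t:{-c..<0}. F t) = (LBINT t:{-c..0}. F t)"
  proof -
    have "AE t in lborel. t \<noteq> (0::real)" by (rule AE_lborel_singleton)
    hence "AE t in lborel. indicator {-c..<0} t *\<^sub>R F t = indicator {-c..0} t *\<^sub>R F t"
      by (rule AE_mp, intro AE_I2 impI) (auto simp: indicator_def)
    thus ?thesis unfolding set_lebesgue_integral_def by (intro integral_cong_AE) measurable
  qed
  also have "\<dots> = (LBINT t:{t. - t \<in> {-c..0}}. F (- t))" by (rule set_integral_reflect)
  also have "{t. - t \<in> {-c..0}} = {0..c}" by auto
  finally show ?thesis by simp
qed

section \<open>Assembly of the upper and lower bounds\<close>

context class_F begin

definition lin_const :: real where "lin_const = K + eta \<psi> 2"

lemma lin_const_ge_1: "lin_const \<ge> 1"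
  using K_ge_1 eta_props(1)[of 2] by (simp add: lin_const_def)

text \<open>Here \<open>T n = O(n)\<close> is used: \<open>1 / cut_lo\<close> is the larger
  bandwidth, so the error \<open>2 * pi / (n * cut_lo)\<close> in the norm of the main part stays
  bounded.\<close>

lemma inverse_cut_lo_le:
  assumes "1 \<le> p" "p \<le> n" "2 \<le> n"
  shows "1 / cut_lo (Tmax n) (real p) \<le> lin_const * real n"
proof -
  have "1 * real n \<le> lin_const * real n" using lin_const_ge_1 by (intro mult_right_mono) auto
  hence "real n \<le> lin_const * real n" by (simp only: mult_1)
  hence "1 \<le> lin_const * real n" "real p \<le> lin_const * real n"
    using assms by linarith+
  moreover have "Tfun \<psi> (real n) \<le> lin_const * real n" using Tfun_le_linear[of "real n"] assms by (simp add: lin_const_def)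
  ultimately have "max (Tmax n) (real p) \<le> lin_const * real n" by (auto simp: Tmax_def)
  moreover have "Tmax n \<ge> 1" by (simp add: Tmax_def)
  hence "1 / cut_lo (Tmax n) (real p) = max (Tmax n) (real p)"
    using assms by (auto simp: cut_lo_def min_def max_def divide_le_cancel field_simps)
  ultimately show ?thesis by simp
qed

lemma Apsi_eq:
  assumes "1 \<le> p"
  shows "Apsi \<psi> n p = ln (cut_hi (Tmax n) (real p) / cut_lo (Tmax n) (real p))"
proof -
  define T where "T = Tfun \<psi> (real n)"
  have p: "real p \<ge> 1" using assms by simp
  consider "T \<le> 1" | "1 < T" "T \<le> real p" | "1 < T" "real p < T" by linarith
  thus ?thesis
  proof cases
    case 1
    have "1 / real p \<le> 1" using p by simp
    thus ?thesis using 1 p by (simp add: Apsi_def Let_def T_def[symmetric] Tmax_def cut_hi_def cut_lo_def min_def max_def)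
  next
    case 2
    have "1 / real p \<le> 1 / T" using 2 p by (simp add: frac_le)
    thus ?thesis using 2 p by (simp add: Apsi_def Let_def T_def[symmetric] Tmax_def cut_hi_def cut_lo_def min_def max_def)
  next
    case 3
    have "1 / T < 1 / real p" using 3 p by (simp add: frac_less2)
    thus ?thesis using 3 p by (simp add: Apsi_def Let_def T_def[symmetric] Tmax_def cut_hi_def cut_lo_def min_def max_def)
  qed
qed

text \<open>A crude linear bound for a logarithm; it is only ever multiplied by a loss of order
  \<open>1 / n\<close>.\<close>

lemma Apsi_le:
  assumes "1 \<le> p" "p \<le> n" "2 \<le> n" shows "Apsi \<psi> n p \<le> lin_const * real n"
proof -
  have RS: "Tmax n \<ge> 1" "real p \<ge> 1" using assms by (auto simp: Tmax_def)
  note l = cut_lo_hi[OF RS]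
  have "Apsi \<psi> n p \<le> cut_hi (Tmax n) (real p) / cut_lo (Tmax n) (real p)"
    unfolding Apsi_eq[OF assms(1)] using l by (intro order.strict_implies_order ln_less_self) auto
  also have "\<dots> \<le> 1 / cut_lo (Tmax n) (real p)" using l by (intro divide_right_mono) auto
  also have "\<dots> \<le> lin_const * real n" by (rule inverse_cut_lo_le[OF assms])
  finally show ?thesis .
qed

text \<open>Error over \<open>[0, pi]\<close>: \<open>1 + 2 * pi * lin_const\<close> from the norm
  of the main part, \<open>2 * pi\<close> from the softened sign, the rest from the kernel
  approximation.\<close>

definition half_const :: real where "half_const = 1 + 2 * pi * lin_const + 2 * pi + kernel_bound"

lemma half_estimates:
  assumes p: "1 \<le> p" "p \<le> n" "2 \<le> n" "real n + Tmax n \<le> real N"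
  shows "(LBINT t:{0..pi}. \<bar>dev_kernel \<psi> n p N \<theta> t\<bar>) \<le> 2 / pi * Apsi \<psi> n p + half_const"
    "(LBINT t:{0..pi}. test_fun n (Tmax n) (real p) \<theta> t * dev_kernel \<psi> n p N \<theta> t) \<ge> 2 / pi * Apsi \<psi> n p - half_const"
proof -
  define R where "R = Tmax n"
  have RS: "R \<ge> 1" "real p \<ge> 1" using p by (auto simp: Tmax_def R_def)
  let ?M = "main_part n R (real p) \<theta>" and ?D = "dev_kernel \<psi> n p N \<theta>" and ?h = "test_fun n R (real p) \<theta>"
  have iM: "set_integrable lborel {0..pi} ?M" by (intro main_part_integrable RS)
  have iD: "set_integrable lborel {0..pi} ?D" by (intro set_integrable_continuous_real continuous_dev_kernel)
  have iDM: "set_integrable lborel {0..pi} (\<lambda>t. ?D t - ?M t)" by (rule set_integral_diff(1)[OF iD iM])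
  have mD: "?D \<in> borel_measurable borel" by (intro borel_measurable_continuous_onI continuous_dev_kernel)
  note mM = borel_measurable_main_part
  have ihM: "set_integrable lborel {0..pi} (\<lambda>t. ?h t * ?M t)"
    by (intro set_integrable_mult_bounded iM mM test_fun_props RS)
  have ihD: "set_integrable lborel {0..pi} (\<lambda>t. ?h t * ?D t)"
    by (intro set_integrable_mult_bounded iD mD test_fun_props RS)
  have DM: "(LBINT t:{0..pi}. \<bar>?D t - ?M t\<bar>) \<le> kernel_bound"
    unfolding R_def by (rule kernel_minus_main_part[OF p])
  have "1 / cut_lo R (real p) / real n \<le> lin_const" using inverse_cut_lo_le[OF p(1-3)] p by (subst pos_divide_le_eq) (auto simp: R_def)
  hence "2 * pi * (1 / cut_lo R (real p) / real n) \<le> 2 * pi * lin_const" by (intro mult_left_mono) auto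
  hence lo: "2 * pi / (real n * cut_lo R (real p)) \<le> 2 * pi * lin_const" by (simp add: mult.commute)
  have M: "\<bar>(LBINT t:{0..pi}. \<bar>?M t\<bar>) - 2 / pi * Apsi \<psi> n p\<bar> \<le> 1 + 2 * pi / (real n * cut_lo R (real p))"
    using main_part_norm[OF RS, of n \<theta>] p by (simp add: Apsi_eq R_def)
  have M1: "(LBINT t:{0..pi}. \<bar>?M t\<bar>) \<le> 2 / pi * Apsi \<psi> n p + (1 + 2 * pi * lin_const)"
    and M2: "2 / pi * Apsi \<psi> n p - (1 + 2 * pi * lin_const) \<le> (LBINT t:{0..pi}. \<bar>?M t\<bar>)"
    using M lo unfolding abs_le_iff by auto
  have "(LBINT t:{0..pi}. \<bar>?D t\<bar>) \<le> (LBINT t:{0..pi}. \<bar>?M t\<bar> + \<bar>?D t - ?M t\<bar>)"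
    by (intro set_integral_mono set_integrable_abs set_integral_add(1) iD iM iDM) auto
  also have "\<dots> = (LBINT t:{0..pi}. \<bar>?M t\<bar>) + (LBINT t:{0..pi}. \<bar>?D t - ?M t\<bar>)"
    by (intro set_integral_add(2) set_integrable_abs iM iDM)
  also have "\<dots> \<le> (2 / pi * Apsi \<psi> n p + (1 + 2 * pi * lin_const)) + kernel_bound"
    by (rule add_mono[OF M1 DM])
  also have "\<dots> \<le> 2 / pi * Apsi \<psi> n p + half_const"
    using pi_gt_zero unfolding half_const_def by linarith
  finally show "(LBINT t:{0..pi}. \<bar>?D t\<bar>) \<le> 2 / pi * Apsi \<psi> n p + half_const" .
  have "(LBINT t:{0..pi}. ?h t * ?M t) - (LBINT t:{0..pi}. \<bar>?D t - ?M t\<bar>) = (LBINT t:{0..pi}. ?h t * ?M t - \<bar>?D t - ?M t\<bar>)"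
    by (intro set_integral_diff(2)[symmetric] ihM set_integrable_abs iDM)
  also have "\<dots> \<le> (LBINT t:{0..pi}. ?h t * ?D t)"
  proof (intro set_integral_mono set_integral_diff(1) ihM ihD set_integrable_abs iD iM)
    fix t
    have "\<bar>?h t * (?M t - ?D t)\<bar> \<le> 1 * \<bar>?D t - ?M t\<bar>"
      unfolding abs_mult abs_minus_commute[of "?M t"] by (intro mult_right_mono test_fun_props RS) auto
    thus "?h t * ?M t - \<bar>?D t - ?M t\<bar> \<le> ?h t * ?D t" by (simp add: right_diff_distrib abs_le_iff)
  qed
  finally have "(LBINT t:{0..pi}. ?h t * ?M t) - kernel_bound \<le> (LBINT t:{0..pi}. ?h t * ?D t)" using DM by linarith
  moreover have "(LBINT t:{0..pi}. \<bar>?M t\<bar>) - 2 * pi \<le> (LBINT t:{0..pi}. ?h t * ?M t)"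
    by (rule test_fun_main_part[OF RS])
  ultimately have "2 / pi * Apsi \<psi> n p - half_const \<le> (LBINT t:{0..pi}. ?h t * ?D t)"
    using M2 unfolding half_const_def by linarith
  thus "2 / pi * Apsi \<psi> n p - half_const \<le> (LBINT t:{0..pi}. test_fun n (Tmax n) (real p) \<theta> t * ?D t)"
    by (simp add: R_def)
qed

lemma Err_upper:
  assumes p: "1 \<le> p" "p \<le> n" "2 \<le> n"
  shows "Err \<psi> \<beta> n p \<le> ereal (\<psi> (real n) * (4 / pi^2 * Apsi \<psi> n p + 2 * half_const / pi))"
proof -
  define L where "L = 4 / pi * Apsi \<psi> n p + 2 * half_const"
  obtain N1 :: nat where N1: "real n + Tmax n \<le> real N1" using real_arch_simple by blast
  have "(LBINT t:{-pi..pi}. \<bar>dev_kernel \<psi> n p N (\<beta> * pi / 2) t\<bar>) \<le> L" if "N \<ge> N1" for N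
  proof -
    have N: "real n + Tmax n \<le> real N" using N1 that by linarith
    let ?D = "dev_kernel \<psi> n p N (\<beta> * pi / 2)"
    have c: "continuous_on UNIV (\<lambda>t. \<bar>?D t\<bar>)" by (intro continuous_intros continuous_dev_kernel)
    have "(LBINT t:{-pi..pi}. \<bar>?D t\<bar>) = (LBINT t:{0..pi}. \<bar>?D t\<bar>) + (LBINT t:{0..pi}. \<bar>?D (- t)\<bar>)"
      using c by (intro LBINT_symmetric_split set_integrable_continuous_real borel_measurable_continuous_onI) auto
    also have "\<dots> \<le> (2 / pi * Apsi \<psi> n p + half_const) + (2 / pi * Apsi \<psi> n p + half_const)"
      unfolding dev_kernel_minus by (intro add_mono half_estimates p N)
    also have "\<dots> = L" by (simp add: L_def)
    finally show ?thesis .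
  qed
  from Err_le[OF in_M p(1,2) this] have "Err \<psi> \<beta> n p \<le> ereal (\<psi> (real n) * L / pi)" .
  also have "\<psi> (real n) * L / pi = \<psi> (real n) * (4 / pi^2 * Apsi \<psi> n p + 2 * half_const / pi)"
    by (simp add: L_def add_divide_distrib distrib_left power2_eq_square)
  finally show ?thesis .
qed

lemma Err_lower:
  assumes p: "1 \<le> p" "p \<le> n" "2 \<le> n"
  shows "ereal (\<psi> (real n) * (4 / pi^2 * Apsi \<psi> n p - (2 * half_const + 16 / pi * lin_const) / pi)) \<le> Err \<psi> \<beta> n p"
proof -
  define \<theta> where "\<theta> = \<beta> * pi / 2"
  define R where "R = Tmax n"
  define A where "A = 4 / pi * Apsi \<psi> n p"
  have RS: "R \<ge> 1" "real p \<ge> 1" using p by (auto simp: Tmax_def R_def)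
  have n0: "real n > 0" using p by simp
  \<comment> \<open>The square of \<open>n\<close> makes \<open>2 * n / (N + n)\<close> at most
    \<open>2 / n\<close>; the other terms put \<open>N\<close> in the range of
    \<open>half_estimates\<close>.\<close>
  obtain N :: nat where N: "real n + Tmax n + real n * real n \<le> real N" using real_arch_simple by blast
  have NT: "real n + Tmax n \<le> real N" using N by (rule order.trans[rotated]) simp
  have nN: "n < N" using NT RS by (simp add: R_def)
  let ?D = "dev_kernel \<psi> n p N \<theta>" and ?h = "test_fun n R (real p) \<theta>"
  \<comment> \<open>Reflected, since the deviation at the point \<open>0\<close> pairs the function
    with the kernel at \<open>- t\<close>.\<close>
  define h where "h t = ?h (- t)" for t
  have h: "h \<in> borel_measurable borel" "\<bar>h t\<bar> \<le> 1" for t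
  proof -
    have [measurable]: "?h \<in> borel_measurable borel" by (rule test_fun_props[OF RS])
    show "h \<in> borel_measurable borel" unfolding h_def by measurable
    show "\<bar>h t\<bar> \<le> 1" unfolding h_def by (rule test_fun_props[OF RS])
  qed
  have ih: "set_integrable lborel {-pi..pi} h"
    using h by (intro set_integrable_bounded_real[where B = 1]) auto
  have hm: "h t = test_fun n R (real p) (- \<theta>) t" "h (- t) = ?h t" for t
    unfolding h_def using test_fun_props(3)[OF RS] by auto
  define m where "m = 2 / real n"
  have m: "\<bar>LBINT t:{-pi..pi}. h t\<bar> \<le> 2 * pi * m"
  proof -
    have eq: "(LBINT t:{-pi..pi}. h t) = (LBINT t:{0..pi}. test_fun n R (real p) (- \<theta>) t) + (LBINT t:{0..pi}. ?h t)"
      using LBINT_symmetric_split[OF ih h(1)] by (simp add: hm test_fun_props(3)[OF RS])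
    have b: "\<bar>LBINT t:{0..pi}. test_fun n R (real p) \<theta> t\<bar> \<le> 2 * pi / real n" for \<theta>
      using test_fun_mean[OF RS] p by simp
    have "2 * pi * m = 2 * pi / real n + 2 * pi / real n" by (simp add: m_def)
    thus ?thesis unfolding eq using b[of \<theta>] b[of "- \<theta>"] by linarith
  qed
  have cD: "continuous_on UNIV (\<lambda>t. ?D (- t))"
    by (intro continuous_on_compose2[OF continuous_dev_kernel] continuous_intros) auto
  have X: "A - 2 * half_const \<le> (LBINT t:{-pi..pi}. h t * ?D (- t))"
  proof -
    have mD: "(\<lambda>t. ?D (- t)) \<in> borel_measurable borel" using cD by (rule borel_measurable_continuous_onI)
    have "(LBINT t:{-pi..pi}. h t * ?D (- t)) = (LBINT t:{0..pi}. h t * ?D (- t)) + (LBINT t:{0..pi}. h (- t) * ?D (- (- t)))"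
      using mD h by (intro LBINT_symmetric_split set_integrable_mult_bounded set_integrable_continuous_real cD borel_measurable_times) auto
    also have "\<dots> = (LBINT t:{0..pi}. test_fun n R (real p) (- \<theta>) t * dev_kernel \<psi> n p N (- \<theta>) t) + (LBINT t:{0..pi}. ?h t * ?D t)"
      by (simp add: hm test_fun_props(3)[OF RS] dev_kernel_minus)
    also have "\<dots> \<ge> (2 / pi * Apsi \<psi> n p - half_const) + (2 / pi * Apsi \<psi> n p - half_const)"
      unfolding R_def by (intro add_mono half_estimates p NT)
    finally show ?thesis by (simp add: A_def)
  qed
  define r where "r = (real N - real n) / ((real N + real n) * (1 + m))"
  have m0: "m \<ge> 0" by (simp add: m_def)
  have r1: "r \<le> 1" "r \<ge> 0"
  proof -
    have "real N - real n \<le> (real N + real n) * 1" by simp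
    also have "\<dots> \<le> (real N + real n) * (1 + m)" using m0 by (intro mult_left_mono) auto
    finally show "r \<le> 1" using n0 m0 by (auto simp: r_def divide_le_eq_1 intro!: mult_pos_pos)
    show "r \<ge> 0" using nN m0 by (simp add: r_def)
  qed
  \<comment> \<open>The norm of the means and the mean correction \<open>m\<close> each lose at most
    \<open>2 / n\<close>.\<close>
  have r2: "1 - r \<le> 4 / real n"
  proof -
    define x where "x = 2 * real n / (real N + real n)"
    have "real n * real n \<le> real N + real n" using N RS by (simp add: R_def)
    hence x: "x \<le> 2 / real n" unfolding x_def using n0 by (simp add: field_simps)
    have x1: "0 \<le> x" "x \<le> 1" using nN by (auto simp: x_def)
    have "r = (1 - x) / (1 + m)" unfolding r_def x_def using n0 by (simp add: field_simps)
    moreover have "1 - x - m \<le> (1 - x) / (1 + m)"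
    proof -
      have "(1 - x - m) * (1 + m) = (1 - x) - m * (x + m)" by (simp add: algebra_simps)
      also have "\<dots> \<le> 1 - x" using m0 x1 by simp
      finally show ?thesis using m0 by (simp add: le_divide_eq)
    qed
    ultimately show ?thesis using x by (simp add: m_def)
  qed
  have A_le: "(1 - r) * A \<le> 16 / pi * lin_const"
  proof -
    have "Apsi \<psi> n p \<ge> 0" unfolding Apsi_eq[OF p(1)] using cut_lo_hi[OF RS] by (intro ln_ge_zero) (auto simp: R_def)
    hence "A \<ge> 0" by (simp add: A_def)
    moreover have "A \<le> 4 / pi * (lin_const * real n)" unfolding A_def by (intro mult_left_mono Apsi_le p) auto
    ultimately have "(1 - r) * A \<le> 4 / real n * (4 / pi * (lin_const * real n))"
      using r2 r1 by (intro mult_mono) auto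
    thus ?thesis using n0 by simp
  qed
  \<comment> \<open>Its sign lets the factor \<open>1 - r\<close> be applied to \<open>A\<close>
    alone.\<close>
  have hc: "half_const \<ge> 0"
    using lin_const_ge_1 K_ge_1 by (auto simp: half_const_def kernel_bound_def intro!: add_nonneg_nonneg mult_nonneg_nonneg)
  have "A - 2 * half_const - 16 / pi * lin_const \<le> r * (A - 2 * half_const)"
  proof -
    have "(1 - r) * (A - 2 * half_const) \<le> (1 - r) * A" using r1 hc by (intro mult_left_mono) auto
    thus ?thesis using A_le by (simp add: left_diff_distrib)
  qed
  also have "\<dots> \<le> r * \<bar>LBINT t:{-pi..pi}. h t * ?D (- t)\<bar>" using X r1 by (intro mult_left_mono) auto
  finally have "\<psi> (real n) / pi * (A - 2 * half_const - 16 / pi * lin_const) \<le> \<psi> (real n) / pi * (r * \<bar>LBINT t:{-pi..pi}. h t * ?D (- t)\<bar>)"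
    using pos[of "real n"] p by (intro mult_left_mono) auto
  hence "ereal (\<psi> (real n) / pi * (A - 2 * half_const - 16 / pi * lin_const)) \<le> ereal (\<psi> (real n) / pi * r * \<bar>LBINT t:{-pi..pi}. h t * ?D (- t)\<bar>)"
    by (simp add: mult.assoc)
  also have "\<dots> \<le> Err \<psi> \<beta> n p"
    unfolding r_def \<theta>_def using h m by (intro Err_ge in_M p nN) (auto simp: \<theta>_def)
  also have "\<psi> (real n) / pi * (A - 2 * half_const - 16 / pi * lin_const) =
     \<psi> (real n) * (4 / pi^2 * Apsi \<psi> n p - (2 * half_const + 16 / pi * lin_const) / pi)"
    by (simp add: A_def field_simps power2_eq_square)
  finally show ?thesis .
qed

lemma Err_asymptotics:
  assumes p: "1 \<le> p" "p \<le> n" "2 \<le> n"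
  shows "\<exists>r. \<bar>r\<bar> \<le> (2 * half_const + 16 / pi * lin_const) / pi \<and>
    Err \<psi> \<beta> n p = ereal (\<psi> (real n) * (4 / pi^2 * Apsi \<psi> n p + r))"
proof -
  define C where "C = (2 * half_const + 16 / pi * lin_const) / pi"
  define A where "A = 4 / pi^2 * Apsi \<psi> n p"
  have \<psi>n: "\<psi> (real n) > 0" using pos p by auto
  note lower = Err_lower[OF p, of \<beta>] and upper = Err_upper[OF p, of \<beta>]
  obtain e where e: "Err \<psi> \<beta> n p = ereal e" using lower upper by (cases "Err \<psi> \<beta> n p") auto
  have "2 * half_const / pi \<le> C"
    unfolding C_def using lin_const_ge_1 by (intro divide_right_mono) auto
  hence "\<psi> (real n) * (A + 2 * half_const / pi) \<le> \<psi> (real n) * (A + C)" using \<psi>n by (intro mult_left_mono) auto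
  moreover have "e \<le> \<psi> (real n) * (A + 2 * half_const / pi)"
    using upper unfolding e A_def by simp
  ultimately have "e \<le> \<psi> (real n) * (A + C)" by linarith
  moreover have "\<psi> (real n) * (A - C) \<le> e" using lower unfolding e A_def C_def by simp
  ultimately have "A - C \<le> e / \<psi> (real n)" "e / \<psi> (real n) \<le> A + C"
    using \<psi>n by (auto simp: le_divide_eq divide_le_eq mult.commute)
  hence "\<bar>e / \<psi> (real n) - A\<bar> \<le> C" by (simp add: abs_le_iff)
  moreover have "e = \<psi> (real n) * (A + (e / \<psi> (real n) - A))" using \<psi>n by simp
  ultimately show ?thesis unfolding e A_def C_def by blast
qed

end

theorem theorem1:
  fixes \<psi> :: "real \<Rightarrow> real"
  assumes "in_F \<psi>"
  shows "\<exists>K N0. \<forall>(\<beta>::real) (n::nat) (p::nat). N0 \<le> n \<and> 1 \<le> p \<and> p \<le> n \<longrightarrow>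
           (\<exists>r. \<bar>r\<bar> \<le> K \<and> Err \<psi> \<beta> n p = ereal (\<psi> (real n) * (4 / pi^2 * Apsi \<psi> n p + r)))"
proof -
  obtain K where K: "\<forall>t\<ge>1. \<exists>D. (eta \<psi> has_real_derivative D) (at_right t) \<and> D \<le> K"
    using assms by (auto simp: in_F_def)
  \<comment> \<open>Raising the constant to at least \<open>1\<close> keeps the powers of
    \<open>K + 1\<close> and the logarithm of \<open>K + 3\<close> monotone and nonnegative in the
    estimates.\<close>
  interpret class_F \<psi> "max 1 K"
  proof
    show "in_M \<psi>" using assms by (simp add: in_F_def)
    show "\<exists>D. (eta \<psi> has_real_derivative D) (at_right t) \<and> D \<le> max 1 K" if "1 \<le> t" for t
      using K that by (meson max.coboundedI2)
  qed simp
  show ?thesis using Err_asymptotics by (intro exI[of _ "(2 * half_const + 16 / pi * lin_const) / pi"] exI[of _ 2]) auto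
qed

end
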